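(* Let $\pi:\widetilde{\Gamma}\to\Gamma$ be a dilated double cover of metric graphs, with $\Gamma$ connected. Let $h=g(\widetilde{\Gamma})-g(\Gamma)$, which is the dimension of the tropical Prym variety $\mathrm{Prym}(\widetilde{\Gamma}/\Gamma)$, and let $d(\widetilde{\Gamma}/\Gamma)$ be the number of connected components of the dilation subgraph $\Gamma_{\mathrm{dil}}\subset\Gamma$. Then \[ \mathrm{Vol}^2(\mathrm{Prym}(\widetilde{\Gamma}/\Gamma))=2^{1-d(\widetilde{\Gamma}/\Gamma)}\sum_{F\subset E(\Gamma)}4^{r(F)-1}\prod_{e\in F}\ell(e), \] where the sum is taken over all ($h$-element) ogods $F\subset E(\Gamma)$ and $r(F)$ denotes the rank of the ogod $F$.
   Context: **Graphs.** A graph $G$ has a finite non-empty vertex set $V(G)$, a finite set $H(G)$ of half-edges with a root map $r:H(G)\to V(G)$ and a fixed-point-free involution on $H(G)$ whose orbits $e=\{h,h'\}$ are the edges; $E(G)$ is the set of edges. Loops and multiple edges are allowed. The genus of a connected graph is $g(G)=b_1(G)=\#E(G)-\#V(G)+1$ (there are no vertex weights). A metric graph $\Gamma$ is a graph together with a positive length $\ell(e)$ for each edge $e$; a choice of underlying graph (model) is always fixed, and we write $V(\Gamma),E(\Gamma)$, etc. **Double covers.** A double cover $\pi:\widetilde{\Gamma}\to\Gamma$ consists of maps $V(\widetilde{\Gamma})\to V(\Gamma)$ and $H(\widetilde{\Gamma})\to H(\Gamma)$ commuting with the root maps and the edge involutions, and a degree function $d_\pi:V(\widetilde{\Gamma})\cup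 E(\widetilde{\Gamma})\to\mathbb{Z}_{>0}$ (the degree of a half-edge is that of its edge) such that: (i) for every $\widetilde{v}\in V(\widetilde{\Gamma})$ and every half-edge $h$ rooted at $\pi(\widetilde{v})$, $d_\pi(\widetilde{v})$ is the sum of $d_\pi(\widetilde{h})$ over the half-edges $\widetilde{h}$ rooted at $\widetilde{v}$ with $\pi(\widetilde{h})=h$; (ii) the degrees of the preimages of each vertex and each half-edge of $\Gamma$ sum to $2$; (iii) $\ell(\pi(\widetilde{e}))=d_\pi(\widetilde{e})\,\ell(\widetilde{e})$ for all $\widetilde{e}\in E(\widetilde{\Gamma})$. A vertex or edge of $\Gamma$ is dilated if it has a single preimage (of degree $2$), and undilated if it has two preimages (each of degree $1$). The dilated vertices and edges form the dilation subgraph $\Gamma_{\mathrm{dil}}\subset\Gamma$. The cover is dilated if $\Gamma_{\mathrm{dil}}\neq\emptyset$; when $\Gamma$ is connected, $\widetilde{\Gamma}$ is then connected too. **Ogods.** Let $h=g(\widetilde{\Gamma})-g(\Gamma)$. A set $F\subset E(\Gamma)$ of exactly $h$ edges is an ogod if no edge in $F$ is dilated and each connected component of $\Gamma\backslash F$ (the interiors of the edges in $F$ are removed, all vertices are kept) has connected preimage in $\widetilde{\Gamma}$. Its rank $r(F)$ is the number of connected components of $\Gamma\backslash F$. **Homology and the Prym variety.** Fix orientations compatible with $\pi$. $H_1(\Gamma,\mathbb{Z})\subset\mathbb{Z}^{E(\Gamma)}$ is the simplicial homology, with edge length pairing $\left[\sum a_e e,\sum b_e e\right]_\Gamma=\sum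 a_e b_e\ell(e)$; similarly for $\widetilde{\Gamma}$. The maps $\pi_*:H_1(\widetilde{\Gamma},\mathbb{Z})\to H_1(\Gamma,\mathbb{Z})$ and $\pi^*:H_1(\Gamma,\mathbb{Z})\to H_1(\widetilde{\Gamma},\mathbb{Z})$ are induced by $\pi_*(\widetilde{e})=\pi(\widetilde{e})$, and by $\pi^*(e)=2\widetilde{e}$ if $e$ is dilated with preimage $\widetilde{e}$, $\pi^*(e)=\widetilde{e}^++\widetilde{e}^-$ if $e$ is undilated with preimages $\widetilde{e}^\pm$. Let $K'=\ker\pi_*$, and let $K$ be the quotient of $\mathrm{coker}\,\pi^*$ by its torsion subgroup; both are free abelian of rank $h$. The pairing $[\cdot,\cdot]_{\widetilde{\Gamma}}$ induces a well-defined non-degenerate pairing $[\cdot,\cdot]_P:K\times K'\to\mathbb{R}$. The tropical Prym variety $\mathrm{Prym}(\widetilde{\Gamma}/\Gamma)$ is the real torus $\mathrm{Hom}(K,\mathbb{R})/K'$ with this integral structure and with a principal polarization, i.e. an isomorphism $\zeta:K'\to K$ such that $(\lambda,\mu)_P=[\zeta(\lambda),\mu]_P$ is symmetric and positive definite on $K'$. Its volume is defined by $\mathrm{Vol}^2=\det\big((\lambda_i,\lambda_j)_P\big)$ for any basis $\lambda_1,\ldots,\lambda_h$ of $K'$. Since $\zeta$ is an isomorphism of lattices, this number does not depend on $\zeta$ and equals \[ \mathrm{Vol}^2(\mathrm{Prym}(\widetilde{\Gamma}/\Gamma))=\left|\det\big([\kappa_i,\lambda_j]_P\big)_{1\le i,j\le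 h}\right| \] for any bases $\kappa_1,\ldots,\kappa_h$ of $K$ and $\lambda_1,\ldots,\lambda_h$ of $K'$; this formula is to be taken as the definition of $\mathrm{Vol}^2(\mathrm{Prym}(\widetilde{\Gamma}/\Gamma))$ (it equals $1$ if $h=0$). *)

theory Defs
  imports Complex_Main "HOL-Algebra.Free_Abelian_Groups" "Jordan_Normal_Form.Determinant"
begin

section \<open>Metric graphs\<close>

text \<open>Edges are the two-element orbits of the involution \<open>flip\<close>, represented as sets of half-edges.
  The values of \<open>rootv\<close> and \<open>flip\<close> outside \<open>halfedges\<close>, and of \<open>len\<close> outside
  the edges, are irrelevant.\<close>

record ('v, 'h) mgraph =
  vertices :: "'v set"
  halfedges :: "'h set"
  rootv :: "'h \<Rightarrow> 'v"
  flip :: "'h \<Rightarrow> 'h"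
  len :: "'h set \<Rightarrow> real"

definition edge_of :: "('v, 'h) mgraph \<Rightarrow> 'h \<Rightarrow> 'h set" where
  "edge_of G x = {x, flip G x}"

definition edges :: "('v, 'h) mgraph \<Rightarrow> 'h set set" where
  "edges G = edge_of G ` halfedges G"

locale metric_graph =
  fixes G :: "('v, 'h) mgraph"
  assumes finite_vertices: "finite (vertices G)"
    and vertices_nonempty: "vertices G \<noteq> {}"
    and finite_halfedges: "finite (halfedges G)"
    and rootv_closed: "x \<in> halfedges G \<Longrightarrow> rootv G x \<in> vertices G"
    and flip_closed: "x \<in> halfedges G \<Longrightarrow> flip G x \<in> halfedges G"
    and flip_flip: "x \<in> halfedges G \<Longrightarrow> flip G (flip G x) = x"
    and flip_neq: "x \<in> halfedges G \<Longrightarrow> flip G x \<noteq> x"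
    and len_pos: "e \<in> edges G \<Longrightarrow> len G e > 0"

definition genus :: "('v, 'h) mgraph \<Rightarrow> int" where
  "genus G = int (card (edges G)) - int (card (vertices G)) + 1"

definition adjacency :: "('v, 'h) mgraph \<Rightarrow> ('v \<times> 'v) set" where
  "adjacency G = {(rootv G x, rootv G (flip G x)) | x. x \<in> halfedges G}"

text \<open>A connected component is represented by its vertex set.\<close>

definition components :: "('v, 'h) mgraph \<Rightarrow> 'v set set" where
  "components G = vertices G // (adjacency G)\<^sup>*"

definition connected_graph :: "('v, 'h) mgraph \<Rightarrow> bool" where
  "connected_graph G \<longleftrightarrow> vertices G \<noteq> {} \<and>
     (\<forall>u \<in> vertices G. \<forall>v \<in> vertices G. (u, v) \<in> (adjacency G)\<^sup>*)"

definition component_graph :: "('v, 'h) mgraph \<Rightarrow> 'v set \<Rightarrow> ('v, 'h) mgraph" where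
  "component_graph G C = G\<lparr>vertices := C, halfedges := {x \<in> halfedges G. rootv G x \<in> C}\<rparr>"

definition delete_edges :: "('v, 'h) mgraph \<Rightarrow> 'h set set \<Rightarrow> ('v, 'h) mgraph" where
  "delete_edges G F = G\<lparr>halfedges := halfedges G - \<Union>F\<rparr>"


section \<open>Double covers\<close>

record ('w, 'k, 'v, 'h) cover =
  vmap :: "'w \<Rightarrow> 'v"
  hmap :: "'k \<Rightarrow> 'h"
  vdeg :: "'w \<Rightarrow> nat"
  edeg :: "'k set \<Rightarrow> nat"

definition emap :: "('w, 'k, 'v, 'h) cover \<Rightarrow> 'k set \<Rightarrow> 'h set" where
  "emap p e = hmap p ` e"

locale double_cover = top: metric_graph Gt + base: metric_graph G
  for Gt :: "('w, 'k) mgraph" and G :: "('v, 'h) mgraph" +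
  fixes p :: "('w, 'k, 'v, 'h) cover"
  assumes vmap_closed: "w \<in> vertices Gt \<Longrightarrow> vmap p w \<in> vertices G"
    and hmap_closed: "k \<in> halfedges Gt \<Longrightarrow> hmap p k \<in> halfedges G"
    and map_rootv: "k \<in> halfedges Gt \<Longrightarrow> vmap p (rootv Gt k) = rootv G (hmap p k)"
    and map_flip: "k \<in> halfedges Gt \<Longrightarrow> hmap p (flip Gt k) = flip G (hmap p k)"
    and vdeg_pos: "w \<in> vertices Gt \<Longrightarrow> vdeg p w > 0"
    and edeg_pos: "e \<in> edges Gt \<Longrightarrow> edeg p e > 0"
    and harmonic: "\<lbrakk>w \<in> vertices Gt; x \<in> halfedges G; rootv G x = vmap p w\<rbrakk> \<Longrightarrow>
      vdeg p w = (\<Sum>k \<in> {k \<in> halfedges Gt. rootv Gt k = w \<and> hmap p k = x}. edeg p (edge_of Gt k))"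
    and vertex_degree: "v \<in> vertices G \<Longrightarrow> (\<Sum>w \<in> {w \<in> vertices Gt. vmap p w = v}. vdeg p w) = 2"
    and halfedge_degree: "x \<in> halfedges G \<Longrightarrow>
      (\<Sum>k \<in> {k \<in> halfedges Gt. hmap p k = x}. edeg p (edge_of Gt k)) = 2"
    and map_len: "e \<in> edges Gt \<Longrightarrow> len G (emap p e) = real (edeg p e) * len Gt e"

definition vertex_fibre ::
    "('w, 'k) mgraph \<Rightarrow> ('w, 'k, 'v, 'h) cover \<Rightarrow> 'v \<Rightarrow> 'w set" where
  "vertex_fibre Gt p v = {w \<in> vertices Gt. vmap p w = v}"

definition edge_fibre ::
    "('w, 'k) mgraph \<Rightarrow> ('w, 'k, 'v, 'h) cover \<Rightarrow> 'h set \<Rightarrow> 'k set set" where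
  "edge_fibre Gt p e = {et \<in> edges Gt. emap p et = e}"

definition dilated_vertex ::
    "('w, 'k) mgraph \<Rightarrow> ('w, 'k, 'v, 'h) cover \<Rightarrow> 'v \<Rightarrow> bool" where
  "dilated_vertex Gt p v \<longleftrightarrow> card (vertex_fibre Gt p v) = 1"

definition dilated_edge ::
    "('w, 'k) mgraph \<Rightarrow> ('w, 'k, 'v, 'h) cover \<Rightarrow> 'h set \<Rightarrow> bool" where
  "dilated_edge Gt p e \<longleftrightarrow> card (edge_fibre Gt p e) = 1"

definition dilation_subgraph ::
    "('w, 'k) mgraph \<Rightarrow> ('v, 'h) mgraph \<Rightarrow> ('w, 'k, 'v, 'h) cover \<Rightarrow> ('v, 'h) mgraph" where
  "dilation_subgraph Gt G p = G\<lparr>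
     vertices := {v \<in> vertices G. dilated_vertex Gt p v},
     halfedges := {x \<in> halfedges G. dilated_edge Gt p (edge_of G x)}\<rparr>"

text \<open>The ends of a dilated edge are dilated, so the dilation subgraph is empty exactly when it has
  no vertices.\<close>

definition dilated_cover ::
    "('w, 'k) mgraph \<Rightarrow> ('v, 'h) mgraph \<Rightarrow> ('w, 'k, 'v, 'h) cover \<Rightarrow> bool" where
  "dilated_cover Gt G p \<longleftrightarrow> vertices (dilation_subgraph Gt G p) \<noteq> {}"

definition preimage_graph ::
    "('w, 'k) mgraph \<Rightarrow> ('w, 'k, 'v, 'h) cover \<Rightarrow> ('v, 'h) mgraph \<Rightarrow> ('w, 'k) mgraph" where
  "preimage_graph Gt p S = Gt\<lparr>
     vertices := {w \<in> vertices Gt. vmap p w \<in> vertices S},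
     halfedges := {k \<in> halfedges Gt. hmap p k \<in> halfedges S}\<rparr>"


section \<open>Ogods\<close>

text \<open>The genus difference is nonnegative for every double cover considered here (connected base,
  nonempty dilation), so \<open>nat\<close> does not truncate.\<close>

definition prym_dim :: "('w, 'k) mgraph \<Rightarrow> ('v, 'h) mgraph \<Rightarrow> nat" where
  "prym_dim Gt G = nat (genus Gt - genus G)"

definition ogod ::
    "('w, 'k) mgraph \<Rightarrow> ('v, 'h) mgraph \<Rightarrow> ('w, 'k, 'v, 'h) cover \<Rightarrow> 'h set set \<Rightarrow> bool" where
  "ogod Gt G p F \<longleftrightarrow> F \<subseteq> edges G \<and> card F = prym_dim Gt G \<and>
     (\<forall>e \<in> F. \<not> dilated_edge Gt p e) \<and>
     (\<forall>C \<in> components (delete_edges G F).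
        connected_graph (preimage_graph Gt p (component_graph (delete_edges G F) C)))"

definition ogod_rank :: "('v, 'h) mgraph \<Rightarrow> 'h set set \<Rightarrow> nat" where
  "ogod_rank G F = card (components (delete_edges G F))"


section \<open>Simplicial homology\<close>

text \<open>An orientation is a set containing exactly one half-edge of each edge; the edge is directed
  from the root of that half-edge to the root of the other one.\<close>

definition orientation :: "('v, 'h) mgraph \<Rightarrow> 'h set \<Rightarrow> bool" where
  "orientation G A \<longleftrightarrow> A \<subseteq> halfedges G \<and> (\<forall>x \<in> halfedges G. x \<in> A \<longleftrightarrow> flip G x \<notin> A)"

definition compatible_orientation ::
    "('w, 'k) mgraph \<Rightarrow> ('w, 'k, 'v, 'h) cover \<Rightarrow> 'k set \<Rightarrow> 'h set \<Rightarrow> bool" where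
  "compatible_orientation Gt p At A \<longleftrightarrow> (\<forall>k \<in> halfedges Gt. k \<in> At \<longleftrightarrow> hmap p k \<in> A)"

definition boundary :: "('v, 'h) mgraph \<Rightarrow> 'h set \<Rightarrow> ('h set \<Rightarrow>\<^sub>0 int) \<Rightarrow> ('v \<Rightarrow>\<^sub>0 int)" where
  "boundary G A = frag_extend
     (\<lambda>e. let x = the_elem (e \<inter> A) in frag_of (rootv G (flip G x)) - frag_of (rootv G x))"

definition H1 :: "('v, 'h) mgraph \<Rightarrow> 'h set \<Rightarrow> ('h set \<Rightarrow>\<^sub>0 int) monoid" where
  "H1 G A = (free_Abelian_group (edges G))\<lparr>carrier :=
     kernel (free_Abelian_group (edges G)) (free_Abelian_group (vertices G)) (boundary G A)\<rparr>"

definition edge_pairing ::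
    "('v, 'h) mgraph \<Rightarrow> ('h set \<Rightarrow>\<^sub>0 int) \<Rightarrow> ('h set \<Rightarrow>\<^sub>0 int) \<Rightarrow> real" where
  "edge_pairing G a b = (\<Sum>e \<in> edges G.
     real_of_int (Poly_Mapping.lookup a e) * real_of_int (Poly_Mapping.lookup b e) * len G e)"

definition pushforward ::
    "('w, 'k, 'v, 'h) cover \<Rightarrow> ('k set \<Rightarrow>\<^sub>0 int) \<Rightarrow> ('h set \<Rightarrow>\<^sub>0 int)" where
  "pushforward p = frag_extend (\<lambda>et. frag_of (emap p et))"

definition pullback ::
    "('w, 'k) mgraph \<Rightarrow> ('w, 'k, 'v, 'h) cover \<Rightarrow> ('h set \<Rightarrow>\<^sub>0 int) \<Rightarrow> ('k set \<Rightarrow>\<^sub>0 int)" where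
  "pullback Gt p = frag_extend
     (\<lambda>e. let s = (\<Sum>et \<in> edge_fibre Gt p e. frag_of et)
          in if dilated_edge Gt p e then frag_cmul 2 s else s)"


section \<open>The tropical Prym variety\<close>

definition torsion :: "('a, 'm) monoid_scheme \<Rightarrow> 'a set" where
  "torsion M = {x \<in> carrier M. \<exists>n::nat. n > 0 \<and> x [^]\<^bsub>M\<^esub> n = \<one>\<^bsub>M\<^esub>}"

definition Z_basis :: "('a, 'm) monoid_scheme \<Rightarrow> nat \<Rightarrow> (nat \<Rightarrow> 'a) \<Rightarrow> bool" where
  "Z_basis M n b \<longleftrightarrow> (\<forall>i < n. b i \<in> carrier M) \<and>
     (\<forall>x \<in> carrier M. \<exists>!c. c \<in> {..<n} \<rightarrow>\<^sub>E (UNIV :: int set) \<and>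
        x = (\<Otimes>\<^bsub>M\<^esub>i \<in> {..<n}. b i [^]\<^bsub>M\<^esub> c i))"

definition prym_K' ::
    "('w, 'k) mgraph \<Rightarrow> ('v, 'h) mgraph \<Rightarrow> ('w, 'k, 'v, 'h) cover \<Rightarrow> 'k set \<Rightarrow> 'h set \<Rightarrow>
     ('k set \<Rightarrow>\<^sub>0 int) monoid" where
  "prym_K' Gt G p At A =
     (H1 Gt At)\<lparr>carrier := kernel (H1 Gt At) (H1 G A) (pushforward p)\<rparr>"

definition coker_pullback ::
    "('w, 'k) mgraph \<Rightarrow> ('v, 'h) mgraph \<Rightarrow> ('w, 'k, 'v, 'h) cover \<Rightarrow> 'k set \<Rightarrow> 'h set \<Rightarrow>
     ('k set \<Rightarrow>\<^sub>0 int) set monoid" where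
  "coker_pullback Gt G p At A = H1 Gt At Mod (pullback Gt p ` carrier (H1 G A))"

definition prym_K ::
    "('w, 'k) mgraph \<Rightarrow> ('v, 'h) mgraph \<Rightarrow> ('w, 'k, 'v, 'h) cover \<Rightarrow> 'k set \<Rightarrow> 'h set \<Rightarrow>
     ('k set \<Rightarrow>\<^sub>0 int) set set monoid" where
  "prym_K Gt G p At A =
     coker_pullback Gt G p At A Mod torsion (coker_pullback Gt G p At A)"

text \<open>An element \<open>\<kappa>\<close> of \<open>K\<close> is a coset of cosets, so \<open>\<Union>\<kappa>\<close> is the set of its representatives in
  \<open>H1 Gt At\<close>; the pairing is the common value on all of them.\<close>

definition prym_pairing ::
    "('w, 'k) mgraph \<Rightarrow> ('k set \<Rightarrow>\<^sub>0 int) set set \<Rightarrow> ('k set \<Rightarrow>\<^sub>0 int) \<Rightarrow> real" where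
  "prym_pairing Gt \<kappa> \<mu> = (THE r. \<forall>c \<in> \<Union>\<kappa>. edge_pairing Gt c \<mu> = r)"

text \<open>The squared volume is the common value over all choices of bases.\<close>

definition prym_vol2 ::
    "('w, 'k) mgraph \<Rightarrow> ('v, 'h) mgraph \<Rightarrow> ('w, 'k, 'v, 'h) cover \<Rightarrow> 'k set \<Rightarrow> 'h set \<Rightarrow> real" where
  "prym_vol2 Gt G p At A = (THE r. \<exists>\<kappa> \<mu>.
     Z_basis (prym_K Gt G p At A) (prym_dim Gt G) \<kappa> \<and>
     Z_basis (prym_K' Gt G p At A) (prym_dim Gt G) \<mu> \<and>
     r = \<bar>det (mat (prym_dim Gt G) (prym_dim Gt G)
                 (\<lambda>(i, j). prym_pairing Gt (\<kappa> i) (\<mu> j)))\<bar>)"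

end

theory Submission
  imports Defs
begin

text \<open>Let \<open>U\<close> and \<open>Vu\<close> be the undilated edges and vertices. Sending a cycle upstairs to its anti-invariant
  part, with one coordinate for every element of \<open>U\<close>, identifies \<open>K'\<close> with the kernel \<open>M\<close> of a signed
  incidence matrix \<open>B\<close> with rows \<open>Vu\<close> and columns \<open>U\<close>, and \<open>K\<close> with the sublattice \<open>L\<close> of those elements of
  \<open>M\<close> that meet every dilation component an even number of times. A spanning tree of the graph obtained
  by contracting the dilation components gives a basis of \<open>M\<close> in which \<open>L\<close> is diagonal of index
  \<open>2^(d-1)\<close>, and a unimodular section of \<open>B\<close>. Hence the squared volume is \<open>2^(d-1)\<close> times the Gram
  determinant of \<open>M\<close>, which equals \<open>det W * det (B W^-1 B^T)\<close> for the diagonal matrix \<open>W\<close> of edge lengths.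
  By Cauchy-Binet it remains to evaluate the maximal minors of \<open>B\<close>: the one with columns \<open>U - F\<close>
  vanishes unless \<open>F\<close> is an ogod, and then it is \<open>2^(r(F)-d)\<close> up to sign.\<close>

section \<open>Matrices indexed by lists, and the Cauchy-Binet formula\<close>

text \<open>The two lattices are read in different coordinates. An element of \<open>K'\<close> is
  anti-invariant and is recorded by one of its two coefficients over each undilated edge; a class in
  \<open>K\<close> is recorded by the difference of the two coefficients. With this choice the
  pairing is the plain length-weighted sum of products, without a factor 2, and invariant cycles,
  whose classes are exactly the torsion of the cokernel, disappear. The parity condition is the
  obstruction to lifting: a vector of differences fixes a chain upstairs only up to invariant
  chains, and over a dilation component the boundary of an invariant chain has even total degree.
  Only \<open>d - 1\<close> parities are imposed, because the total boundary is zero and undilated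
  vertices contribute in pairs. Dilation enters a second time through the spanning tree: its root is
  a dilation component, so that every undilated vertex is a non-root and \<open>B\<close> has full
  row rank even over the integers. The constants meet in
  \<open>2^(d-1) * 4^(r-d) = 2^(1-d) * 4^(r-1)\<close>.\<close>

definition list_mat :: "'a list \<Rightarrow> 'b list \<Rightarrow> ('a \<Rightarrow> 'b \<Rightarrow> 'c) \<Rightarrow> 'c mat" where
  "list_mat xs ys f = mat (length xs) (length ys) (\<lambda>(i, j). f (xs ! i) (ys ! j))"

lemma list_mat_carrier [simp]: "list_mat xs ys f \<in> carrier_mat (length xs) (length ys)"
  by (simp add: list_mat_def)

lemma list_mat_dim [simp]:
  "dim_row (list_mat xs ys f) = length xs" "dim_col (list_mat xs ys f) = length ys"
  by (simp_all add: list_mat_def)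

lemma list_mat_index [simp]:
  "i < length xs \<Longrightarrow> j < length ys \<Longrightarrow> list_mat xs ys f $$ (i, j) = f (xs ! i) (ys ! j)"
  by (simp add: list_mat_def)

lemma list_mat_cong:
  "(\<And>x y. x \<in> set xs \<Longrightarrow> y \<in> set ys \<Longrightarrow> f x y = g x y) \<Longrightarrow> list_mat xs ys f = list_mat xs ys g"
  by (rule eq_matI) auto

lemma list_mat_mult:
  fixes f :: "'a \<Rightarrow> 'b \<Rightarrow> 'd::comm_ring_1"
  assumes "distinct ys"
  shows "list_mat xs ys f * list_mat ys zs g = list_mat xs zs (\<lambda>x z. \<Sum>y\<in>set ys. f x y * g y z)"
proof (rule eq_matI)
  fix i j assume ij: "i < dim_row (list_mat xs zs (\<lambda>x z. \<Sum>y\<in>set ys. f x y * g y z))"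
    "j < dim_col (list_mat xs zs (\<lambda>x z. \<Sum>y\<in>set ys. f x y * g y z))"
  have "(\<Sum>y\<in>set ys. f (xs ! i) y * g y (zs ! j))
      = (\<Sum>k<length ys. f (xs ! i) (ys ! k) * g (ys ! k) (zs ! j))"
    using sum.reindex_bij_betw[OF bij_betw_nth[OF assms refl refl],
        of "\<lambda>y. f (xs ! i) y * g y (zs ! j)"] by simp
  with ij show "(list_mat xs ys f * list_mat ys zs g) $$ (i, j)
      = list_mat xs zs (\<lambda>x z. \<Sum>y\<in>set ys. f x y * g y z) $$ (i, j)"
    by (simp add: scalar_prod_def lessThan_atLeast0)
qed auto

lemma list_mat_one: "distinct xs \<Longrightarrow> list_mat xs xs (\<lambda>x y. if x = y then 1 else 0) = 1\<^sub>m (length xs)"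
  by (rule eq_matI) (auto simp: nth_eq_iff_index_eq)

lemma list_mat_transpose: "transpose_mat (list_mat xs ys f) = list_mat ys xs (\<lambda>y x. f x y)"
  by (rule eq_matI) auto

lemma list_mat_map: "list_mat (map g xs) (map h ys) f = list_mat xs ys (\<lambda>x y. f (g x) (h y))"
  by (rule eq_matI) auto

lemma list_mat_append: "list_mat (xs @ ys) (zs @ ws) f =
   four_block_mat (list_mat xs zs f) (list_mat xs ws f) (list_mat ys zs f) (list_mat ys ws f)"
  by (rule eq_matI) (auto simp: nth_append)

lemma det_list_mat_transpose:
  "length xs = length ys \<Longrightarrow> det (list_mat ys xs (\<lambda>y x. f x y)) = det (list_mat xs ys f)"
  using det_transpose[of "list_mat xs ys f" "length xs"] list_mat_carrier[of xs ys f]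
  by (simp add: list_mat_transpose)

lemma det_list_mat_mult:
  assumes "distinct ys" "length ys = length xs" "length zs = length xs"
  shows "det (list_mat xs zs (\<lambda>x z. \<Sum>y\<in>set ys. f x y * g y z))
    = det (list_mat xs ys f) * det (list_mat ys zs g)"
  using det_mult[of "list_mat xs ys f" "length xs" "list_mat ys zs g"]
    list_mat_carrier[of xs ys f] list_mat_carrier[of ys zs g] assms
  by (simp add: list_mat_mult)

lemma det_list_mat_one: "distinct xs \<Longrightarrow> det (list_mat xs xs (\<lambda>x y. if x = y then 1 else 0)) = 1"
  by (simp add: list_mat_one)

lemma det_list_mat_diag:
  assumes "distinct xs"
  shows "det (list_mat xs xs (\<lambda>x y. if x = y then d x else 0)) = (\<Prod>x\<in>set xs. d x)"
proof -
  have "det (list_mat xs xs (\<lambda>x y. if x = y then d x else 0))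
      = prod_list (diag_mat (list_mat xs xs (\<lambda>x y. if x = y then d x else 0)))"
    by (rule det_upper_triangular) (auto simp: upper_triangular_def assms nth_eq_iff_index_eq)
  also have "diag_mat (list_mat xs xs (\<lambda>x y. if x = y then d x else 0)) = map d xs"
    by (rule nth_equalityI) (auto simp: diag_mat_def)
  also have "prod_list (map d xs) = (\<Prod>x\<in>set xs. d x)"
    using assms by (simp add: prod.distinct_set_conv_list)
  finally show ?thesis .
qed

lemma det_list_mat_of_int:
  "det (list_mat xs ys (\<lambda>x y. of_int (f x y))) = (of_int (det (list_mat xs ys f)) :: real)"
proof -
  have "list_mat xs ys (\<lambda>x y. of_int (f x y)) = map_mat (of_int :: int \<Rightarrow> real) (list_mat xs ys f)"
    by (rule eq_matI) auto
  then show ?thesis by (simp add: of_int_hom.hom_det)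
qed

text \<open>Tagging the indices by \<open>Inl\<close> and \<open>Inr\<close> lets a block matrix be
  a single function on a sum type, even when the two blocks are indexed by different types such as
  vertices and edges.\<close>

lemma det_list_mat_block_upper:
  fixes f :: "'a + 'b \<Rightarrow> 'a + 'b \<Rightarrow> 'd::idom"
  assumes "\<And>x y. x \<in> set xs \<Longrightarrow> y \<in> set ys \<Longrightarrow> f (Inl x) (Inr y) = 0"
  shows "det (list_mat (map Inl xs @ map Inr ys) (map Inl xs @ map Inr ys) f)
    = det (list_mat xs xs (\<lambda>x y. f (Inl x) (Inl y))) * det (list_mat ys ys (\<lambda>x y. f (Inr x) (Inr y)))"
proof -
  have "list_mat xs ys (\<lambda>x y. f (Inl x) (Inr y)) = 0\<^sub>m (length xs) (length ys)"
    by (rule eq_matI) (auto simp: assms)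
  then show ?thesis
    unfolding list_mat_append list_mat_map
    by (intro det_four_block_mat_upper_right_zero) auto
qed

text \<open>Expanding the entries turns the determinant into a sum over maps \<open>f\<close> from
  row positions to columns. A non-injective map gives a determinant with two equal rows; the
  injective ones are grouped by their image \<open>T\<close>. The ordering \<open>es T\<close>
  enters both minors, so its choice does not affect the summand.\<close>

lemma cauchy_binet:
  fixes B C :: "'v \<Rightarrow> 'u \<Rightarrow> 'd::idom" and g :: "'u \<Rightarrow> 'd"
  assumes "finite U" and es: "\<And>T. T \<subseteq> U \<Longrightarrow> set (es T) = T \<and> distinct (es T)"
  shows "det (list_mat vs vs (\<lambda>v w. \<Sum>e\<in>U. B v e * g e * C w e))
    = (\<Sum>T | T \<subseteq> U \<and> card T = length vs.
        (\<Prod>e\<in>T. g e) * det (list_mat vs (es T) B) * det (list_mat vs (es T) C))"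
proof -
  define n where "n = length vs"
  define F where "F = {0..<n} \<rightarrow>\<^sub>E U"
  define P where "P = {p. p permutes {0..<n}}"
  define D where "D f = det (mat n n (\<lambda>(i, j). C (vs ! j) (f i)))" for f :: "nat \<Rightarrow> 'u"
  define W where "W f = (\<Prod>i=0..<n. B (vs ! i) (f i)) * (\<Prod>i=0..<n. g (f i)) * D f" for f
  have finF: "finite F" unfolding F_def by (intro finite_PiE) (auto simp: assms)
  have D: "D f = (\<Sum>p\<in>P. signof p * (\<Prod>i=0..<n. C (vs ! p i) (f i)))" for f
    unfolding D_def P_def by (subst det_def'[of _ n]) (auto intro!: sum.cong prod.cong simp: permutes_in_image)
  have "det (list_mat vs vs (\<lambda>v w. \<Sum>e\<in>U. B v e * g e * C w e))
      = (\<Sum>p\<in>P. signof p * (\<Prod>i=0..<n. \<Sum>e\<in>U. B (vs ! i) e * g e * C (vs ! p i) e))"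
    unfolding P_def n_def by (subst det_def'[of _ "length vs"])
      (auto intro!: sum.cong prod.cong simp: permutes_in_image)
  also have "\<dots> = (\<Sum>p\<in>P. signof p * (\<Sum>f\<in>F. \<Prod>i=0..<n. B (vs ! i) (f i) * g (f i) * C (vs ! p i) (f i)))"
    unfolding F_def by (subst prod_sum_PiE) (auto simp: assms)
  also have "\<dots> = (\<Sum>p\<in>P. \<Sum>f\<in>F. (\<Prod>i=0..<n. B (vs ! i) (f i)) * (\<Prod>i=0..<n. g (f i)) *
      (signof p * (\<Prod>i=0..<n. C (vs ! p i) (f i))))"
    by (simp add: sum_distrib_left prod.distrib ac_simps)
  also have "\<dots> = (\<Sum>f\<in>F. W f)"
    by (subst sum.swap) (simp add: W_def D sum_distrib_left)
  also have "\<dots> = (\<Sum>f\<in>{f\<in>F. inj_on f {0..<n}}. W f)"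
  proof (rule sum.mono_neutral_right[OF finF], safe)
    fix f assume "f \<in> F" "W f \<noteq> 0" then have "D f \<noteq> 0" by (auto simp: W_def)
    show "inj_on f {0..<n}"
    proof (rule inj_onI, rule ccontr)
      fix i j assume ij: "i \<in> {0..<n}" "j \<in> {0..<n}" "f i = f j" "i \<noteq> j"
      have "D f = 0" unfolding D_def
        by (rule det_identical_rows[of _ n i j]) (use ij in auto)
      with \<open>D f \<noteq> 0\<close> show False ..
    qed
  qed
  also have "\<dots> = (\<Sum>T | T \<subseteq> U \<and> card T = n.
      \<Sum>f\<in>{f\<in>{f\<in>F. inj_on f {0..<n}}. f ` {0..<n} = T}. W f)"
  proof (rule sum.group[symmetric])
    show "finite {f\<in>F. inj_on f {0..<n}}" using finF by simp
    show "(\<lambda>f. f ` {0..<n}) ` {f\<in>F. inj_on f {0..<n}} \<subseteq> {T. T \<subseteq> U \<and> card T = n}"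
      by (auto simp: F_def card_image)
  qed (use assms(1) in simp)
  also have "\<dots> = (\<Sum>T | T \<subseteq> U \<and> card T = n.
      (\<Prod>e\<in>T. g e) * det (list_mat vs (es T) B) * det (list_mat vs (es T) C))"
  proof (rule sum.cong[OF refl])
    fix T assume "T \<in> {T. T \<subseteq> U \<and> card T = n}"
    then have T: "T \<subseteq> U" "n = card T" by auto
    define xs where "xs = es T"
    have xs: "distinct xs" "set xs = T" "length xs = n"
      using es[OF T(1)] distinct_card[of xs] T(2) by (auto simp: xs_def)
    have bx: "bij_betw ((!) xs) {0..<n} T"
      using bij_betw_nth[OF xs(1) refl refl] xs by (simp add: lessThan_atLeast0)
    \<comment> \<open>The injective maps with image \<open>T\<close> are the fixed enumeration
      \<open>xs\<close> of \<open>T\<close> composed with the permutations of the positions.\<close>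
    define \<Phi> where "\<Phi> q = restrict (\<lambda>i. xs ! q i) {0..<n}" for q :: "nat \<Rightarrow> nat"
    have \<Phi>: "bij_betw \<Phi> P {f\<in>{f\<in>F. inj_on f {0..<n}}. f ` {0..<n} = T}"
      unfolding bij_betw_def
    proof (intro conjI subset_antisym subsetI inj_onI)
      fix q r assume qr: "q \<in> P" "r \<in> P" and eq: "\<Phi> q = \<Phi> r"
      show "q = r"
      proof
        fix i show "q i = r i"
        proof (cases "i < n")
          case True
          then have "xs ! q i = xs ! r i" using fun_cong[OF eq, of i] by (simp add: \<Phi>_def)
          moreover have "q i < n" "r i < n"
            using qr True permutes_in_image by (fastforce simp: P_def)+
          ultimately show ?thesis using xs by (simp add: nth_eq_iff_index_eq)
        next
          case False
          then show ?thesis using qr by (simp add: P_def permutes_def)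
        qed
      qed
    next
      fix f assume "f \<in> \<Phi> ` P"
      then obtain q where q: "q permutes {0..<n}" and f: "f = \<Phi> q" by (auto simp: P_def)
      have b: "bij_betw (\<lambda>i. xs ! q i) {0..<n} T"
        using bij_betw_trans[OF permutes_imp_bij[OF q] bx] by (simp add: comp_def)
      then have "bij_betw f {0..<n} T"
        unfolding f \<Phi>_def by (simp add: bij_betw_def inj_on_def)
      moreover have "f \<in> {0..<n} \<rightarrow>\<^sub>E T"
        unfolding f \<Phi>_def using bij_betw_apply[OF b] by auto
      ultimately show "f \<in> {f\<in>{f\<in>F. inj_on f {0..<n}}. f ` {0..<n} = T}"
        using T by (auto simp: F_def bij_betw_def)
    next
      fix f assume f: "f \<in> {f\<in>{f\<in>F. inj_on f {0..<n}}. f ` {0..<n} = T}"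
      define q where "q i = (if i \<in> {0..<n} then inv_into {0..<n} ((!) xs) (f i) else i)" for i
      have bf: "bij_betw f {0..<n} T" using f by (simp add: bij_betw_def)
      have "bij_betw (inv_into {0..<n} ((!) xs) \<circ> f) {0..<n} {0..<n}"
        by (rule bij_betw_trans[OF bf bij_betw_inv_into[OF bx]])
      then have "bij_betw q {0..<n} {0..<n}"
        by (subst bij_betw_cong[of _ q "inv_into {0..<n} ((!) xs) \<circ> f"]) (simp_all add: q_def)
      then have q: "q \<in> P"
        unfolding P_def by (auto intro!: bij_imp_permutes simp: q_def)
      have "f i = \<Phi> q i" for i
      proof (cases "i \<in> {0..<n}")
        case True
        then have "f i \<in> T" using bf by (auto simp: bij_betw_def)
        then have "xs ! inv_into {0..<n} ((!) xs) (f i) = f i"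
          using bij_betw_inv_into_right[OF bx] by blast
        then show ?thesis using True by (simp add: \<Phi>_def q_def)
      next
        case False
        moreover have "f \<in> {0..<n} \<rightarrow>\<^sub>E U" using f unfolding F_def by blast
        ultimately have "f i = undefined" by (rule PiE_arb[rotated])
        then show ?thesis using \<open>i \<notin> {0..<n}\<close> by (simp add: \<Phi>_def)
      qed
      then have "f = \<Phi> q" by (rule ext)
      then show "f \<in> \<Phi> ` P" using q by blast
    qed
    have "(\<Sum>f\<in>{f\<in>{f\<in>F. inj_on f {0..<n}}. f ` {0..<n} = T}. W f) = (\<Sum>q\<in>P. W (\<Phi> q))"
      by (rule sum.reindex_bij_betw[OF \<Phi>, symmetric])
    also have "\<dots> = (\<Sum>q\<in>P. (\<Prod>e\<in>T. g e) *
        (signof q * (\<Prod>i=0..<n. B (vs ! i) (xs ! q i))) * det (list_mat vs xs C))"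
    proof (rule sum.cong[OF refl])
      fix q assume "q \<in> P"
      then have q: "q permutes {0..<n}" by (simp add: P_def)
      then have qn: "q i < n" if "i < n" for i using permutes_in_image that by fastforce
      have b: "bij_betw (\<lambda>i. xs ! q i) {0..<n} T"
        using bij_betw_trans[OF permutes_imp_bij[OF q] bx] by (simp add: comp_def)
      have 1: "(\<Prod>i=0..<n. g (\<Phi> q i)) = (\<Prod>e\<in>T. g e)"
        using prod.reindex_bij_betw[OF b, of g] by (simp add: \<Phi>_def)
      \<comment> \<open>Undoing \<open>q\<close> in the rows costs its sign, and this sign together
        with the remaining product is one term of the Leibniz expansion of the minor of
        \<open>B\<close>.\<close>
      have "D (\<Phi> q) = det (mat n n (\<lambda>(i, j). list_mat xs vs (\<lambda>e v. C v e) $$ (q i, j)))"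
        unfolding D_def by (rule arg_cong[of _ _ det], rule eq_matI)
          (auto simp: \<Phi>_def xs n_def[symmetric] qn)
      also have "\<dots> = signof q * det (list_mat xs vs (\<lambda>e v. C v e))"
        by (rule det_permute_rows[OF _ q]) (use list_mat_carrier[of xs vs] xs in \<open>auto simp: n_def\<close>)
      also have "det (list_mat xs vs (\<lambda>e v. C v e)) = det (list_mat vs xs C)"
        by (rule det_list_mat_transpose) (simp add: xs n_def)
      finally have 2: "D (\<Phi> q) = signof q * det (list_mat vs xs C)" .
      have 3: "(\<Prod>i=0..<n. B (vs ! i) (\<Phi> q i)) = (\<Prod>i=0..<n. B (vs ! i) (xs ! q i))"
        by (simp add: \<Phi>_def)
      show "W (\<Phi> q) = (\<Prod>e\<in>T. g e) *
          (signof q * (\<Prod>i=0..<n. B (vs ! i) (xs ! q i))) * det (list_mat vs xs C)"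
        by (simp only: W_def 1 2 3 ac_simps)
    qed
    also have "\<dots> = (\<Prod>e\<in>T. g e) * det (list_mat vs xs B) * det (list_mat vs xs C)"
      unfolding sum_distrib_right[symmetric] sum_distrib_left[symmetric]
      by (subst det_def'[of "list_mat vs xs B" n])
        (use list_mat_carrier[of vs xs B] xs in
          \<open>auto simp: P_def n_def permutes_in_image intro!: sum.cong prod.cong\<close>)
    finally show "(\<Sum>f\<in>{f\<in>{f\<in>F. inj_on f {0..<n}}. f ` {0..<n} = T}. W f)
      = (\<Prod>e\<in>T. g e) * det (list_mat vs (es T) B) * det (list_mat vs (es T) C)"
      by (simp add: xs_def)
  qed
  finally show ?thesis by (simp add: n_def)
qed

section \<open>Gram determinants and lattice bases\<close>

text \<open>With \<open>W = diag g\<close>, the block matrix \<open>P = (B; L^T W)\<close> satisfies \<open>P (S | L) = (1, 0; *, L^T W L)\<close> and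
  \<open>(B; C) (W^-1 P^T) = (B W^-1 B^T, 0; *, 1)\<close>, while \<open>(B; C)\<close> and \<open>(S | L)\<close> are mutually inverse
  integer matrices.\<close>

lemma gram_det:
  fixes B :: "'v \<Rightarrow> 'u \<Rightarrow> int" and C :: "'j \<Rightarrow> 'u \<Rightarrow> int"
    and S :: "'u \<Rightarrow> 'v \<Rightarrow> int" and L :: "'u \<Rightarrow> 'j \<Rightarrow> int" and g :: "'u \<Rightarrow> real"
  assumes dist: "distinct vs" "distinct js" "distinct us" and len: "length us = length vs + length js"
    and g: "\<And>u. u \<in> set us \<Longrightarrow> g u \<noteq> 0"
    and BS: "\<And>v w. v \<in> set vs \<Longrightarrow> w \<in> set vs \<Longrightarrow> (\<Sum>u\<in>set us. B v u * S u w) = (if v = w then 1 else 0)"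
    and BL: "\<And>v j. v \<in> set vs \<Longrightarrow> j \<in> set js \<Longrightarrow> (\<Sum>u\<in>set us. B v u * L u j) = 0"
    and CS: "\<And>j v. j \<in> set js \<Longrightarrow> v \<in> set vs \<Longrightarrow> (\<Sum>u\<in>set us. C j u * S u v) = 0"
    and CL: "\<And>i j. i \<in> set js \<Longrightarrow> j \<in> set js \<Longrightarrow> (\<Sum>u\<in>set us. C i u * L u j) = (if i = j then 1 else 0)"
  shows "det (list_mat js js (\<lambda>i j. \<Sum>u\<in>set us. of_int (L u i) * g u * of_int (L u j)))
    = (\<Prod>u\<in>set us. g u) *
      det (list_mat vs vs (\<lambda>v w. \<Sum>u\<in>set us. of_int (B v u) * (1 / g u) * of_int (B w u)))"
    (is "det ?G = _ * det ?H")
proof -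
  define ws where "ws = map Inl vs @ map (Inr :: 'j \<Rightarrow> 'v + 'j) js"
  define Qi where "Qi = case_sum B C"
  define Q where "Q u = case_sum (S u) (L u)" for u
  define P where "P = case_sum (\<lambda>v u. of_int (B v u)) (\<lambda>j u. of_int (L u j) * g u)"
  define R where "R u = case_sum (\<lambda>v. of_int (B v u) * (1 / g u)) (\<lambda>j. of_int (L u j))" for u
  define q qi where "q = det (list_mat us ws Q)" and "qi = det (list_mat ws us Qi)"
  have dw: "distinct ws" using dist by (auto simp: ws_def distinct_map inj_on_def)
  have lw: "length us = length ws" using len by (simp add: ws_def)
  have "qi * q = det (list_mat ws ws (\<lambda>x z. \<Sum>u\<in>set us. Qi x u * Q u z))"
    unfolding q_def qi_def by (rule det_list_mat_mult[symmetric]) (use dist lw in auto)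
  also have "\<dots> = det (list_mat ws ws (\<lambda>x z. if x = z then 1 else 0))"
    by (rule arg_cong[of _ _ det], rule list_mat_cong)
      (auto simp: ws_def Qi_def Q_def BS BL CS CL split: if_splits)
  finally have qiq: "qi * q = 1" by (simp add: det_list_mat_one dw)
  \<comment> \<open>Integers with product 1 are equal to the same sign, so the two base changes
    contribute a factor \<open>q * q = 1\<close> at the end.\<close>
  then have "q = qi" "q * q = 1" by (auto simp: zmult_eq_1_iff)
  have 1: "det (list_mat ws us P) * of_int q = det ?G"
  proof -
    have "det (list_mat ws us P) * of_int q
        = det (list_mat ws ws (\<lambda>x z. \<Sum>u\<in>set us. P x u * of_int (Q u z)))"
      unfolding q_def det_list_mat_of_int[symmetric]
      by (rule det_list_mat_mult[symmetric]) (use dist lw in auto)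
    also have "\<dots> = det (list_mat vs vs (\<lambda>v w. \<Sum>u\<in>set us. P (Inl v) u * of_int (Q u (Inl w)))) *
        det (list_mat js js (\<lambda>i j. \<Sum>u\<in>set us. P (Inr i) u * of_int (Q u (Inr j))))"
      unfolding ws_def
    proof (rule det_list_mat_block_upper)
      fix v j assume "v \<in> set vs" "j \<in> set js"
      then have "real_of_int (\<Sum>u\<in>set us. B v u * L u j) = 0" by (simp add: BL)
      then show "(\<Sum>u\<in>set us. P (Inl v) u * of_int (Q u (Inr j))) = 0"
        by (simp add: P_def Q_def)
    qed
    also have "list_mat vs vs (\<lambda>v w. \<Sum>u\<in>set us. P (Inl v) u * of_int (Q u (Inl w)))
        = list_mat vs vs (\<lambda>v w. of_int (\<Sum>u\<in>set us. B v u * S u w))"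
      by (rule list_mat_cong) (simp add: P_def Q_def)
    also have "\<dots> = list_mat vs vs (\<lambda>v w. if v = w then 1 else 0)"
      by (rule list_mat_cong) (simp add: BS)
    finally show ?thesis by (simp add: det_list_mat_one dist P_def Q_def)
  qed
  have 2: "of_int qi * det (list_mat us ws R) = det ?H"
  proof -
    have "of_int qi * det (list_mat us ws R)
        = det (list_mat ws ws (\<lambda>x z. \<Sum>u\<in>set us. of_int (Qi x u) * R u z))"
      unfolding qi_def det_list_mat_of_int[symmetric]
      by (rule det_list_mat_mult[symmetric]) (use dist lw in auto)
    also have "\<dots> = det (list_mat vs vs (\<lambda>v w. \<Sum>u\<in>set us. of_int (Qi (Inl v) u) * R u (Inl w))) *
        det (list_mat js js (\<lambda>i j. \<Sum>u\<in>set us. of_int (Qi (Inr i) u) * R u (Inr j)))"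
      unfolding ws_def
    proof (rule det_list_mat_block_upper)
      fix v j assume "v \<in> set vs" "j \<in> set js"
      then have "real_of_int (\<Sum>u\<in>set us. B v u * L u j) = 0" by (simp add: BL)
      then show "(\<Sum>u\<in>set us. of_int (Qi (Inl v) u) * R u (Inr j)) = 0"
        by (simp add: R_def Qi_def)
    qed
    also have "list_mat js js (\<lambda>i j. \<Sum>u\<in>set us. of_int (Qi (Inr i) u) * R u (Inr j))
        = list_mat js js (\<lambda>i j. of_int (\<Sum>u\<in>set us. C i u * L u j))"
      by (rule list_mat_cong) (simp add: R_def Qi_def)
    also have "\<dots> = list_mat js js (\<lambda>i j. if i = j then 1 else 0)"
      by (rule list_mat_cong) (simp add: CL)
    also have "list_mat vs vs (\<lambda>v w. \<Sum>u\<in>set us. of_int (Qi (Inl v) u) * R u (Inl w)) =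
        list_mat vs vs (\<lambda>v w. \<Sum>u\<in>set us. of_int (B v u) * (1 / g u) * of_int (B w u))"
      by (rule list_mat_cong) (simp add: R_def Qi_def mult_ac)
    finally show ?thesis by (simp only: det_list_mat_one dist mult_1_right)
  qed
  have 3: "det (list_mat us ws R) * (\<Prod>u\<in>set us. g u) = det (list_mat ws us P)"
  proof -
    have "det (list_mat us us (\<lambda>x y. if x = y then g x else 0)) * det (list_mat us ws R)
      = det (list_mat us ws (\<lambda>x z. \<Sum>u\<in>set us. (if x = u then g x else 0) * R u z))"
      by (rule det_list_mat_mult[symmetric]) (use dist lw in auto)
    also have "\<dots> = det (list_mat us ws (\<lambda>u x. P x u))"
      by (rule arg_cong[of _ _ det], rule list_mat_cong)
        (auto simp: if_distrib[of "\<lambda>t. t * _"] P_def R_def g ws_def cong: if_cong)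
    also have "\<dots> = det (list_mat ws us P)"
      by (rule det_list_mat_transpose) (simp add: lw)
    finally show ?thesis by (simp add: det_list_mat_diag dist mult.commute)
  qed
  have "(\<Prod>u\<in>set us. g u) * det ?H = of_int q * det (list_mat ws us P)"
    unfolding 2[symmetric] 3[symmetric] \<open>q = qi\<close> by simp
  then show ?thesis by (simp add: 1[symmetric])
qed

text \<open>The counterpart of \<open>Z_basis\<close> for lattices of integer vectors. Coefficient
  functions are taken in \<open>PiE\<close>, since otherwise their values beyond \<open>n\<close>
  would destroy uniqueness.\<close>

definition lattice_basis :: "('u \<Rightarrow> int) set \<Rightarrow> nat \<Rightarrow> (nat \<Rightarrow> 'u \<Rightarrow> int) \<Rightarrow> bool" where
  "lattice_basis L n b \<longleftrightarrow> (\<forall>i<n. b i \<in> L) \<and>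
     (\<forall>x\<in>L. \<exists>!c. c \<in> {..<n} \<rightarrow>\<^sub>E UNIV \<and> x = (\<lambda>u. \<Sum>i<n. c i * b i u))"

lemma lattice_basis_mem: "lattice_basis L n b \<Longrightarrow> i < n \<Longrightarrow> b i \<in> L"
  by (simp add: lattice_basis_def)

lemma lattice_basis_span:
  assumes "lattice_basis L n b" "x \<in> L"
  obtains c where "x = (\<lambda>u. \<Sum>i<n. c i * b i u)"
proof -
  have "\<exists>!c. c \<in> {..<n} \<rightarrow>\<^sub>E UNIV \<and> x = (\<lambda>u. \<Sum>i<n. c i * b i u)"
    using assms by (simp add: lattice_basis_def)
  then show ?thesis using that by (elim ex1E conjE)
qed

lemma lattice_basis_coeff_unique:
  assumes "lattice_basis L n b" "(\<lambda>u. \<Sum>i<n. c i * b i u) \<in> L"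
    and eq: "(\<lambda>u. \<Sum>i<n. c i * b i u) = (\<lambda>u. \<Sum>i<n. d i * b i u)" and "i < n"
  shows "c i = d i"
proof -
  let ?x = "\<lambda>u. \<Sum>i<n. c i * b i u"
  have ex1: "\<exists>!c. c \<in> {..<n} \<rightarrow>\<^sub>E UNIV \<and> ?x = (\<lambda>u. \<Sum>i<n. c i * b i u)"
    using assms(1,2) by (auto simp: lattice_basis_def)
  have "restrict c {..<n} \<in> {..<n} \<rightarrow>\<^sub>E UNIV \<and> ?x = (\<lambda>u. \<Sum>i<n. restrict c {..<n} i * b i u)"
    by auto
  moreover have "restrict d {..<n} \<in> {..<n} \<rightarrow>\<^sub>E UNIV \<and> ?x = (\<lambda>u. \<Sum>i<n. restrict d {..<n} i * b i u)"
    unfolding eq by auto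
  ultimately have "restrict c {..<n} = restrict d {..<n}" using ex1 by blast
  from fun_cong[OF this, of i] show ?thesis using \<open>i < n\<close> by simp
qed

text \<open>Each basis is expressed in the other by an integer matrix. Uniqueness of coefficients
  makes the two matrices inverse to each other, so both determinants are units of the
  integers.\<close>

lemma lattice_basis_change:
  assumes b: "lattice_basis L n b" and b': "lattice_basis L n b'"
  shows "\<exists>P. \<bar>det (list_mat [0..<n] [0..<n] P)\<bar> = 1 \<and> (\<forall>i<n. b i = (\<lambda>u. \<Sum>j<n. P i j * b' j u))"
proof -
  have "\<exists>c. b i = (\<lambda>u. \<Sum>j<n. c j * b' j u)" if "i < n" for i
    using lattice_basis_span[OF b' lattice_basis_mem[OF b that]] by metis
  then obtain P where P: "b i = (\<lambda>u. \<Sum>j<n. P i j * b' j u)" if "i < n" for i by metis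
  have "\<exists>c. b' i = (\<lambda>u. \<Sum>j<n. c j * b j u)" if "i < n" for i
    using lattice_basis_span[OF b lattice_basis_mem[OF b' that]] by metis
  then obtain P' where P': "b' i = (\<lambda>u. \<Sum>j<n. P' i j * b j u)" if "i < n" for i by metis
  have *: "(\<Sum>j<n. P i j * P' j k) = (if i = k then 1 else 0)" if "i < n" "k < n" for i k
  proof -
    have 1: "b i = (\<lambda>u. \<Sum>k<n. (if i = k then 1 else 0) * b k u)"
      using that by (simp add: if_distrib[of "\<lambda>t. t * _"] cong: if_cong)
    have "b i = (\<lambda>u. \<Sum>j<n. P i j * (\<Sum>k<n. P' j k * b k u))"
      using P[OF that(1)] P' by (auto intro!: sum.cong)
    also have "\<dots> = (\<lambda>u. \<Sum>k<n. (\<Sum>j<n. P i j * P' j k) * b k u)"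
      by (simp add: sum_distrib_left sum_distrib_right mult.assoc) (subst sum.swap, simp)
    finally have 2: "b i = (\<lambda>u. \<Sum>k<n. (\<Sum>j<n. P i j * P' j k) * b k u)" .
    show ?thesis
      by (rule lattice_basis_coeff_unique[OF b _ _ that(2)], fold 1 2)
        (use lattice_basis_mem[OF b that(1)] in auto)
  qed
  have "det (list_mat [0..<n] [0..<n] P) * det (list_mat [0..<n] [0..<n] P')
    = det (list_mat [0..<n] [0..<n] (\<lambda>x z. \<Sum>y\<in>set [0..<n]. P x y * P' y z))"
    by (rule det_list_mat_mult[symmetric]) auto
  also have "list_mat [0..<n] [0..<n] (\<lambda>x z. \<Sum>y\<in>set [0..<n]. P x y * P' y z)
    = list_mat [0..<n] [0..<n] (\<lambda>x z. if x = z then 1 else 0)"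
    by (rule list_mat_cong) (simp add: * lessThan_atLeast0[symmetric])
  finally have "det (list_mat [0..<n] [0..<n] P) * det (list_mat [0..<n] [0..<n] P') = 1"
    by (simp add: det_list_mat_one)
  then have "\<bar>det (list_mat [0..<n] [0..<n] P)\<bar> = 1" by (auto simp: zmult_eq_1_iff)
  then show ?thesis using P by blast
qed

definition gram :: "'u set \<Rightarrow> ('u \<Rightarrow> real) \<Rightarrow> nat \<Rightarrow> (nat \<Rightarrow> 'u \<Rightarrow> int) \<Rightarrow> (nat \<Rightarrow> 'u \<Rightarrow> int) \<Rightarrow> real mat" where
  "gram U g n b d = list_mat [0..<n] [0..<n] (\<lambda>i j. \<Sum>u\<in>U. of_int (b i u) * of_int (d j u) * g u)"

lemma det_gram_sym: "det (gram U g n b d) = det (gram U g n d b)"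
  unfolding gram_def
  by (subst det_list_mat_transpose[symmetric]) (auto simp: ac_simps)

lemma abs_det_gram_change_left:
  assumes "lattice_basis L n b" "lattice_basis L n b'"
  shows "\<bar>det (gram U g n b d)\<bar> = \<bar>det (gram U g n b' d)\<bar>"
proof -
  obtain P where P: "\<bar>det (list_mat [0..<n] [0..<n] P)\<bar> = 1"
    "\<And>i. i < n \<Longrightarrow> b i = (\<lambda>u. \<Sum>j<n. P i j * b' j u)"
    using lattice_basis_change[OF assms] by blast
  have "gram U g n b d = list_mat [0..<n] [0..<n] (\<lambda>x z. \<Sum>y\<in>set [0..<n].
      of_int (P x y) * (\<Sum>u\<in>U. of_int (b' y u) * of_int (d z u) * g u))"
    unfolding gram_def
  proof (rule list_mat_cong)
    fix i j assume "i \<in> set [0..<n]" "j \<in> set [0..<n]"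
    then have "i < n" by simp
    have "(\<Sum>u\<in>U. of_int (b i u) * of_int (d j u) * g u) =
        (\<Sum>u\<in>U. \<Sum>k<n. of_int (P i k) * (of_int (b' k u) * of_int (d j u) * g u))"
      unfolding P(2)[OF \<open>i < n\<close>] by (simp add: sum_distrib_right mult.assoc)
    also have "\<dots> = (\<Sum>k<n. of_int (P i k) * (\<Sum>u\<in>U. of_int (b' k u) * of_int (d j u) * g u))"
      by (subst sum.swap) (simp add: sum_distrib_left)
    finally show "(\<Sum>u\<in>U. of_int (b i u) * of_int (d j u) * g u) = (\<Sum>y\<in>set [0..<n].
      of_int (P i y) * (\<Sum>u\<in>U. of_int (b' y u) * of_int (d j u) * g u))"
      by (simp add: lessThan_atLeast0)
  qed
  also have "det \<dots> = of_int (det (list_mat [0..<n] [0..<n] P)) * det (gram U g n b' d)"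
    unfolding gram_def det_list_mat_of_int[symmetric] by (rule det_list_mat_mult) auto
  finally show ?thesis using P(1) by (simp add: abs_mult flip: of_int_abs)
qed

text \<open>This independence of the bases is what makes the definite description in
  \<open>prym_vol2\<close> meaningful.\<close>

lemma abs_det_gram_change:
  assumes "lattice_basis L n b" "lattice_basis L n b'" "lattice_basis M n d" "lattice_basis M n d'"
  shows "\<bar>det (gram U g n b d)\<bar> = \<bar>det (gram U g n b' d')\<bar>"
  using abs_det_gram_change_left[OF assms(1,2), of U g d]
    abs_det_gram_change_left[OF assms(3,4), of U g b'] by (simp add: det_gram_sym[of U g n b'])

lemma lattice_basisI:
  assumes "distinct js" and mem: "\<And>j. j \<in> set js \<Longrightarrow> f j \<in> L"
    and span: "\<And>x. x \<in> L \<Longrightarrow> \<exists>c. x = (\<lambda>u. \<Sum>j\<in>set js. c j * f j u)"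
    and indep: "\<And>c j. (\<And>u. (\<Sum>j\<in>set js. c j * f j u) = 0) \<Longrightarrow> j \<in> set js \<Longrightarrow> c j = 0"
  shows "lattice_basis L (length js) (\<lambda>i. f (js ! i))"
  unfolding lattice_basis_def
proof (intro conjI allI impI ballI)
  have bij: "bij_betw ((!) js) {..<length js} (set js)"
    using assms(1) by (simp add: bij_betw_nth)
  fix x assume "x \<in> L"
  then obtain c where c: "x = (\<lambda>u. \<Sum>j\<in>set js. c j * f j u)" using span by blast
  have conv: "(\<Sum>i<length js. d (js ! i) * f (js ! i) u) = (\<Sum>j\<in>set js. d j * f j u)" for d u
    using sum.reindex_bij_betw[OF bij, of "\<lambda>j. d j * f j u"] by simp
  show "\<exists>!c. c \<in> {..<length js} \<rightarrow>\<^sub>E UNIV \<and> x = (\<lambda>u. \<Sum>i<length js. c i * f (js ! i) u)"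
  proof (rule ex1I[of _ "restrict (\<lambda>i. c (js ! i)) {..<length js}"], goal_cases)
    case 1 then show ?case by (auto simp: c conv)
  next
    case (2 d)
    define e where "e j = d (inv_into {..<length js} ((!) js) j)" for j
    have e: "d i = e (js ! i)" if "i < length js" for i
      using that bij by (simp add: e_def bij_betw_def inv_into_f_f)
    have "x = (\<lambda>u. \<Sum>j\<in>set js. e j * f j u)"
      using 2 by (simp add: conv[symmetric] e)
    then have "(\<Sum>j\<in>set js. e j * f j u) = (\<Sum>j\<in>set js. c j * f j u)" for u
      using c by metis
    then have "(\<Sum>j\<in>set js. (e j - c j) * f j u) = 0" for u
      by (simp add: left_diff_distrib sum_subtractf)
    then have "e j - c j = 0" if "j \<in> set js" for j
      using indep[of "\<lambda>j. e j - c j" j] that by simp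
    moreover have "d i = undefined" if "\<not> i < length js" for i
      using 2 PiE_arb[of d "{..<length js}" "\<lambda>_. UNIV" i] that by simp
    ultimately have "d i = restrict (\<lambda>i. c (js ! i)) {..<length js} i" for i
      using e[of i] by (cases "i < length js") auto
    then show ?case by (rule ext)
  qed
qed (use mem in auto)

section \<open>Bases of abelian groups\<close>

lemma comm_group_additive:
  fixes M :: "('a::ab_group_add, 'm) monoid_scheme"
  assumes "monoid.mult M = (+)" "one M = 0" "0 \<in> carrier M"
    and "\<And>x y. x \<in> carrier M \<Longrightarrow> y \<in> carrier M \<Longrightarrow> x + y \<in> carrier M"
    and "\<And>x. x \<in> carrier M \<Longrightarrow> - x \<in> carrier M"
  shows "comm_group M"
proof (rule comm_groupI)
  fix x assume "x \<in> carrier M"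
  then show "\<exists>y\<in>carrier M. y \<otimes>\<^bsub>M\<^esub> x = \<one>\<^bsub>M\<^esub>"
    using assms by (intro bexI[of _ "- x"]) auto
qed (use assms in \<open>auto simp: algebra_simps\<close>)

lemma inv_additive:
  fixes M :: "('a::ab_group_add, 'm) monoid_scheme"
  assumes "group M" "monoid.mult M = (+)" "one M = 0" "x \<in> carrier M" "- x \<in> carrier M"
  shows "inv\<^bsub>M\<^esub> x = - x"
  by (rule group.inv_equality) (use assms in auto)

text \<open>An additive map into integer vectors turns powers and finite products into integer
  combinations, and injectivity carries uniqueness over. Both \<open>K\<close> and \<open>K'\<close>
  are thereby replaced by lattices of functions on half-edges.\<close>

lemma Z_basis_transport:
  fixes M (structure) and \<Phi> :: "'a \<Rightarrow> 'u \<Rightarrow> int"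
  assumes M: "comm_group M"
    and add: "\<And>x y. x \<in> carrier M \<Longrightarrow> y \<in> carrier M \<Longrightarrow> \<Phi> (x \<otimes> y) = (\<lambda>u. \<Phi> x u + \<Phi> y u)"
    and inj: "inj_on \<Phi> (carrier M)" and img: "\<Phi> ` carrier M = L"
  shows "Z_basis M n b \<longleftrightarrow> (\<forall>i<n. b i \<in> carrier M) \<and> lattice_basis L n (\<lambda>i. \<Phi> (b i))"
proof -
  interpret comm_group M by (rule M)
  have one: "\<Phi> \<one> u = 0" for u
    using fun_cong[OF add[of \<one> \<one>], of u] by simp
  have nat_pow: "\<Phi> (x [^] (m::nat)) u = int m * \<Phi> x u" if "x \<in> carrier M" for x m u
    using that by (induction m) (simp_all add: one add algebra_simps)
  have inv: "\<Phi> (inv x) u = - \<Phi> x u" if "x \<in> carrier M" for x u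
    using fun_cong[OF add[of "inv x" x], of u] that one[of u] by simp
  have pow: "\<Phi> (x [^] (z::int)) u = z * \<Phi> x u" if "x \<in> carrier M" for x z u
  proof (cases "z < 0")
    case True
    then have "x [^] z = inv (x [^] nat (- z))" by (simp only: int_pow_def2 if_True)
    then show ?thesis
      unfolding \<open>x [^] z = inv (x [^] nat (- z))\<close> inv[OF nat_pow_closed[OF that]] nat_pow[OF that]
      using True by simp
  next
    case False
    then have "x [^] z = x [^] nat z" by (simp only: int_pow_def2 if_False)
    then show ?thesis unfolding \<open>x [^] z = x [^] nat z\<close> nat_pow[OF that] using False by simp
  qed
  have fprod: "\<Phi> (\<Otimes>i\<in>I. f i) u = (\<Sum>i\<in>I. \<Phi> (f i) u)" if "finite I" "f \<in> I \<rightarrow> carrier M" for I :: "nat set" and f u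
    using that by (induction I rule: finite_induct) (simp_all add: one add)
  show ?thesis
  proof (cases "\<forall>i<n. b i \<in> carrier M")
    case True
    have eq: "x = (\<Otimes>i\<in>{..<n}. b i [^] c i) \<longleftrightarrow> \<Phi> x = (\<lambda>u. \<Sum>i<n. c i * \<Phi> (b i) u)"
      if "x \<in> carrier M" for x and c :: "nat \<Rightarrow> int"
    proof -
      have mem: "(\<lambda>i. b i [^] c i) \<in> {..<n} \<rightarrow> carrier M" using True by simp
      have "\<Phi> (\<Otimes>i\<in>{..<n}. b i [^] c i) = (\<lambda>u. \<Sum>i<n. c i * \<Phi> (b i) u)"
        by (rule ext) (use True mem in \<open>simp add: fprod pow\<close>)
      then show ?thesis using inj_on_eq_iff[OF inj that finprod_closed[OF mem]] by simp
    qed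
    show ?thesis
      unfolding Z_basis_def lattice_basis_def img[symmetric] using True by (simp add: eq)
  qed (auto simp: Z_basis_def)
qed

lemma (in group) r_coset_eq_iff:
  assumes N: "subgroup N G" and a: "a \<in> carrier G" and b: "b \<in> carrier G"
  shows "N #> a = N #> b \<longleftrightarrow> a \<otimes> inv b \<in> N"
proof -
  have "N #> a = N #> b \<longleftrightarrow> a \<in> N #> b"
    using repr_independence[OF _ b N] rcos_self[OF a N] by blast
  then show ?thesis using subgroup.rcos_module[OF N is_group b a] by simp
qed

text \<open>A coset is seen as a fibre of the quotient map, the form in which the representatives of
  an element of \<open>K\<close> are determined later.\<close>

lemma (in group) r_coset_members:
  assumes N: "subgroup N G" and a: "a \<in> carrier G"
  shows "N #> a = {x \<in> carrier G. N #> x = N #> a}"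
proof -
  have "N #> a \<subseteq> carrier G" using r_coset_subset_G[OF subgroup.subset[OF N] a] .
  then show ?thesis using repr_independence[OF _ a N] rcos_self[OF _ N] by blast
qed

lemma subgroup_torsion:
  assumes "comm_group M"
  shows "subgroup (torsion M) M"
proof -
  interpret comm_group M by (rule assms)
  show ?thesis
  proof (rule subgroupI)
    show "torsion M \<noteq> {}" by (auto simp: torsion_def intro!: exI[of _ "\<one>\<^bsub>M\<^esub>"] exI[of _ "1::nat"])
    show "inv\<^bsub>M\<^esub> x \<in> torsion M" if "x \<in> torsion M" for x
      using that nat_pow_inv[of x] by (fastforce simp: torsion_def)
    show "x \<otimes>\<^bsub>M\<^esub> y \<in> torsion M" if x: "x \<in> torsion M" and y: "y \<in> torsion M" for x y
    proof -
      obtain m n :: nat where mn: "m > 0" "n > 0" "x [^]\<^bsub>M\<^esub> m = \<one>\<^bsub>M\<^esub>" "y [^]\<^bsub>M\<^esub> n = \<one>\<^bsub>M\<^esub>"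
        and c: "x \<in> carrier M" "y \<in> carrier M"
        using x y by (auto simp: torsion_def)
      have "(x \<otimes>\<^bsub>M\<^esub> y) [^]\<^bsub>M\<^esub> (m * n) = x [^]\<^bsub>M\<^esub> (m * n) \<otimes>\<^bsub>M\<^esub> y [^]\<^bsub>M\<^esub> (n * m)"
        using c by (simp add: pow_mult_distrib m_comm mult.commute)
      also have "\<dots> = (x [^]\<^bsub>M\<^esub> m) [^]\<^bsub>M\<^esub> n \<otimes>\<^bsub>M\<^esub> (y [^]\<^bsub>M\<^esub> n) [^]\<^bsub>M\<^esub> m"
        using c by (simp add: nat_pow_pow)
      also have "\<dots> = \<one>\<^bsub>M\<^esub>" using mn by simp
      finally show ?thesis using c mn unfolding torsion_def by (intro CollectI conjI exI[of _ "m * n"]) auto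
    qed
  qed (auto simp: torsion_def)
qed

section \<open>Spanning trees\<close>

text \<open>Here \<open>e y\<close> is the edge from \<open>y\<close> to its parent, with incidence
  signs \<open>a y\<close> at \<open>y\<close> and \<open>b y\<close> at the parent. Subtracting
  \<open>b y\<close> times the path of the parent cancels the boundary left there, so that only a
  boundary 1 at \<open>y\<close> and something at the root remain. The number counts the steps to
  the root and makes the recursion primitive.\<close>

primrec tree_path ::
    "('x \<Rightarrow> 'x) \<Rightarrow> ('x \<Rightarrow> 'u) \<Rightarrow> ('x \<Rightarrow> int) \<Rightarrow> ('x \<Rightarrow> int) \<Rightarrow> nat \<Rightarrow> 'x \<Rightarrow> 'u \<Rightarrow> int" where
  "tree_path par e a b 0 y = (\<lambda>f. 0)"
| "tree_path par e a b (Suc n) y =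
     (\<lambda>f. a y * ((if f = e y then 1 else 0) - b y * tree_path par e a b n (par y) f))"

text \<open>The rank is the distance to \<open>x0\<close>, and a shortest path starts with a step to
  a point that is one closer. Parents chosen in this way give a breadth-first spanning tree.\<close>

lemma parent_function:
  assumes "\<And>x. x \<in> X \<Longrightarrow> (x, x0) \<in> r\<^sup>*"
  obtains par and rk :: "'x \<Rightarrow> nat" where "rk x0 = 0"
    "\<And>x. x \<in> X \<Longrightarrow> x \<noteq> x0 \<Longrightarrow> (x, par x) \<in> r \<and> rk x = Suc (rk (par x))"
proof -
  define rk where "rk x = (LEAST n. (x, x0) \<in> r ^^ n)" for x
  have rk_le: "rk x \<le> n" if "(x, x0) \<in> r ^^ n" for x n
    unfolding rk_def using that by (rule Least_le)
  have "\<exists>y. (x, y) \<in> r \<and> rk x = Suc (rk y)" if x: "x \<in> X" "x \<noteq> x0" for x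
  proof -
    have "\<exists>n. (x, x0) \<in> r ^^ n" using assms[OF x(1)] by (simp add: rtrancl_power)
    then have rx: "(x, x0) \<in> r ^^ rk x" unfolding rk_def by (rule LeastI_ex)
    then obtain n where n: "rk x = Suc n" using x(2) by (cases "rk x") auto
    with rx obtain y where y: "(x, y) \<in> r" "(y, x0) \<in> r ^^ n" by (metis relpow_Suc_D2)
    then have ry: "(y, x0) \<in> r ^^ rk y" unfolding rk_def by (metis LeastI)
    have "(x, x0) \<in> r ^^ Suc (rk y)" by (rule relpow_Suc_I2[OF y(1) ry])
    then have "rk x \<le> Suc (rk y)" by (rule rk_le)
    with rk_le[OF y(2)] n y(1) show ?thesis by (intro exI[of _ y]) auto
  qed
  then obtain par where "\<And>x. x \<in> X \<Longrightarrow> x \<noteq> x0 \<Longrightarrow> (x, par x) \<in> r \<and> rk x = Suc (rk (par x))"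
    by metis
  moreover have "rk x0 = 0" using rk_le[of x0 0] by simp
  ultimately show ?thesis using that by blast
qed

text \<open>The section \<open>S\<close> comes from a spanning tree \<open>T\<close> rooted at \<open>x0\<close>: \<open>S _ y\<close> is the signed tree path from
  \<open>y\<close> to \<open>x0\<close>.\<close>

lemma spanning_tree_section:
  fixes hd tl :: "'u \<Rightarrow> 'x" and \<alpha> \<beta> :: "'u \<Rightarrow> int"
  defines "B \<equiv> \<lambda>x u. (if hd u = x then \<alpha> u else 0) + (if tl u = x then \<beta> u else 0)"
  assumes fin: "finite U" "finite X" and ends: "\<And>u. u \<in> U \<Longrightarrow> hd u \<in> X \<and> tl u \<in> X"
    and signs: "\<And>u. u \<in> U \<Longrightarrow> \<alpha> u * \<alpha> u = 1 \<and> \<beta> u * \<beta> u = 1"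
    and conn: "\<And>x. x \<in> X \<Longrightarrow> (x, x0) \<in> ({(hd u, tl u) | u. u \<in> U} \<union> {(tl u, hd u) | u. u \<in> U})\<^sup>*"
  obtains T S where "T \<subseteq> U" "card T = card (X - {x0})"
    "\<And>x y. x \<in> X - {x0} \<Longrightarrow> y \<in> X - {x0} \<Longrightarrow> (\<Sum>u\<in>U. B x u * S u y) = (if x = y then 1 else 0)"
    "\<And>u y. u \<notin> T \<Longrightarrow> y \<in> X - {x0} \<Longrightarrow> S u y = 0"
    "\<And>f u. f \<in> U \<Longrightarrow> u \<in> T \<Longrightarrow> (\<Sum>y\<in>X - {x0}. S f y * B y u) = (if f = u then 1 else 0)"
proof -
  obtain par and rk :: "'x \<Rightarrow> nat" where rk0: "rk x0 = 0" and
    par: "\<And>x. x \<in> X \<Longrightarrow> x \<noteq> x0 \<Longrightarrow>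
      (x, par x) \<in> {(hd u, tl u) | u. u \<in> U} \<union> {(tl u, hd u) | u. u \<in> U} \<and> rk x = Suc (rk (par x))"
    by (rule parent_function[where X = X and ?x0.0 = x0, OF conn]) (assumption | rule that)+
  have "\<exists>u. u \<in> U \<and> (hd u = x \<and> tl u = par x \<or> tl u = x \<and> hd u = par x)" if "x \<in> X" "x \<noteq> x0" for x
    using par[OF that] by auto
  then obtain e where e: "\<And>x. x \<in> X \<Longrightarrow> x \<noteq> x0 \<Longrightarrow> e x \<in> U \<and>
      (hd (e x) = x \<and> tl (e x) = par x \<or> tl (e x) = x \<and> hd (e x) = par x)"
    by metis
  define a where "a x = B x (e x)" for x
  define b where "b x = B (par x) (e x)" for x
  have neq: "par x \<noteq> x" if "x \<in> X" "x \<noteq> x0" for x using par[OF that] by auto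
  have parX: "par x \<in> X" if "x \<in> X" "x \<noteq> x0" for x using e[OF that] ends by metis
  have a: "a x * a x = 1" if "x \<in> X" "x \<noteq> x0" for x
    using e[OF that] signs neq[OF that] by (auto simp: a_def B_def)
  \<comment> \<open>The rank drops along a parent edge, so it is not a loop and its column has
    exactly one entry at each end.\<close>
  have Be: "B z (e x) = (if z = x then a x else 0) + (if z = par x then b x else 0)"
    if "x \<in> X" "x \<noteq> x0" for x z
    using e[OF that] neq[OF that] by (auto simp: a_def b_def B_def)
  define T where "T = e ` (X - {x0})"
  define S where "S f y = tree_path par e a b (rk y) y f" for f y
  have S0: "S f x0 = 0" for f by (simp add: S_def rk0)
  have S_rec: "S f y = a y * ((if f = e y then 1 else 0) - b y * S f (par y))"
    if "y \<in> X" "y \<noteq> x0" for f y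
    using par[OF that] by (simp add: S_def)
  have rank_induct [consumes 1, case_names root step]: "P y" if "y \<in> X" "P x0"
    "\<And>y. y \<in> X \<Longrightarrow> y \<noteq> x0 \<Longrightarrow> P (par y) \<Longrightarrow> P y" for P y
    using that(1)
  proof (induction "rk y" arbitrary: y rule: less_induct)
    case less
    show ?case
    proof (cases "y = x0")
      case False
      show ?thesis
        by (rule that(3)[OF less.prems False], rule less.hyps)
          (use par[OF less.prems False] parX[OF less.prems False] in auto)
    qed (simp add: that(2))
  qed
  show ?thesis
  proof
    show "T \<subseteq> U" using e by (auto simp: T_def)
    have "inj_on e (X - {x0})"
    proof (rule inj_onI)
      fix x y assume xy: "x \<in> X - {x0}" "y \<in> X - {x0}" "e x = e y"
      show "x = y"
      proof (rule ccontr)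
        assume "x \<noteq> y"
        \<comment> \<open>A shared parent edge has only these two ends, so each of them would be one
          step closer to the root than the other.\<close>
        then have "par x = y" "par y = x" using e[of x] e[of y] xy by auto
        then show False using par[of x] par[of y] xy by auto
      qed
    qed
    then show "card T = card (X - {x0})" by (simp add: T_def card_image)
  next
    fix x y assume x: "x \<in> X - {x0}" and y: "y \<in> X - {x0}"
    have "(\<Sum>u\<in>U. B x u * S u y) = (if x = y \<and> y \<noteq> x0 then 1 else 0)" if "y \<in> X" for y
      using that
    proof (induction y rule: rank_induct)
      case (step y)
      have "(\<Sum>u\<in>U. B x u * S u y) = (\<Sum>u\<in>U. a y * (if u = e y then B x u else 0)
          - a y * b y * (B x u * S u (par y)))"
        by (rule sum.cong) (auto simp: S_rec step algebra_simps)
      also have "\<dots> = a y * (\<Sum>u\<in>U. if u = e y then B x u else 0)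
          - a y * b y * (\<Sum>u\<in>U. B x u * S u (par y))"
        by (simp add: sum_subtractf sum_distrib_left)
      also have "(\<Sum>u\<in>U. if u = e y then B x u else 0) = B x (e y)"
        using e[OF step(1,2)] fin by simp
      also note step(3)
      finally show ?case
        using Be[OF step(1,2), of x] a[OF step(1,2)] neq[OF step(1,2)] x step(2) by (auto simp: mult.assoc)
    qed (simp_all add: S0)
    then show "(\<Sum>u\<in>U. B x u * S u y) = (if x = y then 1 else 0)" using y by auto
  next
    fix u y assume u: "u \<notin> T" and y: "y \<in> X - {x0}"
    have "S u y = 0" if "y \<in> X" for y
      using that by (induction y rule: rank_induct) (use u in \<open>auto simp: S0 S_rec T_def\<close>)
    then show "S u y = 0" using y by simp
  next
    fix f u assume f: "f \<in> U" and "u \<in> T"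
    then obtain x where x: "x \<in> X" "x \<noteq> x0" and u: "u = e x" by (auto simp: T_def)
    have "(\<Sum>y\<in>X - {x0}. S f y * B y u) = (\<Sum>y\<in>X - {x0}. (if y = x then S f y * a x else 0)
        + (if y = par x then S f y * b x else 0))"
      by (rule sum.cong) (auto simp: u Be[OF x] algebra_simps)
    \<comment> \<open>The parent may be the excluded vertex \<open>x0\<close>; its missing summand
      is harmless because \<open>S f x0 = 0\<close>.\<close>
    also have "\<dots> = S f x * a x + S f (par x) * b x"
      using fin x parX[OF x] by (auto simp: sum.distrib S0)
    also have "\<dots> = a x * a x * ((if f = u then 1 else 0) - b x * S f (par x)) + S f (par x) * b x"
      by (simp add: S_rec[OF x] u)
    also have "\<dots> = (if f = u then 1 else 0)" by (simp add: a[OF x])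
    finally show "(\<Sum>y\<in>X - {x0}. S f y * B y u) = (if f = u then 1 else 0)" .
  qed
qed

section \<open>The covering involution\<close>

definition other :: "'a set \<Rightarrow> 'a \<Rightarrow> 'a" where
  "other S a = (if \<exists>b\<in>S. b \<noteq> a then SOME b. b \<in> S \<and> b \<noteq> a else a)"

lemma other_singleton [simp]: "other {a} a = a"
  by (simp add: other_def)

lemma other_doubleton: "a \<noteq> b \<Longrightarrow> other {a, b} a = b" "a \<noteq> b \<Longrightarrow> other {a, b} b = a"
  unfolding other_def by (auto intro!: some_equality)

text \<open>With positive degrees of sum 2 there is either one point of degree 2 or two points of
  degree 1, since three points would already give 3. Fibres over vertices and over half-edges are
  both treated by this statement.\<close>

lemma total_degree_two:
  fixes d :: "'a \<Rightarrow> nat"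
  assumes "finite S" "sum d S = 2" "\<And>s. s \<in> S \<Longrightarrow> d s > 0" "a \<in> S"
  shows "S = {a, other S a} \<and> other S (other S a) = a \<and> d a = (if other S a = a then 2 else 1)"
proof (cases "S = {a}")
  case True
  then show ?thesis using assms by simp
next
  case False
  then obtain b where b: "b \<in> S" "b \<noteq> a" using assms(4) by blast
  have "S - {a} - {b} = {}"
  proof (rule ccontr)
    assume "S - {a} - {b} \<noteq> {}"
    then obtain c where c: "c \<in> S" "c \<noteq> a" "c \<noteq> b" by blast
    have "sum d {a, b, c} \<le> sum d S" using assms b c by (intro sum_mono2) auto
    moreover have "d a > 0" "d b > 0" "d c > 0" using assms b c by auto
    ultimately show False using assms(2) b c by auto
  qed
  then have S: "S = {a, b}" using assms(4) b by blast
  have "d a + d b = 2" using assms(2) b(2) by (simp add: S)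
  moreover have "d a > 0" "d b > 0" using assms S by auto
  ultimately have "d a = 1" by simp
  then show ?thesis using b(2) by (simp add: S other_doubleton)
qed

context metric_graph
begin

lemma finite_edges: "finite (edges G)"
  by (simp add: edges_def finite_halfedges)

lemma edge_of_flip: "x \<in> halfedges G \<Longrightarrow> edge_of G (flip G x) = edge_of G x"
  by (auto simp: edge_of_def flip_flip)

lemma edge_of_eq_iff:
  "x \<in> halfedges G \<Longrightarrow> y \<in> halfedges G \<Longrightarrow> edge_of G x = edge_of G y \<longleftrightarrow> y = x \<or> y = flip G x"
  unfolding edge_of_def using flip_flip by (metis doubleton_eq_iff)

lemma bij_betw_edge_of:
  assumes "orientation G A"
  shows "bij_betw (edge_of G) A (edges G)"
proof -
  have "inj_on (edge_of G) A"
    by (rule inj_onI) (use assms edge_of_eq_iff in \<open>unfold orientation_def, blast\<close>)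
  moreover have "edge_of G ` A = edges G"
  proof -
    have "edge_of G x \<in> edge_of G ` A" if "x \<in> halfedges G" for x
    proof (cases "x \<in> A")
      case False
      then have "flip G x \<in> A" using assms that unfolding orientation_def by blast
      then show ?thesis using edge_of_flip[OF that] by (metis imageI)
    qed auto
    then show ?thesis using assms unfolding edges_def orientation_def by blast
  qed
  ultimately show ?thesis by (simp add: bij_betw_def)
qed

end

context double_cover
begin

abbreviation hfib :: "'h \<Rightarrow> 'k set" where
  "hfib x \<equiv> {k \<in> halfedges Gt. hmap p k = x}"

abbreviation vfib :: "'v \<Rightarrow> 'w set" where
  "vfib v \<equiv> {w \<in> vertices Gt. vmap p w = v}"

text \<open>The covering involution, which is the identity exactly over the dilated part.\<close>

definition conjh :: "'k \<Rightarrow> 'k" where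
  "conjh k = other (hfib (hmap p k)) k"

definition conjv :: "'w \<Rightarrow> 'w" where
  "conjv w = other (vfib (vmap p w)) w"

lemma edge_of_top: "k \<in> halfedges Gt \<Longrightarrow> edge_of Gt k \<in> edges Gt"
  by (simp add: edges_def)

lemma edge_of_base: "x \<in> halfedges G \<Longrightarrow> edge_of G x \<in> edges G"
  by (simp add: edges_def)

lemma hfib_props:
  assumes "k \<in> halfedges Gt"
  shows "hfib (hmap p k) = {k, conjh k}" "conjh k \<in> halfedges Gt" "hmap p (conjh k) = hmap p k"
    "conjh (conjh k) = k" "edeg p (edge_of Gt k) = (if conjh k = k then 2 else 1)"
proof -
  have *: "hfib (hmap p k) = {k, other (hfib (hmap p k)) k} \<and>
      other (hfib (hmap p k)) (other (hfib (hmap p k)) k) = k \<and>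
      edeg p (edge_of Gt k) = (if other (hfib (hmap p k)) k = k then 2 else 1)"
    by (rule total_degree_two)
      (use assms top.finite_halfedges hmap_closed halfedge_degree edeg_pos edge_of_top in auto)
  then show 1: "hfib (hmap p k) = {k, conjh k}" by (simp add: conjh_def)
  then show 2: "conjh k \<in> halfedges Gt" "hmap p (conjh k) = hmap p k" by blast+
  show "conjh (conjh k) = k" "edeg p (edge_of Gt k) = (if conjh k = k then 2 else 1)"
    using * 2 by (simp_all add: conjh_def)
qed

lemma vfib_props:
  assumes "w \<in> vertices Gt"
  shows "vfib (vmap p w) = {w, conjv w}" "conjv w \<in> vertices Gt" "vmap p (conjv w) = vmap p w"
    "conjv (conjv w) = w" "vdeg p w = (if conjv w = w then 2 else 1)"
proof -
  have *: "vfib (vmap p w) = {w, other (vfib (vmap p w)) w} \<and>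
      other (vfib (vmap p w)) (other (vfib (vmap p w)) w) = w \<and>
      vdeg p w = (if other (vfib (vmap p w)) w = w then 2 else 1)"
    by (rule total_degree_two)
      (use assms top.finite_vertices vmap_closed vertex_degree vdeg_pos in auto)
  then show 1: "vfib (vmap p w) = {w, conjv w}" by (simp add: conjv_def)
  then show 2: "conjv w \<in> vertices Gt" "vmap p (conjv w) = vmap p w" by blast+
  show "conjv (conjv w) = w" "vdeg p w = (if conjv w = w then 2 else 1)"
    using * 2 by (simp_all add: conjv_def)
qed

lemma over_same_vertex:
  "w \<in> vertices Gt \<Longrightarrow> u \<in> vertices Gt \<Longrightarrow> vmap p u = vmap p w \<Longrightarrow> u = w \<or> u = conjv w"
  using vfib_props(1)[of w] by blast

lemma over_same_halfedge:
  "k \<in> halfedges Gt \<Longrightarrow> l \<in> halfedges Gt \<Longrightarrow> hmap p l = hmap p k \<Longrightarrow> l = k \<or> l = conjh k"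
  using hfib_props(1)[of k] by blast

text \<open>The involution is chosen fibre by fibre, so compatibility with roots has to be proved.
  It comes from harmonicity: the second vertex above an undilated root has positive degree, hence
  some lift of the half-edge is rooted there, and this can only be the conjugate one.\<close>

lemma rootv_conjh:
  assumes k: "k \<in> halfedges Gt"
  shows "rootv Gt (conjh k) = conjv (rootv Gt k)"
proof -
  have r: "rootv Gt k \<in> vertices Gt" "rootv Gt (conjh k) \<in> vertices Gt"
    using k hfib_props(2) top.rootv_closed by auto
  have "vmap p (rootv Gt (conjh k)) = vmap p (rootv Gt k)"
    using k by (simp add: map_rootv hfib_props)
  then have *: "rootv Gt (conjh k) = rootv Gt k \<or> rootv Gt (conjh k) = conjv (rootv Gt k)"
    using over_same_vertex[OF r] by simp
  show ?thesis
  proof (cases "conjv (rootv Gt k) = rootv Gt k")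
    case False
    let ?w = "conjv (rootv Gt k)"
    have w: "?w \<in> vertices Gt" "vmap p ?w = rootv G (hmap p k)"
      using vfib_props[OF r(1)] map_rootv[OF k] by auto
    have "0 < vdeg p ?w" by (rule vdeg_pos[OF w(1)])
    also have "vdeg p ?w = (\<Sum>l \<in> {l \<in> halfedges Gt. rootv Gt l = ?w \<and> hmap p l = hmap p k}.
        edeg p (edge_of Gt l))"
      by (rule harmonic) (use w hmap_closed[OF k] in auto)
    finally have "{l \<in> halfedges Gt. rootv Gt l = ?w \<and> hmap p l = hmap p k} \<noteq> {}"
      by (metis (no_types) less_irrefl sum.empty)
    then obtain l where "l \<in> halfedges Gt" "rootv Gt l = ?w" "hmap p l = hmap p k" by blast
    moreover from this have "l \<noteq> k" using False by auto
    ultimately show ?thesis using over_same_halfedge[OF k] by metis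
  qed (use * in auto)
qed

text \<open>Two different lifts of a half-edge flip to two different lifts of its flip, which
  settles the undilated case. If \<open>k\<close> is fixed, so is its flip: otherwise the undilated
  case applied to the flip would give two half-edges flipping to \<open>k\<close>.\<close>

lemma flip_conjh:
  assumes k: "k \<in> halfedges Gt"
  shows "flip Gt (conjh k) = conjh (flip Gt k)"
proof -
  have *: "flip Gt (conjh l) = conjh (flip Gt l)" if l: "l \<in> halfedges Gt" "conjh l \<noteq> l" for l
  proof -
    note c = hfib_props[OF l(1)] and f = top.flip_closed[OF l(1)]
    have "flip Gt (conjh l) \<noteq> flip Gt l"
      using l c top.flip_flip by metis
    moreover have "hmap p (flip Gt (conjh l)) = hmap p (flip Gt l)"
      using l c by (simp add: map_flip)
    ultimately show ?thesis
      using over_same_halfedge[OF f top.flip_closed[OF c(2)]] by blast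
  qed
  show ?thesis
  proof (cases "conjh k = k")
    case True
    note f = top.flip_closed[OF k]
    have "conjh (flip Gt k) = flip Gt k"
    proof (rule ccontr)
      assume "conjh (flip Gt k) \<noteq> flip Gt k"
      then have "flip Gt (conjh (flip Gt k)) = k"
        using *[OF f] True top.flip_flip[OF k] by simp
      then have "conjh (flip Gt k) = flip Gt k"
        using top.flip_flip hfib_props(2)[OF f] by metis
      then show False using \<open>conjh (flip Gt k) \<noteq> flip Gt k\<close> by simp
    qed
    then show ?thesis using True by simp
  qed (use * k in auto)
qed

lemma hfib_nonempty: "x \<in> halfedges G \<Longrightarrow> hfib x \<noteq> {}"
  using halfedge_degree[of x] by (metis sum.empty zero_neq_numeral)

lemma vfib_nonempty: "v \<in> vertices G \<Longrightarrow> vfib v \<noteq> {}"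
  using vertex_degree[of v] by (metis sum.empty zero_neq_numeral)

text \<open>Since flipping has no fixed points downstairs, each edge above contains exactly one
  half-edge over \<open>x\<close>. Dilation of an edge can therefore be tested on a single
  half-edge.\<close>

lemma edge_fibre_eq:
  assumes x: "x \<in> halfedges G"
  shows "edge_fibre Gt p (edge_of G x) = edge_of Gt ` hfib x" and "inj_on (edge_of Gt) (hfib x)"
proof -
  have em: "emap p (edge_of Gt k) = edge_of G (hmap p k)" if "k \<in> halfedges Gt" for k
    using that by (simp add: emap_def edge_of_def map_flip)
  show "edge_fibre Gt p (edge_of G x) = edge_of Gt ` hfib x"
  proof (intro equalityI subsetI)
    fix e assume "e \<in> edge_fibre Gt p (edge_of G x)"
    then obtain k where k: "k \<in> halfedges Gt" "e = edge_of Gt k" "edge_of G (hmap p k) = edge_of G x"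
      by (auto simp: edge_fibre_def edges_def em)
    then consider "hmap p k = x" | "hmap p k = flip G x"
      using base.edge_of_eq_iff[OF x hmap_closed[OF k(1)]] by auto
    then show "e \<in> edge_of Gt ` hfib x"
    proof cases
      case 2
      then have "flip Gt k \<in> hfib x" using k x by (simp add: map_flip base.flip_flip top.flip_closed)
      then show ?thesis using k(2) top.edge_of_flip[OF k(1)] by (metis imageI)
    qed (use k in auto)
  qed (auto simp: edge_fibre_def em edge_of_top)
  show "inj_on (edge_of Gt) (hfib x)"
    by (rule inj_onI) (use top.edge_of_eq_iff map_flip base.flip_neq x in auto)
qed

lemma dilated_edge_iff:
  assumes k: "k \<in> halfedges Gt"
  shows "dilated_edge Gt p (edge_of G (hmap p k)) \<longleftrightarrow> conjh k = k"
proof -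
  have "card (edge_fibre Gt p (edge_of G (hmap p k))) = card {k, conjh k}"
    using edge_fibre_eq[OF hmap_closed[OF k]] card_image hfib_props(1)[OF k] by metis
  then show ?thesis by (auto simp: dilated_edge_def card_insert_if)
qed

lemma dilated_vertex_iff:
  assumes w: "w \<in> vertices Gt"
  shows "dilated_vertex Gt p (vmap p w) \<longleftrightarrow> conjv w = w"
  using vfib_props(1)[OF w] by (auto simp: dilated_vertex_def vertex_fibre_def card_insert_if)

section \<open>Chosen lifts and the signs of the sheets\<close>

definition lifth :: "'h \<Rightarrow> 'k" where
  "lifth x = (SOME k. k \<in> hfib x)"

definition liftv :: "'v \<Rightarrow> 'w" where
  "liftv v = (SOME w. w \<in> vfib v)"

lemma lifth: "x \<in> halfedges G \<Longrightarrow> lifth x \<in> halfedges Gt" "x \<in> halfedges G \<Longrightarrow> hmap p (lifth x) = x"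
  using some_in_eq[of "hfib x"] hfib_nonempty[of x] by (auto simp: lifth_def)

lemma liftv: "v \<in> vertices G \<Longrightarrow> liftv v \<in> vertices Gt" "v \<in> vertices G \<Longrightarrow> vmap p (liftv v) = v"
  using some_in_eq[of "vfib v"] vfib_nonempty[of v] by (auto simp: liftv_def)

lemma hfib_eq: "x \<in> halfedges G \<Longrightarrow> hfib x = {lifth x, conjh (lifth x)}"
  using hfib_props(1)[of "lifth x"] lifth[of x] by simp

lemma vfib_eq: "v \<in> vertices G \<Longrightarrow> vfib v = {liftv v, conjv (liftv v)}"
  using vfib_props(1)[of "liftv v"] liftv[of v] by simp

lemma dilated_rootv:
  assumes x: "x \<in> halfedges G" and "dilated_edge Gt p (edge_of G x)"
  shows "dilated_vertex Gt p (rootv G x)"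
proof -
  have "conjh (lifth x) = lifth x" using assms dilated_edge_iff[of "lifth x"] lifth[OF x] by simp
  then have "conjv (rootv Gt (lifth x)) = rootv Gt (lifth x)"
    using rootv_conjh[OF lifth(1)[OF x]] by simp
  then show ?thesis
    using dilated_vertex_iff[of "rootv Gt (lifth x)"] lifth[OF x] map_rootv top.rootv_closed by simp
qed

text \<open>The lifts are chosen independently of each other, and \<open>sg\<close> compares a
  vertex with the chosen one in its fibre. The value 0 at dilated vertices makes \<open>sg\<close>
  anti-invariant everywhere.\<close>

definition sg :: "'w \<Rightarrow> int" where
  "sg w = (if conjv w = w then 0 else if w = liftv (vmap p w) then 1 else -1)"

lemma sg_conjv: "w \<in> vertices Gt \<Longrightarrow> sg (conjv w) = - sg w"
  using vfib_props[of w] vfib_eq[of "vmap p w"] vmap_closed[of w]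
  unfolding sg_def by (auto simp: doubleton_eq_iff)

lemma sg_square: "conjv w \<noteq> w \<Longrightarrow> sg w * sg w = 1"
  by (simp add: sg_def)

lemma sg_liftv: "v \<in> vertices G \<Longrightarrow> sg (liftv v) = (if dilated_vertex Gt p v then 0 else 1)"
  using dilated_vertex_iff[of "liftv v"] liftv[of v] by (simp add: sg_def)

end

section \<open>Anti-invariant chains\<close>

locale oriented_cover = double_cover Gt G p
  for Gt :: "('w, 'k) mgraph" and G :: "('v, 'h) mgraph" and p :: "('w, 'k, 'v, 'h) cover" +
  fixes At :: "'k set" and A :: "'h set"
  assumes base_connected: "connected_graph G"
    and dilated: "dilated_cover Gt G p"
    and orient_top: "orientation Gt At"
    and orient_base: "orientation G A"
    and orient_compatible: "compatible_orientation Gt p At A"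
begin

text \<open>Each undilated edge is represented by its half-edge in \<open>A\<close>, so that chains
  become functions on half-edges with the orientation built in.\<close>

definition U :: "'h set" where
  "U = {x \<in> A. \<not> dilated_edge Gt p (edge_of G x)}"

definition Vu :: "'v set" where
  "Vu = {v \<in> vertices G. \<not> dilated_vertex Gt p v}"

definition Vd :: "'v set" where
  "Vd = {v \<in> vertices G. dilated_vertex Gt p v}"

lemma A_halfedges: "x \<in> A \<Longrightarrow> x \<in> halfedges G"
  using orient_base by (auto simp: orientation_def)

lemma U_A: "x \<in> U \<Longrightarrow> x \<in> A"
  by (simp add: U_def)

lemma U_halfedges: "x \<in> U \<Longrightarrow> x \<in> halfedges G"
  by (simp add: A_halfedges U_A)

lemma finite_A: "finite A"
  using A_halfedges base.finite_halfedges by (meson finite_subset subsetI)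

lemma finite_U: "finite U"
  using finite_A by (simp add: U_def)

lemma finite_Vu: "finite Vu"
  using base.finite_vertices by (simp add: Vu_def)

lemma finite_Vd: "finite Vd"
  using base.finite_vertices by (simp add: Vd_def)

lemma vertices_split: "vertices G = Vu \<union> Vd" "Vu \<inter> Vd = {}"
  by (auto simp: Vu_def Vd_def)

lemma At_iff: "k \<in> At \<longleftrightarrow> k \<in> halfedges Gt \<and> hmap p k \<in> A"
  using orient_top orient_compatible unfolding orientation_def compatible_orientation_def by blast

lemma finite_At: "finite At"
  using top.finite_halfedges At_iff by (meson finite_subset subsetI)

lemma U_lift:
  assumes "x \<in> U"
  shows "lifth x \<in> At" "conjh (lifth x) \<in> At" "conjh (lifth x) \<noteq> lifth x"
  using assms U_halfedges[OF assms] lifth[of x] hfib_props[of "lifth x"] dilated_edge_iff[of "lifth x"]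
  by (auto simp: At_iff U_def)

lemma dil_lift:
  assumes "x \<in> A - U"
  shows "lifth x \<in> At" "conjh (lifth x) = lifth x"
  using assms A_halfedges[of x] lifth[of x] hfib_props[of "lifth x"] dilated_edge_iff[of "lifth x"]
  by (auto simp: At_iff U_def)

lemma sum_At:
  fixes f :: "'k \<Rightarrow> 'z::comm_monoid_add"
  shows "(\<Sum>k\<in>At. f k) = (\<Sum>x\<in>U. f (lifth x) + f (conjh (lifth x))) + (\<Sum>x\<in>A - U. f (lifth x))"
proof -
  have "(\<Sum>k\<in>At. f k) = (\<Sum>x\<in>A. \<Sum>k\<in>{k \<in> At. hmap p k = x}. f k)"
    by (rule sum.group[symmetric]) (auto simp: finite_At finite_A At_iff)
  also have "\<dots> = (\<Sum>x\<in>A. \<Sum>k\<in>{lifth x, conjh (lifth x)}. f k)"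
  proof (rule sum.cong[OF refl])
    fix x assume x: "x \<in> A"
    then have "{k \<in> At. hmap p k = x} = hfib x" by (auto simp: At_iff)
    then show "(\<Sum>k\<in>{k \<in> At. hmap p k = x}. f k) = (\<Sum>k\<in>{lifth x, conjh (lifth x)}. f k)"
      using hfib_eq[OF A_halfedges[OF x]] by simp
  qed
  also have "\<dots> = (\<Sum>x\<in>A. if x \<in> U then f (lifth x) + f (conjh (lifth x)) else f (lifth x))"
  proof (rule sum.cong[OF refl])
    fix x assume "x \<in> A"
    then show "(\<Sum>k\<in>{lifth x, conjh (lifth x)}. f k)
        = (if x \<in> U then f (lifth x) + f (conjh (lifth x)) else f (lifth x))"
      using U_lift(3)[of x] dil_lift(2)[of x] by (cases "x \<in> U") (auto simp: eq_commute)
  qed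
  also have "\<dots> = (\<Sum>x\<in>U. f (lifth x) + f (conjh (lifth x))) + (\<Sum>x\<in>A - U. f (lifth x))"
  proof -
    have "A \<inter> {x. x \<in> U} = U" "A \<inter> - {x. x \<in> U} = A - U" using U_A by auto
    then show ?thesis by (simp add: sum.If_cases[OF finite_A])
  qed
  finally show ?thesis .
qed

definition inc :: "'w \<Rightarrow> 'k \<Rightarrow> int" where
  "inc w k = (if rootv Gt (flip Gt k) = w then 1 else 0) - (if rootv Gt k = w then 1 else 0)"

definition bd :: "('k \<Rightarrow> int) \<Rightarrow> 'w \<Rightarrow> int" where
  "bd c w = (\<Sum>k\<in>At. c k * inc w k)"

text \<open>The coordinates of the chain minus its conjugate. Off \<open>U\<close> the value is
  fixed to 0, so that equality of coordinate vectors is equality of functions.\<close>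

definition phi :: "('k \<Rightarrow> int) \<Rightarrow> 'h \<Rightarrow> int" where
  "phi c x = (if x \<in> U then c (lifth x) - c (conjh (lifth x)) else 0)"

text \<open>Incidence matrix of the anti-invariant chains \<open>lifth x - conjh (lifth x)\<close>; the rows of
  dilated vertices vanish.\<close>

definition Binc :: "'v \<Rightarrow> 'h \<Rightarrow> int" where
  "Binc v x = (if rootv G (flip G x) = v then sg (rootv Gt (flip Gt (lifth x))) else 0)
     - (if rootv G x = v then sg (rootv Gt (lifth x)) else 0)"

lemma inc_conjh:
  assumes "k \<in> halfedges Gt" "w \<in> vertices Gt"
  shows "inc w (conjh k) = inc (conjv w) k"
proof -
  have *: "rootv Gt (conjh l) = w \<longleftrightarrow> rootv Gt l = conjv w" if "l \<in> halfedges Gt" for l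
    using rootv_conjh[OF that] vfib_props(4)[OF assms(2)] vfib_props(4)[OF top.rootv_closed[OF that]]
    by metis
  show ?thesis
    using *[OF assms(1)] *[OF top.flip_closed[OF assms(1)]] by (simp add: inc_def flip_conjh assms(1))
qed

text \<open>Over one fibre both sides change sign when either \<open>t\<close> or \<open>w\<close>
  is replaced by its conjugate, so they only record whether the two points lie on the same
  sheet.\<close>

lemma delta_sg:
  assumes "t \<in> vertices Gt" "w \<in> vertices Gt"
  shows "(if t = w then 1 else 0) - (if t = conjv w then 1 else 0)
    = (if vmap p t = vmap p w then sg w * sg t else 0)"
proof (cases "vmap p t = vmap p w")
  case True
  show ?thesis
  proof (cases "conjv w = w")
    case False
    then show ?thesis
      using over_same_vertex[OF assms(2,1) True] sg_square[OF False] sg_conjv[OF assms(2)] True by auto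
  qed (simp add: sg_def)
qed (use vfib_props(3)[OF assms(2)] in auto)

lemma lifth_root:
  assumes "x \<in> halfedges G"
  shows "rootv Gt (lifth x) \<in> vertices Gt" "rootv Gt (flip Gt (lifth x)) \<in> vertices Gt"
    "vmap p (rootv Gt (lifth x)) = rootv G x" "vmap p (rootv Gt (flip Gt (lifth x))) = rootv G (flip G x)"
  using lifth[OF assms] top.rootv_closed top.flip_closed map_rootv map_flip by auto

lemma inc_lifth:
  assumes "x \<in> halfedges G" "w \<in> vertices Gt"
  shows "inc w (lifth x) - inc (conjv w) (lifth x) = sg w * Binc (vmap p w) x"
  using delta_sg[OF lifth_root(1)[OF assms(1)] assms(2)] delta_sg[OF lifth_root(2)[OF assms(1)] assms(2)]
  by (auto simp: inc_def Binc_def lifth_root[OF assms(1)] algebra_simps)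

text \<open>Conjugation swaps the incidences of the two lifts of an undilated edge, so only the
  difference of their coefficients survives. The lift of a dilated edge is fixed and cancels. Thus
  \<open>Binc\<close> is the boundary map on anti-invariant coordinates.\<close>

lemma bd_antisym:
  assumes w: "w \<in> vertices Gt"
  shows "bd c w - bd c (conjv w) = sg w * (\<Sum>x\<in>U. Binc (vmap p w) x * phi c x)"
proof -
  have "bd c w - bd c (conjv w) = (\<Sum>k\<in>At. c k * (inc w k - inc (conjv w) k))"
    by (simp add: bd_def sum_subtractf[symmetric] algebra_simps)
  also have "\<dots> = (\<Sum>x\<in>U. sg w * (Binc (vmap p w) x * phi c x)) + (\<Sum>x\<in>A - U. 0)"
    unfolding sum_At
  proof (intro arg_cong2[of _ _ _ _ "(+)"] sum.cong refl)
    fix x assume x: "x \<in> U"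
    note h = U_halfedges[OF x] and l = lifth[OF U_halfedges[OF x]]
    have "inc w (conjh (lifth x)) - inc (conjv w) (conjh (lifth x))
        = - (inc w (lifth x) - inc (conjv w) (lifth x))"
      using inc_conjh[OF l(1)] w vfib_props[OF w] by simp
    then show "c (lifth x) * (inc w (lifth x) - inc (conjv w) (lifth x)) +
        c (conjh (lifth x)) * (inc w (conjh (lifth x)) - inc (conjv w) (conjh (lifth x)))
        = sg w * (Binc (vmap p w) x * phi c x)"
      by (simp only: inc_lifth[OF h w]) (simp add: phi_def x algebra_simps)
  next
    fix x assume x: "x \<in> A - U"
    then have "inc (conjv w) (lifth x) = inc w (lifth x)"
      using inc_conjh[of "lifth x" w] dil_lift[OF x] w by (simp add: At_iff)
    then show "c (lifth x) * (inc w (lifth x) - inc (conjv w) (lifth x)) = 0" by simp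
  qed
  finally show ?thesis by (simp add: sum_distrib_left)
qed

section \<open>Contraction of the dilation components\<close>

definition dil_adj :: "('v \<times> 'v) set" where
  "dil_adj = adjacency (dilation_subgraph Gt G p)"

lemma dil_adjE:
  assumes "(u, v) \<in> dil_adj"
  obtains x where "x \<in> halfedges G" "dilated_edge Gt p (edge_of G x)"
    "u = rootv G x" "v = rootv G (flip G x)"
  using assms by (auto simp: dil_adj_def adjacency_def dilation_subgraph_def)

lemma dil_adjI:
  "x \<in> halfedges G \<Longrightarrow> dilated_edge Gt p (edge_of G x) \<Longrightarrow> (rootv G x, rootv G (flip G x)) \<in> dil_adj"
  by (auto simp: dil_adj_def adjacency_def dilation_subgraph_def)

lemma sym_dil_adj: "sym dil_adj"
proof (rule symI)
  fix u v assume "(u, v) \<in> dil_adj"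
  then show "(v, u) \<in> dil_adj"
    using dil_adjI[of "flip G x" for x] base.flip_closed base.flip_flip base.edge_of_flip
    by (elim dil_adjE) metis
qed

lemma dil_adj_Vd: "(u, v) \<in> dil_adj \<Longrightarrow> u \<in> Vd \<and> v \<in> Vd"
  using dilated_rootv base.rootv_closed base.flip_closed base.edge_of_flip
  by (elim dil_adjE) (simp add: Vd_def)

lemma dil_star_Vd: "(u, v) \<in> dil_adj\<^sup>* \<Longrightarrow> u = v \<or> (u \<in> Vd \<and> v \<in> Vd)"
  by (induction rule: rtrancl_induct) (auto dest: dil_adj_Vd)

text \<open>A chosen representative of the dilation component of a dilated vertex; undilated vertices
  represent themselves.\<close>

definition q :: "'v \<Rightarrow> 'v" where
  "q v = (SOME u. (v, u) \<in> dil_adj\<^sup>*)"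

lemma q_star: "(v, q v) \<in> dil_adj\<^sup>*"
  unfolding q_def by (rule someI[of _ v]) simp

lemma q_eq: "(u, v) \<in> dil_adj\<^sup>* \<Longrightarrow> q u = q v"
  unfolding q_def
  by (rule arg_cong[of _ _ Eps], rule ext)
    (use sym_rtrancl[OF sym_dil_adj] in \<open>blast dest: symD intro: rtrancl_trans\<close>)

lemma q_eq_iff: "q u = q v \<longleftrightarrow> (u, v) \<in> dil_adj\<^sup>*"
  using q_eq q_star sym_rtrancl[OF sym_dil_adj] by (metis rtrancl_trans symD)

lemma q_Vu: "v \<in> Vu \<Longrightarrow> q v = v"
  using dil_star_Vd[OF q_star[of v]] vertices_split by auto

lemma q_Vd: "v \<in> Vd \<Longrightarrow> q v \<in> Vd"
  using dil_star_Vd[OF q_star[of v]] by auto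

lemma q_idem: "q (q v) = q v"
  using q_eq[OF q_star[of v]] by simp

lemma q_dilated:
  "x \<in> halfedges G \<Longrightarrow> dilated_edge Gt p (edge_of G x) \<Longrightarrow> q (rootv G (flip G x)) = q (rootv G x)"
  using q_eq[OF r_into_rtrancl[OF dil_adjI]] by metis

definition R :: "'v set" where
  "R = q ` Vd"

lemma R_Vd: "R \<subseteq> Vd"
  using q_Vd by (auto simp: R_def)

lemma finite_R: "finite R"
  by (simp add: R_def finite_Vd)

lemma q_in_R: "v \<in> Vd \<Longrightarrow> q v \<in> R"
  by (simp add: R_def)

lemma q_R: "u \<in> R \<Longrightarrow> q u = u"
  by (auto simp: R_def q_idem)

lemma q_R_iff: "v \<in> vertices G \<Longrightarrow> q v \<in> R \<longleftrightarrow> v \<in> Vd"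
  using q_in_R q_Vu R_Vd vertices_split by fastforce

lemma card_R: "card R = card (components (dilation_subgraph Gt G p))"
proof -
  have "components (dilation_subgraph Gt G p) = (\<lambda>v. dil_adj\<^sup>* `` {v}) ` Vd"
    by (auto simp: components_def quotient_def dil_adj_def dilation_subgraph_def Vd_def)
  also have "\<dots> = (\<lambda>u. dil_adj\<^sup>* `` {u}) ` R"
  proof -
    have "dil_adj\<^sup>* `` {q v} = dil_adj\<^sup>* `` {v}" for v
      by (auto simp: q_eq_iff[symmetric] q_idem)
    then show ?thesis by (simp add: R_def image_image)
  qed
  also have "card \<dots> = card R"
  proof (rule card_image, rule inj_onI)
    fix u v assume uv: "u \<in> R" "v \<in> R" "dil_adj\<^sup>* `` {u} = dil_adj\<^sup>* `` {v}"
    then have "(u, v) \<in> dil_adj\<^sup>*" by blast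
    then show "u = v" using q_eq q_R uv by metis
  qed
  finally show ?thesis by simp
qed

text \<open>This dilation component becomes the root of the spanning tree, and it is the one whose
  parity follows from the others.\<close>

definition x0 :: "'v" where
  "x0 = (SOME u. u \<in> R)"

lemma x0: "x0 \<in> R"
proof -
  have "R \<noteq> {}" using dilated by (auto simp: dilated_cover_def dilation_subgraph_def R_def Vd_def)
  then show ?thesis by (simp add: x0_def some_in_eq)
qed

text \<open>The incidence matrix after contracting every dilation component, without sheet signs:
  the net flow of the edge into the class \<open>u\<close>.\<close>

definition Yinc :: "'v \<Rightarrow> 'h \<Rightarrow> int" where
  "Yinc u x = (if q (rootv G (flip G x)) = u then 1 else 0) - (if q (rootv G x) = u then 1 else 0)"

lemma Yinc_dilated: "x \<in> A - U \<Longrightarrow> Yinc u x = 0"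
  using q_dilated[of x] A_halfedges[of x] by (simp add: Yinc_def U_def)

text \<open>A dilated edge stays inside one class and does not contribute to the total boundary over
  it, while both lifts of an undilated edge contribute with the same sign.\<close>

lemma sum_bd_class:
  "(\<Sum>w | w \<in> vertices Gt \<and> q (vmap p w) = u. bd c w)
    = (\<Sum>x\<in>U. (c (lifth x) + c (conjh (lifth x))) * Yinc u x)"
proof -
  let ?W = "{w \<in> vertices Gt. q (vmap p w) = u}"
  have fin: "finite ?W" using top.finite_vertices by simp
  have Y: "(\<Sum>w\<in>?W. inc w k) = Yinc u (hmap p k)" if k: "k \<in> At" for k
  proof -
    have h: "k \<in> halfedges Gt" "flip Gt k \<in> halfedges Gt" using k top.flip_closed by (auto simp: At_iff)
    have "(\<Sum>w\<in>?W. inc w k) = (if rootv Gt (flip Gt k) \<in> ?W then 1 else 0) - (if rootv Gt k \<in> ?W then 1 else 0)"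
      using fin by (simp add: inc_def sum_subtractf)
    then show ?thesis
      using h top.rootv_closed by (simp add: Yinc_def map_rootv map_flip)
  qed
  have "(\<Sum>w\<in>?W. bd c w) = (\<Sum>k\<in>At. c k * (\<Sum>w\<in>?W. inc w k))"
    unfolding bd_def by (subst sum.swap) (simp add: sum_distrib_left)
  also have "\<dots> = (\<Sum>k\<in>At. c k * Yinc u (hmap p k))"
    by (rule sum.cong) (simp_all add: Y)
  also have "\<dots> = (\<Sum>x\<in>U. (c (lifth x) + c (conjh (lifth x))) * Yinc u x) + (\<Sum>x\<in>A - U. 0)"
    unfolding sum_At
    by (intro arg_cong2[of _ _ _ _ "(+)"] sum.cong refl)
      (use lifth hfib_props U_halfedges A_halfedges Yinc_dilated in \<open>auto simp: algebra_simps\<close>)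
  finally show ?thesis by simp
qed

definition latM :: "('h \<Rightarrow> int) set" where
  "latM = {a. (\<forall>x. x \<notin> U \<longrightarrow> a x = 0) \<and> (\<forall>v\<in>Vu. (\<Sum>x\<in>U. Binc v x * a x) = 0)}"

definition latL :: "('h \<Rightarrow> int) set" where
  "latL = {a \<in> latM. \<forall>u\<in>R - {x0}. even (\<Sum>x\<in>U. Yinc u x * a x)}"

text \<open>For a cycle the total boundary over every class vanishes. This is a statement about the
  sums of the two coefficients over each edge, and modulo 2 these agree with the differences
  \<open>phi c\<close>.\<close>

lemma phi_cycle_in_latL:
  assumes c: "\<And>w. w \<in> vertices Gt \<Longrightarrow> bd c w = 0"
  shows "phi c \<in> latL"
proof -
  have "(\<Sum>x\<in>U. Binc v x * phi c x) = 0" if v: "v \<in> Vu" for v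
  proof -
    have "v \<in> vertices G" "sg (liftv v) = 1" using v sg_liftv by (auto simp: Vu_def)
    then show ?thesis
      using bd_antisym[of "liftv v" c] liftv[of v] vfib_props[of "liftv v"] c by simp
  qed
  moreover have "even (\<Sum>x\<in>U. Yinc u x * phi c x)" for u
  proof -
    have "0 = (\<Sum>x\<in>U. (c (lifth x) + c (conjh (lifth x))) * Yinc u x)"
      using sum_bd_class[where u = u and c = c] c by simp
    also have "\<dots> = (\<Sum>x\<in>U. Yinc u x * phi c x) + 2 * (\<Sum>x\<in>U. c (conjh (lifth x)) * Yinc u x)"
      by (simp add: sum_distrib_left sum.distrib[symmetric] phi_def algebra_simps)
    finally show ?thesis by presburger
  qed
  ultimately show ?thesis by (auto simp: latL_def latM_def phi_def)
qed

end

section \<open>Boundaries of invariant chains\<close>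

context oriented_cover
begin

lemma bd_add: "bd (\<lambda>k. c k + d k) w = bd c w + bd d w"
  by (simp add: bd_def algebra_simps sum.distrib)

lemma bd_cmult: "bd (\<lambda>k. n * c k) w = n * bd c w"
  by (simp add: bd_def sum_distrib_left mult.assoc)

lemma bd_diff: "bd (\<lambda>k. c k - d k) w = bd c w - bd d w"
  by (simp add: bd_def algebra_simps sum_subtractf)

text \<open>\<open>phi b = 0\<close> says that \<open>b\<close> is invariant under the covering involution.\<close>

definition inv_bdry :: "('w \<Rightarrow> int) \<Rightarrow> bool" where
  "inv_bdry z \<longleftrightarrow> (\<exists>b. (\<forall>x. phi b x = 0) \<and> (\<forall>w\<in>vertices Gt. bd b w = z w))"

lemma inv_bdry_cong: "inv_bdry z \<Longrightarrow> (\<And>w. w \<in> vertices Gt \<Longrightarrow> z w = z' w) \<Longrightarrow> inv_bdry z'"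
  by (auto simp: inv_bdry_def)

lemma inv_bdry_zero: "inv_bdry (\<lambda>w. 0)"
  unfolding inv_bdry_def by (rule exI[of _ "\<lambda>k. 0"]) (simp add: phi_def bd_def)

lemma inv_bdry_add:
  assumes "inv_bdry z" "inv_bdry z'"
  shows "inv_bdry (\<lambda>w. z w + z' w)"
proof -
  obtain b b' where "\<forall>x. phi b x = 0" "\<forall>w\<in>vertices Gt. bd b w = z w"
    "\<forall>x. phi b' x = 0" "\<forall>w\<in>vertices Gt. bd b' w = z' w"
    using assms unfolding inv_bdry_def by blast
  then show ?thesis unfolding inv_bdry_def
    by (intro exI[of _ "\<lambda>k. b k + b' k"]) (auto simp: bd_add phi_def split: if_splits)
qed

lemma inv_bdry_cmult:
  assumes "inv_bdry z"
  shows "inv_bdry (\<lambda>w. n * z w)"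
proof -
  obtain b where "\<forall>x. phi b x = 0" "\<forall>w\<in>vertices Gt. bd b w = z w"
    using assms unfolding inv_bdry_def by blast
  then show ?thesis unfolding inv_bdry_def
    by (intro exI[of _ "\<lambda>k. n * b k"]) (auto simp: bd_cmult phi_def split: if_splits)
qed

lemma inv_bdry_uminus: "inv_bdry (\<lambda>w. z w - z' w) \<Longrightarrow> inv_bdry (\<lambda>w. z' w - z w)"
  using inv_bdry_cmult[of "\<lambda>w. z w - z' w" "-1"] by simp

lemma inv_bdry_trans:
  "inv_bdry (\<lambda>w. z w - y w) \<Longrightarrow> inv_bdry (\<lambda>w. y w - x w) \<Longrightarrow> inv_bdry (\<lambda>w. z w - x w)"
  using inv_bdry_add[of "\<lambda>w. z w - y w" "\<lambda>w. y w - x w"] by simp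

lemma inv_bdry_sum:
  "finite I \<Longrightarrow> (\<And>i. i \<in> I \<Longrightarrow> inv_bdry (z i)) \<Longrightarrow> inv_bdry (\<lambda>w. \<Sum>i\<in>I. z i w)"
  by (induction I rule: finite_induct) (auto simp: inv_bdry_zero inv_bdry_add)

text \<open>The pullback of the vertex \<open>v\<close> as a 0-chain: its fibre counted with
  degrees.\<close>

definition tau :: "'v \<Rightarrow> 'w \<Rightarrow> int" where
  "tau v w = (if vmap p w = v then int (vdeg p w) else 0)"

text \<open>For dilated \<open>v\<close> this is the single point over \<open>v\<close> counted
  once, half of \<open>tau v\<close>.\<close>

definition dl :: "'v \<Rightarrow> 'w \<Rightarrow> int" where
  "dl v w = (if vmap p w = v then 1 else 0)"

lemma halfedge_A_cases: "x \<in> halfedges G \<Longrightarrow> x \<in> A \<or> flip G x \<in> A"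
  using orient_base unfolding orientation_def by blast

lemma fibre_degree_at:
  assumes x: "x \<in> halfedges G" and w: "w \<in> vertices Gt"
  shows "(\<Sum>k\<in>hfib x. if rootv Gt k = w then int (edeg p (edge_of Gt k)) else 0) = tau (rootv G x) w"
proof -
  have "(\<Sum>k\<in>hfib x. if rootv Gt k = w then int (edeg p (edge_of Gt k)) else 0)
      = (\<Sum>k\<in>{k \<in> halfedges Gt. rootv Gt k = w \<and> hmap p k = x}. int (edeg p (edge_of Gt k)))"
    by (rule sum.mono_neutral_cong_right) (auto simp: top.finite_halfedges)
  also have "\<dots> = tau (rootv G x) w"
  proof (cases "rootv G x = vmap p w")
    case True
    then show ?thesis using harmonic[OF w x True] by (simp add: tau_def)
  next
    case False
    then have "{k \<in> halfedges Gt. rootv Gt k = w \<and> hmap p k = x} = {}" by (auto simp: map_rootv)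
    then show ?thesis using False unfolding tau_def by (metis sum.empty)
  qed
  finally show ?thesis .
qed

text \<open>The boundary of a pulled-back edge is the pullback of its boundary, by harmonicity at
  both ends. This serves both for constructing invariant chains and for showing that pullbacks of
  cycles are cycles.\<close>

lemma bd_fibre:
  assumes xA: "x \<in> A" and w: "w \<in> vertices Gt"
  shows "bd (\<lambda>k. if hmap p k = x then int (edeg p (edge_of Gt k)) else 0) w
    = tau (rootv G (flip G x)) w - tau (rootv G x) w"
proof -
  let ?d = "\<lambda>k. int (edeg p (edge_of Gt k))"
  have x: "x \<in> halfedges G" "flip G x \<in> halfedges G" using xA A_halfedges base.flip_closed by auto
  have "bd (\<lambda>k. if hmap p k = x then ?d k else 0) w = (\<Sum>k\<in>hfib x. ?d k * inc w k)"
    unfolding bd_def by (rule sum.mono_neutral_cong_right)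
      (use xA in \<open>auto simp: finite_At At_iff\<close>)
  also have "\<dots> = (\<Sum>k\<in>hfib x. if rootv Gt (flip Gt k) = w then ?d k else 0)
      - (\<Sum>k\<in>hfib x. if rootv Gt k = w then ?d k else 0)"
    unfolding sum_subtractf[symmetric] by (rule sum.cong) (auto simp: inc_def)
  also have "(\<Sum>k\<in>hfib x. if rootv Gt (flip Gt k) = w then ?d k else 0)
      = (\<Sum>k\<in>hfib (flip G x). if rootv Gt k = w then ?d k else 0)"
    by (rule sum.reindex_bij_witness[of _ "flip Gt" "flip Gt"])
      (use x in \<open>auto simp: top.flip_flip top.flip_closed map_flip base.flip_flip top.edge_of_flip\<close>)
  finally show ?thesis using fibre_degree_at[OF x(1) w] fibre_degree_at[OF x(2) w] by simp
qed

lemma edeg_conjh: "k \<in> halfedges Gt \<Longrightarrow> edeg p (edge_of Gt (conjh k)) = edeg p (edge_of Gt k)"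
  using hfib_props[of k] hfib_props(4,5)[of "conjh k"] by auto

lemma inv_bdry_tau_edge:
  assumes x: "x \<in> halfedges G"
  shows "inv_bdry (\<lambda>w. tau (rootv G (flip G x)) w - tau (rootv G x) w)"
proof -
  have A: "inv_bdry (\<lambda>w. tau (rootv G (flip G x)) w - tau (rootv G x) w)" if xA: "x \<in> A" for x
  proof -
    define b where "b k = (if hmap p k = x then int (edeg p (edge_of Gt k)) else 0)" for k
    have "phi b y = 0" for y
    proof (cases "y \<in> U")
      case True
      note l = lifth(1)[OF U_halfedges[OF True]]
      show ?thesis by (simp add: phi_def b_def hfib_props(3)[OF l] edeg_conjh[OF l])
    qed (simp add: phi_def)
    moreover have "bd b w = tau (rootv G (flip G x)) w - tau (rootv G x) w" if w: "w \<in> vertices Gt" for w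
      unfolding b_def by (rule bd_fibre[OF xA w])
    ultimately show ?thesis unfolding inv_bdry_def by blast
  qed
  show ?thesis
    using halfedge_A_cases[OF x] A[of x] inv_bdry_uminus[OF A[of "flip G x"]] base.flip_flip[OF x]
    by auto
qed

text \<open>Here connectedness of the base is used: the pulled-back edges of a path from
  \<open>u\<close> to \<open>v\<close> form an invariant chain with this boundary.\<close>

lemma inv_bdry_tau:
  assumes "u \<in> vertices G" "v \<in> vertices G"
  shows "inv_bdry (\<lambda>w. tau v w - tau u w)"
proof -
  have "(u, v) \<in> (adjacency G)\<^sup>*" using base_connected assms by (auto simp: connected_graph_def)
  then show ?thesis
  proof (induction rule: rtrancl_induct)
    case base show ?case using inv_bdry_zero by simp
  next
    case (step y z)
    from step(2) have "inv_bdry (\<lambda>w. tau z w - tau y w)"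
      by (auto simp: adjacency_def intro: inv_bdry_tau_edge)
    then show ?case by (rule inv_bdry_trans[OF _ step(3)])
  qed
qed

lemma root_eq_dilated:
  assumes "t \<in> vertices Gt" "w \<in> vertices Gt" "vmap p t \<in> Vd"
  shows "t = w \<longleftrightarrow> vmap p w = vmap p t"
  using over_same_vertex[OF assms(1,2)] dilated_vertex_iff[OF assms(1)] assms(3) by (auto simp: Vd_def)

text \<open>The only lift of a dilated edge is itself invariant, so it may be used with coefficient
  1, half of what the pullback would give.\<close>

lemma inv_bdry_dl_edge:
  assumes x: "x \<in> halfedges G" and dil: "dilated_edge Gt p (edge_of G x)"
  shows "inv_bdry (\<lambda>w. dl (rootv G (flip G x)) w - dl (rootv G x) w)"
proof -
  have A: "inv_bdry (\<lambda>w. dl (rootv G (flip G x)) w - dl (rootv G x) w)"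
    if xA: "x \<in> A" and dil: "dilated_edge Gt p (edge_of G x)" for x
  proof -
    have h: "x \<in> halfedges G" and AU: "x \<in> A - U" using xA dil A_halfedges by (auto simp: U_def)
    have ends: "rootv G x \<in> Vd" "rootv G (flip G x) \<in> Vd"
      using dil_adj_Vd[OF dil_adjI[OF h dil]] by auto
    define b where "b k = (if hmap p k = x then 1 else 0 :: int)" for k
    have "phi b y = 0" for y
      using hfib_props[of "lifth y"] lifth(1)[of y] U_halfedges[of y] by (simp add: phi_def b_def)
    moreover have "bd b w = dl (rootv G (flip G x)) w - dl (rootv G x) w" if w: "w \<in> vertices Gt" for w
    proof -
      have "bd b w = (\<Sum>k\<in>hfib x. inc w k)"
        unfolding bd_def by (rule sum.mono_neutral_cong_right)
          (use xA in \<open>auto simp: finite_At At_iff b_def\<close>)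
      also have "\<dots> = inc w (lifth x)"
        unfolding hfib_eq[OF h] by (simp add: dil_lift[OF AU])
      also have "\<dots> = dl (rootv G (flip G x)) w - dl (rootv G x) w"
        using root_eq_dilated[OF lifth_root(1)[OF h] w] root_eq_dilated[OF lifth_root(2)[OF h] w] ends
        by (simp add: inc_def dl_def lifth_root[OF h])
      finally show ?thesis .
    qed
    ultimately show ?thesis unfolding inv_bdry_def by blast
  qed
  show ?thesis
    using halfedge_A_cases[OF x] A[of x] inv_bdry_uminus[OF A[of "flip G x"]] base.flip_flip[OF x]
      base.edge_of_flip[OF x] dil by auto
qed

lemma inv_bdry_dl:
  assumes "(u, v) \<in> dil_adj\<^sup>*"
  shows "inv_bdry (\<lambda>w. dl v w - dl u w)"
  using assms
proof (induction rule: rtrancl_induct)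
  case base show ?case using inv_bdry_zero by simp
next
  case (step y z)
  from step(2) have "inv_bdry (\<lambda>w. dl z w - dl y w)"
    by (elim dil_adjE) (simp add: inv_bdry_dl_edge)
  then show ?case by (rule inv_bdry_trans[OF _ step(3)])
qed

lemma sum_Vt:
  fixes f :: "'w \<Rightarrow> int"
  shows "(\<Sum>w\<in>vertices Gt. f w) = (\<Sum>v\<in>Vu. f (liftv v) + f (conjv (liftv v))) + (\<Sum>v\<in>Vd. f (liftv v))"
proof -
  have "(\<Sum>w\<in>vertices Gt. f w) = (\<Sum>v\<in>vertices G. \<Sum>w\<in>vfib v. f w)"
    by (rule sum.group[symmetric]) (auto simp: base.finite_vertices top.finite_vertices vmap_closed)
  also have "\<dots> = (\<Sum>v\<in>Vu. \<Sum>w\<in>vfib v. f w) + (\<Sum>v\<in>Vd. \<Sum>w\<in>vfib v. f w)"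
    unfolding vertices_split(1) by (rule sum.union_disjoint) (auto simp: finite_Vu finite_Vd vertices_split)
  also have "(\<Sum>v\<in>Vu. \<Sum>w\<in>vfib v. f w) = (\<Sum>v\<in>Vu. f (liftv v) + f (conjv (liftv v)))"
  proof (rule sum.cong[OF refl])
    fix v assume "v \<in> Vu"
    then have v: "v \<in> vertices G" "conjv (liftv v) \<noteq> liftv v"
      using dilated_vertex_iff[of "liftv v"] liftv[of v] by (auto simp: Vu_def)
    then show "(\<Sum>w\<in>vfib v. f w) = f (liftv v) + f (conjv (liftv v))"
      unfolding vfib_eq[OF v(1)] by (simp add: eq_commute)
  qed
  also have "(\<Sum>v\<in>Vd. \<Sum>w\<in>vfib v. f w) = (\<Sum>v\<in>Vd. f (liftv v))"
  proof (rule sum.cong[OF refl])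
    fix v assume "v \<in> Vd"
    then have v: "v \<in> vertices G" "conjv (liftv v) = liftv v"
      using dilated_vertex_iff[of "liftv v"] liftv[of v] by (auto simp: Vd_def)
    then show "(\<Sum>w\<in>vfib v. f w) = f (liftv v)"
      unfolding vfib_eq[OF v(1)] by simp
  qed
  finally show ?thesis .
qed

lemma sum_Vd_classes:
  fixes f :: "'v \<Rightarrow> int"
  shows "(\<Sum>v\<in>Vd. f v) = (\<Sum>u\<in>R. \<Sum>v | v \<in> Vd \<and> q v = u. f v)"
  by (rule sum.group[symmetric]) (auto simp: finite_Vd finite_R q_in_R)

lemma dl_tau: "u \<in> Vd \<Longrightarrow> w \<in> vertices Gt \<Longrightarrow> tau u w = 2 * dl u w"
  using vfib_props(5)[of w] dilated_vertex_iff[of w] by (auto simp: tau_def dl_def Vd_def)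

text \<open>Modulo boundaries of invariant chains all \<open>tau v\<close> agree, and \<open>dl v\<close> depends only on the
  dilation component of \<open>v\<close>, with \<open>tau v = 2 dl v\<close>.\<close>

lemma inv_bdry_if_even:
  assumes inv: "\<And>w. w \<in> vertices Gt \<Longrightarrow> z (conjv w) = z w"
    and total: "(\<Sum>w\<in>vertices Gt. z w) = 0"
    and even: "\<And>u. u \<in> R - {x0} \<Longrightarrow> even (\<Sum>v | v \<in> Vd \<and> q v = u. z (liftv v))"
  shows "inv_bdry z"
proof -
  define y where "y u = (\<Sum>v | v \<in> Vd \<and> q v = u. z (liftv v))" for u
  \<comment> \<open>The transports below add up to \<open>z\<close> minus \<open>N\<close> copies of
    \<open>tau x0\<close> and \<open>y x0\<close> copies of \<open>dl x0\<close>. Since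
    \<open>tau x0 = 2 dl x0\<close>, the vanishing total degree says that these two terms
    cancel.\<close>
  define N where "N = (\<Sum>v\<in>Vu. z (liftv v)) + (\<Sum>u\<in>R - {x0}. y u div 2)"
  have x0V: "x0 \<in> vertices G" "x0 \<in> Vd" using x0 R_Vd by (auto simp: Vd_def)
  have "(\<Sum>w\<in>vertices Gt. z w) = 2 * (\<Sum>v\<in>Vu. z (liftv v)) + (\<Sum>u\<in>R. y u)"
    unfolding sum_Vt sum_Vd_classes y_def
    by (simp add: sum_distrib_left) (rule sum.cong, auto simp: inv liftv Vu_def)
  also have "(\<Sum>u\<in>R. y u) = y x0 + (\<Sum>u\<in>R - {x0}. y u)"
    by (rule sum.remove[OF finite_R x0])
  also have "(\<Sum>u\<in>R - {x0}. y u) = 2 * (\<Sum>u\<in>R - {x0}. y u div 2)"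
    unfolding sum_distrib_left by (rule sum.cong) (use even in \<open>auto simp: y_def\<close>)
  finally have N: "2 * N + y x0 = 0" using total by (simp add: N_def)
  have z: "z w = (\<Sum>v\<in>Vu. z (liftv v) * tau v w) + (\<Sum>v\<in>Vd. z (liftv v) * dl v w)"
    if w: "w \<in> vertices Gt" for w
  proof -
    have v: "vmap p w \<in> vertices G" using w by (rule vmap_closed)
    have zl: "z (liftv (vmap p w)) = z w"
      using over_same_vertex[OF w liftv(1)[OF v] liftv(2)[OF v]] inv[OF w] by auto
    have 1: "(\<Sum>v\<in>Vu. z (liftv v) * tau v w) = (if vmap p w \<in> Vu then z w * int (vdeg p w) else 0)"
      using finite_Vu by (simp add: tau_def zl if_distrib[of "\<lambda>t. _ * t"] cong: if_cong)
    have 2: "(\<Sum>v\<in>Vd. z (liftv v) * dl v w) = (if vmap p w \<in> Vd then z w else 0)"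
      using finite_Vd by (simp add: dl_def zl if_distrib[of "\<lambda>t. _ * t"] cong: if_cong)
    show ?thesis
      unfolding 1 2 using vfib_props(5)[OF w] dilated_vertex_iff[OF w] v by (auto simp: Vu_def Vd_def)
  qed
  \<comment> \<open>Undilated fibres are moved to \<open>x0\<close> as whole pullbacks, points over
    dilated vertices to the representative of their component, and the even totals collected there
    to \<open>x0\<close> as multiples of \<open>tau\<close>.\<close>
  have A1: "inv_bdry (\<lambda>w. \<Sum>v\<in>Vu. z (liftv v) * (tau v w - tau x0 w))"
    by (intro inv_bdry_sum inv_bdry_cmult inv_bdry_tau) (use x0V finite_Vu in \<open>auto simp: Vu_def\<close>)
  have A2: "inv_bdry (\<lambda>w. \<Sum>v\<in>Vd. z (liftv v) * (dl v w - dl (q v) w))"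
    by (intro inv_bdry_sum inv_bdry_cmult inv_bdry_dl finite_Vd)
      (use q_eq_iff q_idem in blast)
  have A3: "inv_bdry (\<lambda>w. \<Sum>u\<in>R - {x0}. (y u div 2) * (tau u w - tau x0 w))"
    by (intro inv_bdry_sum inv_bdry_cmult inv_bdry_tau) (use x0V finite_R R_Vd in \<open>auto simp: Vd_def\<close>)
  show ?thesis
  proof (rule inv_bdry_cong[OF inv_bdry_add[OF inv_bdry_add[OF A1 A2] A3]])
    fix w assume w: "w \<in> vertices Gt"
    have "(\<Sum>v\<in>Vd. z (liftv v) * dl (q v) w) = (\<Sum>u\<in>R. y u * dl u w)"
      unfolding sum_Vd_classes[of "\<lambda>v. z (liftv v) * dl (q v) w"] y_def sum_distrib_right by simp
    also have "\<dots> = y x0 * dl x0 w + (\<Sum>u\<in>R - {x0}. y u * dl u w)"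
      by (rule sum.remove[OF finite_R x0])
    also have "(\<Sum>u\<in>R - {x0}. y u * dl u w) = (\<Sum>u\<in>R - {x0}. (y u div 2) * tau u w)"
    proof (rule sum.cong[OF refl])
      fix u assume u: "u \<in> R - {x0}"
      then have "y u = 2 * (y u div 2)" using even by (simp add: y_def)
      then show "y u * dl u w = (y u div 2) * tau u w"
        using dl_tau[of u w] u w R_Vd by (metis (no_types) DiffD1 mult.assoc mult.commute subsetD)
    qed
    finally have 3: "(\<Sum>v\<in>Vd. z (liftv v) * dl (q v) w)
        = y x0 * dl x0 w + (\<Sum>u\<in>R - {x0}. (y u div 2) * tau u w)" .
    have "(\<Sum>v\<in>Vu. z (liftv v) * (tau v w - tau x0 w)) + (\<Sum>v\<in>Vd. z (liftv v) * (dl v w - dl (q v) w))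
        + (\<Sum>u\<in>R - {x0}. (y u div 2) * (tau u w - tau x0 w))
        = z w - N * tau x0 w - y x0 * dl x0 w"
      unfolding z[OF w] N_def using 3
      by (simp add: right_diff_distrib sum_subtractf distrib_right sum_distrib_right)
    also have "\<dots> = z w - (2 * N + y x0) * dl x0 w"
      using dl_tau[OF x0V(2) w] by (simp add: algebra_simps)
    finally show "(\<Sum>v\<in>Vu. z (liftv v) * (tau v w - tau x0 w)) + (\<Sum>v\<in>Vd. z (liftv v) * (dl v w - dl (q v) w))
        + (\<Sum>u\<in>R - {x0}. (y u div 2) * (tau u w - tau x0 w)) = z w"
      using N by simp
  qed
qed

text \<open>Placing all of \<open>a\<close> on the chosen lifts gives the right differences but in
  general no cycle. The equations of \<open>latM\<close> make its boundary invariant and the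
  parities of \<open>latL\<close> make its component totals even, so an invariant chain has the same
  boundary; subtracting that chain leaves \<open>phi\<close> unchanged.\<close>

lemma latL_lift:
  assumes a: "a \<in> latL"
  obtains c where "\<And>w. w \<in> vertices Gt \<Longrightarrow> bd c w = 0" "phi c = a"
proof -
  define c0 where "c0 k = (if k = lifth (hmap p k) then a (hmap p k) else 0)" for k
  have supp: "a x = 0" if "x \<notin> U" for x using a that by (auto simp: latL_def latM_def)
  have c0: "c0 (lifth x) = a x" "c0 (conjh (lifth x)) = 0" if "x \<in> U" for x
    using lifth[OF U_halfedges[OF that]] hfib_props[of "lifth x"] U_lift(3)[OF that] by (simp_all add: c0_def)
  have phi0: "phi c0 x = a x" for x using supp c0 by (simp add: phi_def)
  have "inv_bdry (bd c0)"
  proof (rule inv_bdry_if_even)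
    fix w assume w: "w \<in> vertices Gt"
    show "bd c0 (conjv w) = bd c0 w"
    proof (cases "vmap p w \<in> Vu")
      case True
      then have "(\<Sum>x\<in>U. Binc (vmap p w) x * a x) = 0" using a by (auto simp: latL_def latM_def)
      then show ?thesis using bd_antisym[OF w, of c0] by (simp add: phi0)
    next
      case False
      then show ?thesis using dilated_vertex_iff[OF w] vmap_closed[OF w] by (simp add: Vu_def)
    qed
  next
    have "(\<Sum>w\<in>vertices Gt. inc w k) = 0" if "k \<in> At" for k
      using that top.finite_vertices top.rootv_closed top.flip_closed
      by (simp add: inc_def sum_subtractf At_iff)
    then show "(\<Sum>w\<in>vertices Gt. bd c0 w) = 0"
      unfolding bd_def by (subst sum.swap) (simp add: sum_distrib_left[symmetric])
  next
    fix u assume u: "u \<in> R - {x0}"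
    have "(\<Sum>v | v \<in> Vd \<and> q v = u. bd c0 (liftv v)) = (\<Sum>w | w \<in> vertices Gt \<and> q (vmap p w) = u. bd c0 w)"
    proof (rule sum.reindex_bij_witness[of _ "vmap p" liftv])
      fix w assume w: "w \<in> {w \<in> vertices Gt. q (vmap p w) = u}"
      then have Vd: "vmap p w \<in> Vd" using u q_R_iff vmap_closed by auto
      then show "vmap p w \<in> {v \<in> Vd. q v = u}" using w by simp
      have "vmap p w \<in> vertices G" using Vd by (simp add: Vd_def)
      then show "liftv (vmap p w) = w" using root_eq_dilated[of w "liftv (vmap p w)"] w Vd liftv by auto
    qed (use liftv in \<open>auto simp: Vd_def\<close>)
    also have "\<dots> = (\<Sum>x\<in>U. Yinc u x * a x)"
      unfolding sum_bd_class by (rule sum.cong) (auto simp: c0)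
    finally show "even (\<Sum>v | v \<in> Vd \<and> q v = u. bd c0 (liftv v))"
      using a u by (simp add: latL_def)
  qed
  then obtain b where b: "\<forall>x. phi b x = 0" "\<forall>w\<in>vertices Gt. bd b w = bd c0 w"
    by (auto simp: inv_bdry_def)
  show ?thesis
  proof
    show "bd (\<lambda>k. c0 k - b k) w = 0" if "w \<in> vertices Gt" for w using b that by (simp add: bd_diff)
    have "phi (\<lambda>k. c0 k - b k) x = phi c0 x - phi b x" for x by (simp add: phi_def)
    then show "phi (\<lambda>k. c0 k - b k) = a" using phi0 b by auto
  qed
qed

text \<open>For the chain with \<open>a\<close> on one sheet and \<open>- a\<close> on the other,
  the invariant part of the boundary cancels identically, and the anti-invariant part vanishes by
  the equations of \<open>latM\<close>.\<close>

lemma latM_lift: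
  assumes a: "a \<in> latM"
    and c: "\<And>x. x \<in> U \<Longrightarrow> c (lifth x) = a x \<and> c (conjh (lifth x)) = - a x"
    and c0: "\<And>x. x \<in> A - U \<Longrightarrow> c (lifth x) = 0" and w: "w \<in> vertices Gt"
  shows "bd c w = 0"
proof -
  have "(\<Sum>k\<in>At. c k * (inc w k + inc (conjv w) k)) = (\<Sum>x\<in>U. 0) + (\<Sum>x\<in>A - U. 0)"
    unfolding sum_At
  proof (intro arg_cong2[of _ _ _ _ "(+)"] sum.cong refl)
    fix x assume x: "x \<in> U"
    note l = lifth[OF U_halfedges[OF x]]
    show "c (lifth x) * (inc w (lifth x) + inc (conjv w) (lifth x)) +
        c (conjh (lifth x)) * (inc w (conjh (lifth x)) + inc (conjv w) (conjh (lifth x))) = 0"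
      using inc_conjh[OF l(1)] w vfib_props[OF w] c[OF x] by (simp add: algebra_simps)
  qed (simp add: c0)
  then have "bd c w + bd c (conjv w) = 0"
    by (simp add: bd_def distrib_left sum.distrib)
  moreover have "bd c w - bd c (conjv w) = 0"
  proof (cases "vmap p w \<in> Vu")
    case True
    have "(\<Sum>x\<in>U. Binc (vmap p w) x * phi c x) = 2 * (\<Sum>x\<in>U. Binc (vmap p w) x * a x)"
      unfolding sum_distrib_left by (rule sum.cong) (auto simp: phi_def c)
    also have "\<dots> = 0" using a True by (simp add: latM_def)
    finally show ?thesis using bd_antisym[OF w, of c] by simp
  next
    case False
    then show ?thesis using dilated_vertex_iff[OF w] vmap_closed[OF w] by (simp add: Vu_def)
  qed
  ultimately show ?thesis by simp
qed

text \<open>On anti-invariant chains \<open>phi\<close> is twice the recorded coefficient, and the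
  linear equations may be divided by 2.\<close>

lemma anti_cycle_in_latM:
  assumes c: "\<And>w. w \<in> vertices Gt \<Longrightarrow> bd c w = 0"
    and anti: "\<And>x. x \<in> U \<Longrightarrow> c (conjh (lifth x)) = - c (lifth x)"
  shows "(\<lambda>x. if x \<in> U then c (lifth x) else 0) \<in> latM"
proof -
  have "(\<Sum>x\<in>U. Binc v x * (if x \<in> U then c (lifth x) else 0)) = 0" if v: "v \<in> Vu" for v
  proof -
    have "2 * (\<Sum>x\<in>U. Binc v x * (if x \<in> U then c (lifth x) else 0)) = (\<Sum>x\<in>U. Binc v x * phi c x)"
      unfolding sum_distrib_left by (rule sum.cong) (auto simp: phi_def anti)
    also have "\<dots> = 0" using phi_cycle_in_latL[OF c] v by (simp add: latL_def latM_def)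
    finally show ?thesis by simp
  qed
  then show ?thesis by (simp add: latM_def)
qed

end

section \<open>Bases of the two lattices\<close>

lemma det_list_mat_scale_rows:
  assumes "distinct xs" "length ys = length xs"
  shows "det (list_mat xs ys (\<lambda>x y. d x * f x y)) = (\<Prod>x\<in>set xs. d x) * det (list_mat xs ys f)"
proof -
  have "list_mat xs ys (\<lambda>x y. d x * f x y)
      = list_mat xs ys (\<lambda>x z. \<Sum>y\<in>set xs. (if x = y then d x else 0) * f y z)"
    by (rule list_mat_cong) (simp add: if_distrib[of "\<lambda>t. t * _"] cong: if_cong)
  also have "det \<dots> = det (list_mat xs xs (\<lambda>x y. if x = y then d x else 0)) * det (list_mat xs ys f)"
    by (rule det_list_mat_mult) (use assms in auto)
  finally show ?thesis by (simp add: det_list_mat_diag assms)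
qed

lemma list_mat_nth:
  "list_mat [0..<length xs] [0..<length ys] (\<lambda>i j. f (xs ! i) (ys ! j)) = list_mat xs ys f"
  by (rule eq_matI) auto

context oriented_cover
begin

text \<open>The value 1 instead of 0 at dilated vertices makes all coefficients at the ends of an
  edge units, as the spanning tree argument demands.\<close>

definition sgn1 :: "'w \<Rightarrow> int" where
  "sgn1 w = (if conjv w = w then 1 else sg w)"

definition hd_q :: "'h \<Rightarrow> 'v" where "hd_q x = q (rootv G (flip G x))"
definition tl_q :: "'h \<Rightarrow> 'v" where "tl_q x = q (rootv G x)"

text \<open>The incidence matrix of the graph with every dilation component contracted: the rows of
  \<open>Binc\<close> for undilated vertices together with the rows of \<open>Yinc\<close>.\<close>

definition Binc_q :: "'v \<Rightarrow> 'h \<Rightarrow> int" where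
  "Binc_q y x = (if hd_q x = y then sgn1 (rootv Gt (flip Gt (lifth x))) else 0)
     + (if tl_q x = y then - sgn1 (rootv Gt (lifth x)) else 0)"

lemma q_eq_Vu: "v \<in> vertices G \<Longrightarrow> y \<in> Vu \<Longrightarrow> q v = y \<longleftrightarrow> v = y"
  using q_Vu[of v] q_Vu[of y] q_Vd[of v] vertices_split by (cases "v \<in> Vu") auto

lemma sgn1_cases:
  assumes "w \<in> vertices Gt"
  shows "vmap p w \<in> Vu \<Longrightarrow> sgn1 w = sg w" "vmap p w \<in> Vd \<Longrightarrow> sgn1 w = 1"
  using dilated_vertex_iff[OF assms] by (auto simp: sgn1_def Vu_def Vd_def)

lemma Binc_q_Vu:
  assumes "v \<in> Vu" and x: "x \<in> halfedges G"
  shows "Binc_q v x = Binc v x"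
  using assms(1) q_eq_Vu[OF base.rootv_closed[OF x] assms(1)]
    q_eq_Vu[OF base.rootv_closed[OF base.flip_closed[OF x]] assms(1)]
    sgn1_cases(1)[OF lifth_root(1)[OF x]] sgn1_cases(1)[OF lifth_root(2)[OF x]] lifth_root(3,4)[OF x]
  by (auto simp: Binc_q_def Binc_def hd_q_def tl_q_def)

lemma Binc_q_R:
  assumes "u \<in> R" and x: "x \<in> halfedges G"
  shows "Binc_q u x = Yinc u x"
  using assms(1) q_R_iff[OF base.rootv_closed[OF x]]
    q_R_iff[OF base.rootv_closed[OF base.flip_closed[OF x]]]
    sgn1_cases(2)[OF lifth_root(1)[OF x]] sgn1_cases(2)[OF lifth_root(2)[OF x]] lifth_root(3,4)[OF x]
  by (auto simp: Binc_q_def Yinc_def hd_q_def tl_q_def)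

lemma q_vertices: "q ` vertices G = Vu \<union> R"
  using q_Vu by (force simp: vertices_split(1) R_def image_Un)

lemma quotient_connected:
  assumes "v \<in> vertices G"
  shows "(q v, x0) \<in> ({(hd_q x, tl_q x) | x. x \<in> U} \<union> {(tl_q x, hd_q x) | x. x \<in> U})\<^sup>*"
    (is "_ \<in> ?r\<^sup>*")
proof -
  have "x0 \<in> vertices G" using x0 R_Vd by (auto simp: Vd_def)
  then have "(v, x0) \<in> (adjacency G)\<^sup>*" using base_connected assms by (auto simp: connected_graph_def)
  then have "(q v, q x0) \<in> ?r\<^sup>*"
  proof (induction rule: rtrancl_induct)
    case (step y z)
    from step(2) obtain x where x: "x \<in> halfedges G" "y = rootv G x" "z = rootv G (flip G x)"
      by (auto simp: adjacency_def)
    have "(q y, q z) \<in> ?r\<^sup>*"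
    proof (cases "dilated_edge Gt p (edge_of G x)")
      case True
      then show ?thesis using q_dilated[OF x(1)] x by simp
    next
      case False
      then have "x \<in> U \<or> flip G x \<in> U"
        using halfedge_A_cases[OF x(1)] base.edge_of_flip[OF x(1)] by (auto simp: U_def)
      then have "(q y, q z) \<in> ?r"
        using x(2,3) base.flip_flip[OF x(1)] unfolding hd_q_def tl_q_def by (metis (mono_tags, lifting) UnCI mem_Collect_eq)
      then show ?thesis by blast
    qed
    with step(3) show ?case by (rule rtrancl_trans)
  qed simp
  then show ?thesis by (simp add: q_R x0)
qed

definition lenU :: "'h \<Rightarrow> real" where
  "lenU x = len G (edge_of G x)"

lemma lenU_pos: "x \<in> U \<Longrightarrow> lenU x > 0"
  using base.len_pos[OF edge_of_base[OF U_halfedges]] by (simp add: lenU_def)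

text \<open>The section \<open>S\<close> splits all rows of \<open>Binc_q\<close> except that of
  \<open>x0\<close>. Its columns at the remaining dilation components, together with the fundamental
  cycles of the non-tree edges, form a basis of \<open>latM\<close>; its columns at
  \<open>Vu\<close> are the section of \<open>Binc\<close> that the Gram formula asks for. The
  parities concern just the coordinates belonging to dilation components, so doubling those vectors
  gives a basis of \<open>latL\<close>.\<close>

lemma lattice_bases_gram:
  obtains bM bL where "lattice_basis latM (card U - card Vu) bM" "lattice_basis latL (card U - card Vu) bL"
    "card Vu \<le> card U"
    "\<And>vs. distinct vs \<Longrightarrow> set vs = Vu \<Longrightarrow> det (gram U lenU (card U - card Vu) bL bM)
      = 2 ^ (card R - 1) * (\<Prod>x\<in>U. lenU x) * det (list_mat vs vs
          (\<lambda>v w. \<Sum>x\<in>U. of_int (Binc v x) * (1 / lenU x) * of_int (Binc w x)))"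
proof -
  define X where "X = Vu \<union> R"
  have disj: "Vu \<inter> R = {}" using R_Vd vertices_split by auto
  have x0X: "x0 \<notin> Vu" using x0 disj by auto
  have X': "X - {x0} = Vu \<union> (R - {x0})" using x0X by (auto simp: X_def)
  have rtv: "rootv G x \<in> vertices G" "rootv G (flip G x) \<in> vertices G" if "x \<in> U" for x
    using U_halfedges[OF that] base.rootv_closed base.flip_closed by auto
  have sq: "sgn1 w * sgn1 w = 1" for w using sg_square by (simp add: sgn1_def)
  obtain T S where T: "T \<subseteq> U" "card T = card (X - {x0})"
    and BS: "\<And>x y. x \<in> X - {x0} \<Longrightarrow> y \<in> X - {x0} \<Longrightarrow>
      (\<Sum>u\<in>U. Binc_q x u * S u y) = (if x = y then 1 else 0)"
    and S0: "\<And>u y. u \<notin> T \<Longrightarrow> y \<in> X - {x0} \<Longrightarrow> S u y = (0::int)"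
    and SB: "\<And>f u. f \<in> U \<Longrightarrow> u \<in> T \<Longrightarrow>
      (\<Sum>y\<in>X - {x0}. S f y * Binc_q y u) = (if f = u then 1 else 0)"
  proof (rule spanning_tree_section[of U X hd_q tl_q "\<lambda>x. sgn1 (rootv Gt (flip Gt (lifth x)))"
        "\<lambda>x. - sgn1 (rootv Gt (lifth x))" x0], goal_cases)
    case 1 show ?case using finite_U by simp
  next
    case 2 show ?case using finite_Vu finite_R by (simp add: X_def)
  next
    case (3 u) then show ?case using rtv[OF 3(2)] unfolding hd_q_def tl_q_def X_def q_vertices[symmetric] by blast
  next
    case (4 u) then show ?case using sq by simp
  next
    case (5 x) then show ?case using quotient_connected unfolding X_def q_vertices[symmetric] by auto
  next
    case (6 T S)
    show ?case by (rule 6(1)[of T S]) (use 6(2-) in \<open>simp_all only: Binc_q_def\<close>)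
  qed
  have finX: "finite (X - {x0})" using finite_Vu finite_R by (simp add: X_def)
  \<comment> \<open>\<open>Lm _ e\<close> is the fundamental cycle of \<open>e\<close>: the
    projection of the edge, along the section, to the kernel of all rows other than that of
    \<open>x0\<close>.\<close>
  define Lm where "Lm f e = (if f \<in> U then (if f = e then 1 else 0) - (\<Sum>y\<in>X - {x0}. S f y * Binc_q y e) else 0)"
    for f e
  \<comment> \<open>\<open>Inl u\<close> stands for the tree path from the dilation component
    \<open>u\<close> to that of \<open>x0\<close>, and \<open>Inr e\<close> for the fundamental
    cycle of the non-tree edge \<open>e\<close>.\<close>
  define J where "J = (Inl ` (R - {x0}) \<union> Inr ` (U - T) :: ('v + 'h) set)"
  define Lam where "Lam f = case_sum (S f) (Lm f)" for f
  \<comment> \<open>The coordinates dual to \<open>Lam\<close>: the boundary at a dilation component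
    and the coefficient of a non-tree edge. \<open>latL\<close> requires the former to be even,
    which explains the 2 in \<open>dt\<close>.\<close>
  define C where "C = case_sum Binc_q (\<lambda>e f. if e = f then 1 else 0 :: int)"
  define dt where "dt = case_sum (\<lambda>u::'v. 2) (\<lambda>e::'h. 1 :: int)"
  define h where "h = card U - card Vu"
  have finJ: "finite J" using finite_R finite_U by (simp add: J_def)
  have "finite T" using T(1) finite_U finite_subset by blast
  have cardX: "card (X - {x0}) = card Vu + (card R - 1)"
    unfolding X' using finite_Vu finite_R disj x0 by (subst card_Un_disjoint) auto
  have leT: "card T \<le> card U" using T(1) finite_U by (rule card_mono[rotated])
  have "card J = (card R - 1) + (card U - card T)"
    unfolding J_def using finite_R finite_U T(1) \<open>finite T\<close> x0
    by (subst card_Un_disjoint) (auto simp: card_image card_Diff_subset)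
  then have cardJ: "card U = card Vu + card J" and le: "card Vu \<le> card U"
    using leT cardX T(2) by auto
  have BLm: "(\<Sum>f\<in>U. Binc_q y f * Lm f e) = 0" if "y \<in> X - {x0}" "e \<in> U" for y e
  proof -
    have "(\<Sum>f\<in>U. Binc_q y f * Lm f e) = (\<Sum>f\<in>U. (if f = e then Binc_q y f else 0)
        - (\<Sum>z\<in>X - {x0}. (Binc_q y f * S f z) * Binc_q z e))"
      by (rule sum.cong) (auto simp: Lm_def right_diff_distrib sum_distrib_left mult.assoc)
    also have "\<dots> = Binc_q y e - (\<Sum>z\<in>X - {x0}. (\<Sum>f\<in>U. Binc_q y f * S f z) * Binc_q z e)"
      unfolding sum_subtractf sum_distrib_right by (subst sum.swap) (simp add: finite_U that)
    also have "\<dots> = Binc_q y e - (\<Sum>z\<in>X - {x0}. (if y = z then Binc_q z e else 0))"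
      by (intro arg_cong2[of _ _ _ _ "(-)"] sum.cong refl) (simp add: BS[OF that(1)])
    finally show ?thesis using that finX by simp
  qed
  have BLam: "(\<Sum>f\<in>U. Binc_q v f * Lam f j) = 0" if "v \<in> Vu" "j \<in> J" for v j
  proof -
    have v: "v \<in> X - {x0}" using that X' by auto
    show ?thesis using that(2) unfolding J_def
    proof (elim UnE imageE DiffE)
      fix u assume "j = Inl u" "u \<in> R" "u \<notin> {x0}"
      then show ?thesis using BS[of v u] v that disj X' by (auto simp: Lam_def)
    next
      fix e assume "j = Inr e" "e \<in> U"
      then show ?thesis using BLm[of v e] v by (simp add: Lam_def)
    qed
  qed
  have CS: "(\<Sum>f\<in>U. C j f * S f v) = 0" if "v \<in> Vu" "j \<in> J" for v j
  proof -
    have v: "v \<in> X - {x0}" using that X' by auto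
    show ?thesis using that(2) unfolding J_def
    proof (elim UnE imageE DiffE)
      fix u assume "j = Inl u" "u \<in> R" "u \<notin> {x0}"
      then show ?thesis using BS[of u v] v that disj X' by (auto simp: C_def)
    next
      fix e assume "j = Inr e" "e \<in> U" "e \<notin> T"
      then show ?thesis using S0[of e v] v finite_U by (simp add: C_def if_distrib[of "\<lambda>t. t * _"] cong: if_cong)
    qed
  qed
  have CL: "(\<Sum>f\<in>U. C i f * Lam f j) = (if i = j then 1 else 0)" if "i \<in> J" "j \<in> J" for i j
  proof -
    have 1: "(\<Sum>f\<in>U. C (Inr e) f * Lam f j) = Lam e j" if "e \<in> U" for e
      using that finite_U by (simp add: C_def if_distrib[of "\<lambda>t. t * _"] cong: if_cong)
    have 2: "Lam e (Inr e') = (if e = e' then 1 else 0)" if "e \<in> U - T" for e e'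
      using that by (simp add: Lam_def Lm_def S0)
    have 3: "Lam e (Inl u) = 0" if "e \<in> U - T" "u \<in> R - {x0}" for e u
      using that X' S0 by (simp add: Lam_def)
    have i: "(\<exists>u\<in>R - {x0}. i = Inl u) \<or> (\<exists>e\<in>U - T. i = Inr e)" using that(1) by (auto simp: J_def)
    have j: "(\<exists>u\<in>R - {x0}. j = Inl u) \<or> (\<exists>e\<in>U - T. j = Inr e)" using that(2) by (auto simp: J_def)
    show ?thesis using i
    proof (elim disjE bexE)
      fix u assume u: "u \<in> R - {x0}" "i = Inl u"
      then have uX: "u \<in> X - {x0}" using X' by auto
      have C: "C (Inl u) = Binc_q u" for u by (simp add: C_def)
      show ?thesis using j
      proof (elim disjE bexE)
        fix u' assume "u' \<in> R - {x0}" "j = Inl u'"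
        then show ?thesis using BS[of u u'] uX u(2) X' by (simp add: C Lam_def)
      next
        fix e assume "e \<in> U - T" "j = Inr e"
        then show ?thesis using BLm[of u e] uX u(2) by (simp add: C Lam_def)
      qed
    next
      fix e assume e: "e \<in> U - T" "i = Inr e"
      then have "(\<Sum>f\<in>U. C i f * Lam f j) = Lam e j" using 1[of e] by simp
      then show ?thesis using j 2[OF e(1)] 3[OF e(1)] e(2) by (auto split: if_splits)
    qed
  qed
  have expand: "a f = (\<Sum>j\<in>J. (\<Sum>x\<in>U. C j x * a x) * Lam f j)" if a: "a \<in> latM" for a f
  proof (cases "f \<in> U")
    case True
    \<comment> \<open>The identity on \<open>U\<close> is \<open>S\<close> times
      \<open>Binc_q\<close> plus \<open>Lm\<close>, and \<open>Lm\<close> vanishes in the columns of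
      tree edges. Applied to \<open>a\<close>, the first summand keeps only the rows of dilation
      components, as the others annihilate \<open>a\<close>.\<close>
    have *: "(\<Sum>y\<in>X - {x0}. S f y * Binc_q y e) + (if e \<in> U - T then Lm f e else 0) = (if f = e then 1 else 0)"
      if "e \<in> U" for e
      using that SB[OF True, of e] True by (auto simp: Lm_def)
    have "a f = (\<Sum>e\<in>U. (if f = e then 1 else 0) * a e)"
      using True finite_U by (simp add: if_distrib[of "\<lambda>t. t * _"] cong: if_cong)
    also have "\<dots> = (\<Sum>e\<in>U. (\<Sum>y\<in>X - {x0}. S f y * (Binc_q y e * a e)) + (if e \<in> U - T then a e * Lm f e else 0))"
      by (rule sum.cong[OF refl], subst *[symmetric]) (auto simp: distrib_right sum_distrib_right mult.assoc mult.commute[of "a _"])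
    also have "\<dots> = (\<Sum>y\<in>X - {x0}. S f y * (\<Sum>e\<in>U. Binc_q y e * a e)) + (\<Sum>e\<in>U - T. a e * Lm f e)"
      unfolding sum.distrib sum_distrib_left using finite_U
      by (subst sum.swap) (simp add: sum.If_cases Int_def, intro arg_cong2[of _ _ _ _ "(+)"] sum.cong, auto)
    also have "(\<Sum>y\<in>X - {x0}. S f y * (\<Sum>e\<in>U. Binc_q y e * a e))
        = (\<Sum>y\<in>R - {x0}. S f y * (\<Sum>e\<in>U. Binc_q y e * a e))"
    proof (rule sum.mono_neutral_right[OF finX])
      show "\<forall>y\<in>X - {x0} - (R - {x0}). S f y * (\<Sum>e\<in>U. Binc_q y e * a e) = 0"
        using a X' by (auto simp: latM_def Binc_q_Vu U_halfedges)
    qed (auto simp: X_def)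
    also have "\<dots> + (\<Sum>e\<in>U - T. a e * Lm f e) = (\<Sum>j\<in>J. (\<Sum>x\<in>U. C j x * a x) * Lam f j)"
    proof -
      have "(\<Sum>x\<in>U. C (Inr e) x * a x) = a e" if "e \<in> U" for e
        using that finite_U by (simp add: C_def if_distrib[of "\<lambda>t. t * _"] cong: if_cong)
      then show ?thesis unfolding J_def using finite_R finite_U
        by (subst sum.union_disjoint) (auto simp: sum.reindex C_def Lam_def mult.commute)
    qed
    finally show ?thesis .
  next
    case False
    then have "f \<notin> T" using T(1) by auto
    then have "Lam f j = 0" if "j \<in> J" for j
      using that S0[of f, unfolded X'] False unfolding J_def
      by (elim UnE imageE) (simp_all add: Lam_def Lm_def)
    then show ?thesis using False a by (simp add: latM_def)
  qed
  have coeff: "c i = 0" if "\<And>u. (\<Sum>j\<in>J. c j * Lam u j) = 0" "i \<in> J" for c i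
  proof -
    have "c i = (\<Sum>j\<in>J. c j * (\<Sum>u\<in>U. C i u * Lam u j))"
      using that(2) finJ by (simp add: CL if_distrib[of "\<lambda>t. _ * t"] cong: if_cong)
    also have "\<dots> = (\<Sum>u\<in>U. C i u * (\<Sum>j\<in>J. c j * Lam u j))"
      unfolding sum_distrib_left by (subst sum.swap) (simp add: mult_ac)
    finally show ?thesis using that(1) by simp
  qed
  have LamM: "(\<lambda>f. Lam f j) \<in> latM" if j: "j \<in> J" for j
  proof -
    have "Lam f j = 0" if "f \<notin> U" for f
    proof -
      have "f \<notin> T" using that T(1) by auto
      then show ?thesis using j that S0[of f, unfolded X'] unfolding J_def
        by (elim UnE imageE) (simp_all add: Lam_def Lm_def)
    qed
    moreover have "(\<Sum>x\<in>U. Binc v x * Lam x j) = 0" if "v \<in> Vu" for v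
      using BLam[OF that j] by (simp add: Binc_q_Vu U_halfedges that)
    ultimately show ?thesis by (simp add: latM_def)
  qed
  have LamL: "(\<lambda>f. dt j * Lam f j) \<in> latL" if j: "j \<in> J" for j
  proof -
    have "even (\<Sum>x\<in>U. Yinc u x * (dt j * Lam x j))" if u: "u \<in> R - {x0}" for u
    proof -
      have "(\<Sum>x\<in>U. Yinc u x * (dt j * Lam x j)) = dt j * (\<Sum>x\<in>U. C (Inl u) x * Lam x j)"
        unfolding sum_distrib_left using u by (intro sum.cong) (auto simp: C_def Binc_q_R U_halfedges)
      also have "\<dots> = dt j * (if Inl u = j then 1 else 0)"
        using CL[of "Inl u" j] u j by (simp add: J_def)
      finally show ?thesis by (auto simp: dt_def)
    qed
    moreover have "(\<Sum>x\<in>U. Binc v x * (dt j * Lam x j)) = dt j * (\<Sum>x\<in>U. Binc v x * Lam x j)" for v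
      by (simp add: sum_distrib_left mult_ac)
    ultimately show ?thesis using LamM[OF j] by (simp add: latL_def latM_def)
  qed
  obtain js where js: "set js = J" "distinct js" using finite_distinct_list[OF finJ] by blast
  have lj: "length js = h" using js distinct_card[of js] cardJ by (simp add: h_def)
  have bM: "lattice_basis latM (length js) (\<lambda>i. (\<lambda>j f. Lam f j) (js ! i))"
  proof (rule lattice_basisI[OF js(2)])
    show "\<exists>c. x = (\<lambda>u. \<Sum>j\<in>set js. c j * Lam u j)" if "x \<in> latM" for x
      unfolding js(1) by (intro exI[of _ "\<lambda>j. \<Sum>f\<in>U. C j f * x f"] ext) (rule expand[OF that])
  qed (use js LamM coeff in auto)
  have bL: "lattice_basis latL (length js) (\<lambda>i. (\<lambda>j f. dt j * Lam f j) (js ! i))"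
  proof (rule lattice_basisI[OF js(2)])
    fix a assume a: "a \<in> latL"
    have ev: "\<exists>d. (\<Sum>x\<in>U. C j x * a x) = d * dt j" if "j \<in> J" for j
    proof (cases j)
      case (Inl u)
      then have u: "u \<in> R - {x0}" using that by (auto simp: J_def)
      then have "(\<Sum>x\<in>U. C j x * a x) = (\<Sum>x\<in>U. Yinc u x * a x)"
        using Inl by (intro sum.cong) (auto simp: C_def Binc_q_R U_halfedges)
      then have "even (\<Sum>x\<in>U. C j x * a x)" using a u by (simp add: latL_def)
      then show ?thesis using Inl by (auto simp: dt_def elim!: evenE)
    qed (simp add: dt_def)
    then obtain d where d: "\<And>j. j \<in> J \<Longrightarrow> (\<Sum>x\<in>U. C j x * a x) = d j * dt j" by metis
    have "a \<in> latM" using a by (simp add: latL_def)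
    have "a f = (\<Sum>j\<in>J. d j * (dt j * Lam f j))" for f
      unfolding expand[OF \<open>a \<in> latM\<close>, of f] by (rule sum.cong) (simp_all add: d)
    then show "\<exists>c. a = (\<lambda>u. \<Sum>j\<in>set js. c j * (dt j * Lam u j))" using js by auto
  next
    fix c j assume c: "\<And>u. (\<Sum>j\<in>set js. c j * (dt j * Lam u j)) = 0" and j: "j \<in> set js"
    then have "c j * dt j = 0" using coeff[of "\<lambda>j. c j * dt j" j] js by (simp add: mult.assoc)
    then show "c j = 0" by (auto simp: dt_def split: sum.splits)
  qed (use js LamL in auto)
  show ?thesis
  proof (rule that[OF bM[unfolded lj h_def] bL[unfolded lj h_def] le])
    fix vs assume vs: "distinct vs" "set vs = Vu"
    obtain us where us: "set us = U" "distinct us" using finite_distinct_list[OF finite_U] by blast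
    have "det (gram U lenU (length js) (\<lambda>i f. dt (js ! i) * Lam f (js ! i)) (\<lambda>i f. Lam f (js ! i)))
        = det (list_mat js js (\<lambda>i j. of_int (dt i) *
            (\<Sum>u\<in>set us. of_int (Lam u i) * lenU u * of_int (Lam u j))))"
      unfolding gram_def list_mat_nth[symmetric, of js js]
      by (rule arg_cong[of _ _ det], rule list_mat_cong) (simp add: us sum_distrib_left mult_ac)
    also have "\<dots> = (\<Prod>j\<in>J. of_int (dt j)) *
        det (list_mat js js (\<lambda>i j. \<Sum>u\<in>set us. of_int (Lam u i) * lenU u * of_int (Lam u j)))"
      by (subst det_list_mat_scale_rows) (simp_all add: js)
    \<comment> \<open>One factor 2 for every dilation component except that of \<open>x0\<close>:
      the index of \<open>latL\<close> in \<open>latM\<close>.\<close>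
    also have "(\<Prod>j\<in>J. of_int (dt j)) = (2 ^ (card R - 1) :: real)"
      unfolding J_def using finite_R finite_U x0
      by (subst prod.union_disjoint) (auto simp: prod.reindex dt_def)
    also have "det (list_mat js js (\<lambda>i j. \<Sum>u\<in>set us. of_int (Lam u i) * lenU u * of_int (Lam u j)))
        = (\<Prod>u\<in>set us. lenU u) * det (list_mat vs vs
          (\<lambda>v w. \<Sum>u\<in>set us. of_int (Binc_q v u) * (1 / lenU u) * of_int (Binc_q w u)))"
    proof (rule gram_det[where C = C and S = S])
      show "length us = length vs + length js"
        using cardJ us vs js distinct_card by metis
      show "lenU u \<noteq> 0" if "u \<in> set us" for u using lenU_pos us that by force
    qed (use us vs js BS BLam CS CL X' in auto)
    also have "list_mat vs vs (\<lambda>v w. \<Sum>u\<in>set us. of_int (Binc_q v u) * (1 / lenU u) * of_int (Binc_q w u))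
        = list_mat vs vs (\<lambda>v w. \<Sum>x\<in>U. of_int (Binc v x) * (1 / lenU x) * of_int (Binc w x))"
      by (rule list_mat_cong) (auto simp: us vs Binc_q_Vu U_halfedges intro!: sum.cong)
    finally show "det (gram U lenU (card U - card Vu) (\<lambda>i f. dt (js ! i) * Lam f (js ! i)) (\<lambda>i f. Lam f (js ! i)))
      = 2 ^ (card R - 1) * (\<Prod>x\<in>U. lenU x) * det (list_mat vs vs
          (\<lambda>v w. \<Sum>x\<in>U. of_int (Binc v x) * (1 / lenU x) * of_int (Binc w x)))"
      by (simp add: us lj h_def mult.assoc)
  qed
qed

end

section \<open>Minors of the incidence matrix\<close>

lemma det_list_mat_right_kernel:
  fixes f :: "'a \<Rightarrow> 'b \<Rightarrow> 'c::idom"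
  assumes "distinct ys" "length ys = length xs" "\<And>x. x \<in> set xs \<Longrightarrow> (\<Sum>y\<in>set ys. f x y * c y) = 0"
    and "y \<in> set ys" "c y \<noteq> 0"
  shows "det (list_mat xs ys f) = 0"
proof -
  define v where "v = vec (length xs) (\<lambda>i. c (ys ! i))"
  have "list_mat xs ys f *\<^sub>v v = 0\<^sub>v (length xs)"
  proof (rule eq_vecI)
    fix i assume "i < dim_vec (0\<^sub>v (length xs))"
    then have i: "i < length xs" by simp
    have "(list_mat xs ys f *\<^sub>v v) $ i = (\<Sum>j<length xs. f (xs ! i) (ys ! j) * c (ys ! j))"
      using i assms(2) by (simp add: v_def scalar_prod_def lessThan_atLeast0)
    also have "\<dots> = (\<Sum>y\<in>set ys. f (xs ! i) y * c y)"
      using sum.reindex_bij_betw[OF bij_betw_nth[OF assms(1) refl refl], of "\<lambda>y. f (xs ! i) y * c y"]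
      by (simp add: assms(2))
    finally show "(list_mat xs ys f *\<^sub>v v) $ i = 0\<^sub>v (length xs) $ i" using assms(3) i by simp
  qed simp
  moreover have "v \<noteq> 0\<^sub>v (length xs)"
  proof
    assume "v = 0\<^sub>v (length xs)"
    moreover obtain i where "i < length xs" "ys ! i = y" using assms(2,4) by (metis in_set_conv_nth)
    ultimately have "c y = 0" by (metis index_vec index_zero_vec(1) v_def)
    then show False using assms(5) by simp
  qed
  moreover have "v \<in> carrier_vec (length xs)" by (simp add: v_def)
  ultimately have "\<exists>v. v \<in> carrier_vec (length xs) \<and> v \<noteq> 0\<^sub>v (length xs) \<and>
      list_mat xs ys f *\<^sub>v v = 0\<^sub>v (length xs)" by blast
  moreover have "list_mat xs ys f \<in> carrier_mat (length xs) (length xs)"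
    using list_mat_carrier[of xs ys f] assms(2) by simp
  ultimately show ?thesis by (simp only: det_0_iff_vec_prod_zero)
qed

lemma det_list_mat_left_kernel:
  fixes f :: "'a \<Rightarrow> 'b \<Rightarrow> 'c::idom"
  assumes "distinct xs" "length ys = length xs" "\<And>y. y \<in> set ys \<Longrightarrow> (\<Sum>x\<in>set xs. c x * f x y) = 0"
    and "x \<in> set xs" "c x \<noteq> 0"
  shows "det (list_mat xs ys f) = 0"
proof -
  have "det (list_mat ys xs (\<lambda>y x. f x y)) = 0"
    by (rule det_list_mat_right_kernel[where c = c and y = x]) (use assms in \<open>auto simp: mult.commute\<close>)
  then show ?thesis using det_list_mat_transpose[of xs ys f] assms(2) by simp
qed

text \<open>\<open>T\<close> is the column set of a minor, so the edges of \<open>U - T\<close> form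
  the candidate ogod. \<open>H\<close> will consist of the half-edges that survive their removal,
  and \<open>base_adj\<close> and \<open>top_adj\<close> describe adjacency in the remaining graph
  and in its preimage.\<close>

locale edge_subset = oriented_cover Gt G p At A
  for Gt :: "('w, 'k) mgraph" and G :: "('v, 'h) mgraph" and p :: "('w, 'k, 'v, 'h) cover"
    and At :: "'k set" and A :: "'h set" +
  fixes T :: "'h set"
  assumes T_U: "T \<subseteq> U"
begin

definition H :: "'h set" where
  "H = {x \<in> halfedges G. dilated_edge Gt p (edge_of G x) \<or> x \<in> T \<or> flip G x \<in> T}"

definition base_adj :: "('v \<times> 'v) set" where
  "base_adj = {(rootv G x, rootv G (flip G x)) | x. x \<in> H}"

definition top_adj :: "('w \<times> 'w) set" where
  "top_adj = {(rootv Gt k, rootv Gt (flip Gt k)) | k. k \<in> halfedges Gt \<and> hmap p k \<in> H}"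

lemma H_halfedges: "x \<in> H \<Longrightarrow> x \<in> halfedges G"
  by (simp add: H_def)

lemma flip_H: "x \<in> H \<Longrightarrow> flip G x \<in> H"
  using base.flip_closed base.flip_flip base.edge_of_flip by (auto simp: H_def)

lemma T_H: "x \<in> T \<Longrightarrow> x \<in> H"
  using T_U U_halfedges by (auto simp: H_def)

lemma base_adjI: "x \<in> H \<Longrightarrow> (rootv G x, rootv G (flip G x)) \<in> base_adj"
  by (auto simp: base_adj_def)

lemma top_adjI: "k \<in> halfedges Gt \<Longrightarrow> hmap p k \<in> H \<Longrightarrow> (rootv Gt k, rootv Gt (flip Gt k)) \<in> top_adj"
  by (auto simp: top_adj_def)

lemma top_adjE:
  assumes "(w, w') \<in> top_adj"
  obtains k where "k \<in> halfedges Gt" "hmap p k \<in> H" "w = rootv Gt k" "w' = rootv Gt (flip Gt k)"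
  using assms by (auto simp: top_adj_def)

lemma sym_base_adj: "sym base_adj"
proof (rule symI)
  fix u v assume "(u, v) \<in> base_adj"
  then obtain x where "x \<in> H" "u = rootv G x" "v = rootv G (flip G x)" by (auto simp: base_adj_def)
  then show "(v, u) \<in> base_adj" using base_adjI[OF flip_H, of x] base.flip_flip[OF H_halfedges, of x] by simp
qed

lemma sym_top_adj: "sym top_adj"
proof (rule symI)
  fix w w' assume "(w, w') \<in> top_adj"
  then obtain k where "k \<in> halfedges Gt" "hmap p k \<in> H" "w = rootv Gt k" "w' = rootv Gt (flip Gt k)"
    by (rule top_adjE)
  then show "(w', w) \<in> top_adj"
    using top_adjI[of "flip Gt k"] top.flip_flip[of k] top.flip_closed[of k] map_flip[of k] flip_H by simp
qed

lemma top_adj_sym: "(w, w') \<in> top_adj\<^sup>* \<Longrightarrow> (w', w) \<in> top_adj\<^sup>*"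
  using sym_rtrancl[OF sym_top_adj] by (rule symD)

lemma base_adj_sym: "(w, w') \<in> base_adj\<^sup>* \<Longrightarrow> (w', w) \<in> base_adj\<^sup>*"
  using sym_rtrancl[OF sym_base_adj] by (rule symD)

lemma top_adj_vertices: "(w, w') \<in> top_adj \<Longrightarrow> w \<in> vertices Gt \<and> w' \<in> vertices Gt"
  by (elim top_adjE) (simp add: top.rootv_closed top.flip_closed)

lemma top_adj_star_vertices: "(w, w') \<in> top_adj\<^sup>* \<Longrightarrow> w \<in> vertices Gt \<Longrightarrow> w' \<in> vertices Gt"
  by (induction rule: rtrancl_induct) (auto dest: top_adj_vertices)

lemma base_adj_star_vertices: "(u, v) \<in> base_adj\<^sup>* \<Longrightarrow> u \<in> vertices G \<Longrightarrow> v \<in> vertices G"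
  by (induction rule: rtrancl_induct) (auto simp: base_adj_def base.rootv_closed base.flip_closed H_halfedges)

lemma top_adj_base_adj: "(w, w') \<in> top_adj \<Longrightarrow> (vmap p w, vmap p w') \<in> base_adj"
  by (elim top_adjE) (simp add: map_rootv map_flip top.flip_closed base_adjI)

lemma top_adj_base_adj_star: "(w, w') \<in> top_adj\<^sup>* \<Longrightarrow> (vmap p w, vmap p w') \<in> base_adj\<^sup>*"
  by (induction rule: rtrancl_induct) (auto dest: top_adj_base_adj intro: rtrancl_into_rtrancl)

text \<open>Path lifting from a prescribed starting point: if the chosen lift of the half-edge is
  rooted at the other point of the fibre, its conjugate is rooted at the right one.\<close>

lemma base_adj_lift:
  assumes "(u, v) \<in> base_adj" "w \<in> vertices Gt" "vmap p w = u"
  obtains w' where "(w, w') \<in> top_adj" "vmap p w' = v"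
proof -
  obtain x where x: "x \<in> H" "u = rootv G x" "v = rootv G (flip G x)" using assms(1) by (auto simp: base_adj_def)
  note h = H_halfedges[OF x(1)] and l = lifth[OF H_halfedges[OF x(1)]]
  have "\<exists>k. k \<in> halfedges Gt \<and> hmap p k = x \<and> rootv Gt k = w"
    using over_same_vertex[OF assms(2) lifth_root(1)[OF h]] lifth_root(3)[OF h] assms(3) x(2) l
      rootv_conjh[OF l(1)] hfib_props[OF l(1)] vfib_props(4)[OF assms(2)] by metis
  then obtain k where k: "k \<in> halfedges Gt" "hmap p k = x" "rootv Gt k = w" by blast
  show ?thesis
    by (rule that[of "rootv Gt (flip Gt k)"])
      (use k top_adjI[of k] x map_rootv[OF top.flip_closed[OF k(1)]] map_flip[OF k(1)] in auto)
qed

lemma base_adj_star_lift: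
  assumes "(u, v) \<in> base_adj\<^sup>*" "w \<in> vertices Gt" "vmap p w = u"
  shows "\<exists>w'. (w, w') \<in> top_adj\<^sup>* \<and> vmap p w' = v"
  using assms(1)
proof (induction rule: rtrancl_induct)
  case base then show ?case using assms by blast
next
  case (step y z)
  then obtain w' where w': "(w, w') \<in> top_adj\<^sup>*" "vmap p w' = y" by blast
  then show ?case using base_adj_lift[OF step(2) top_adj_star_vertices[OF w'(1) assms(2)] w'(2)]
    by (metis rtrancl_into_rtrancl)
qed

lemma top_adj_conjv: "(w, w') \<in> top_adj \<Longrightarrow> (conjv w, conjv w') \<in> top_adj"
proof (elim top_adjE)
  fix k assume k: "k \<in> halfedges Gt" "hmap p k \<in> H" "w = rootv Gt k" "w' = rootv Gt (flip Gt k)"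
  have "(rootv Gt (conjh k), rootv Gt (flip Gt (conjh k))) \<in> top_adj"
    by (rule top_adjI) (use k hfib_props in auto)
  then show "(conjv w, conjv w') \<in> top_adj"
    using k(1) by (simp add: k(3,4) flip_conjh rootv_conjh top.flip_closed)
qed

text \<open>As \<open>v\<close> varies, this is the vector of the sheet sign of \<open>w\<close>.
  The column of \<open>Binc\<close> at an edge is the difference of these vectors at the two ends of
  its chosen lift.\<close>

definition sig :: "'v \<Rightarrow> 'w \<Rightarrow> int" where
  "sig v w = (if vmap p w = v then sg w else 0)"

lemma sig_conjv: "w \<in> vertices Gt \<Longrightarrow> sig v (conjv w) = - sig v w"
  by (simp add: sig_def sg_conjv vfib_props)

lemma Binc_sig: "x \<in> halfedges G \<Longrightarrow> Binc v x = sig v (rootv Gt (flip Gt (lifth x))) - sig v (rootv Gt (lifth x))"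
  by (simp add: Binc_def sig_def lifth_root)

text \<open>A step over an edge of \<open>T\<close> is plus or minus one column of
  \<open>Binc\<close>, the sign depending on the sheet and the direction; a step over a dilated edge
  contributes nothing. \<open>Yinc\<close> carries no sheet signs, so it can follow the step only
  modulo 2, which suffices for telling dilation components apart.\<close>

lemma top_adj_step_sig:
  assumes k: "k \<in> halfedges Gt" "hmap p k \<in> H"
  obtains a where "\<And>x. x \<notin> T \<Longrightarrow> a x = (0::int)"
    "\<And>v. v \<in> Vu \<Longrightarrow> (\<Sum>x\<in>U. Binc v x * a x) = sig v (rootv Gt (flip Gt k)) - sig v (rootv Gt k)"
    "\<And>u. even ((\<Sum>x\<in>U. Yinc u x * a x) -
      ((if q (vmap p (rootv Gt (flip Gt k))) = u then 1 else 0) - (if q (vmap p (rootv Gt k)) = u then 1 else 0)))"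
proof -
  let ?x = "hmap p k"
  have x: "?x \<in> halfedges G" using k hmap_closed by simp
  have r: "vmap p (rootv Gt k) = rootv G ?x" "vmap p (rootv Gt (flip Gt k)) = rootv G (flip G ?x)"
    using k map_rootv map_flip top.flip_closed by auto
  show ?thesis
  proof (cases "dilated_edge Gt p (edge_of G ?x)")
    case True
    have "rootv G ?x \<in> Vd" "rootv G (flip G ?x) \<in> Vd"
      using dil_adj_Vd[OF dil_adjI[OF x True]] by auto
    then have s: "sig v (rootv Gt k) = 0 \<and> sig v (rootv Gt (flip Gt k)) = 0" if "v \<in> Vu" for v
      using r that vertices_split(2) by (auto simp: sig_def)
    show ?thesis
      by (rule that[of "\<lambda>x. 0"]) (use s r q_dilated[OF x True] in simp_all)
  next
    case False
    define single where "single y \<epsilon> x = (if x = y then \<epsilon> else 0 :: int)" for y x :: 'h and \<epsilon>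
    have single: "single y \<epsilon> x = 0" if "y \<in> T" "x \<notin> T" for x y \<epsilon> using that by (auto simp: single_def)
    have S: "(\<Sum>x\<in>U. f x * single y \<epsilon> x) = f y * \<epsilon>" if "y \<in> T" for f :: "'h \<Rightarrow> int" and y \<epsilon>
      using that T_U finite_U by (auto simp: single_def if_distrib[of "\<lambda>t. _ * t"] cong: if_cong)
    have *: "\<exists>\<epsilon>. \<epsilon> * \<epsilon> = 1 \<and> (\<forall>v\<in>Vu. Binc v y * \<epsilon> = sig v (rootv Gt (flip Gt l)) - sig v (rootv Gt l))"
      if y: "y \<in> T" and l: "l \<in> halfedges Gt" "hmap p l = y" for y l
    proof -
      have h: "y \<in> halfedges G" using T_H[OF y] H_halfedges by auto
      have "l = lifth y \<or> l = conjh (lifth y)" using over_same_halfedge[OF lifth(1)[OF h] l(1)] lifth(2)[OF h] l(2) by simp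
      then show ?thesis
      proof
        assume "l = lifth y"
        then show ?thesis by (intro exI[of _ 1]) (simp add: Binc_sig[OF h])
      next
        assume "l = conjh (lifth y)"
        then show ?thesis
          by (intro exI[of _ "-1"])
            (simp add: Binc_sig[OF h] flip_conjh lifth h rootv_conjh top.flip_closed sig_conjv lifth_root)
      qed
    qed
    have odd_sq: "odd \<epsilon>" if "\<epsilon> * \<epsilon> = 1" for \<epsilon> :: int using that by (metis even_mult_iff odd_one)
    consider "?x \<in> T" | "flip G ?x \<in> T" using k(2) False by (auto simp: H_def)
    then show ?thesis
    proof cases
      case 1
      obtain \<epsilon> where \<epsilon>: "\<epsilon> * \<epsilon> = 1" "\<forall>v\<in>Vu. Binc v ?x * \<epsilon> = sig v (rootv Gt (flip Gt k)) - sig v (rootv Gt k)"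
        using *[OF 1 k(1) refl] by blast
      show ?thesis
        by (rule that[of "single ?x \<epsilon>"])
          (use 1 \<epsilon>(2) odd_sq[OF \<epsilon>(1)] in \<open>auto simp: S single r Yinc_def\<close>)
    next
      case 2
      obtain \<epsilon> where \<epsilon>: "\<epsilon> * \<epsilon> = 1"
        "\<forall>v\<in>Vu. Binc v (flip G ?x) * \<epsilon> = sig v (rootv Gt k) - sig v (rootv Gt (flip Gt k))"
        using *[OF 2 top.flip_closed[OF k(1)]] map_flip[OF k(1)] top.flip_flip[OF k(1)] by auto
      show ?thesis
        by (rule that[of "single (flip G ?x) (- \<epsilon>)"])
          (use 2 \<epsilon>(2) odd_sq[OF \<epsilon>(1)] base.flip_flip[OF x] in \<open>auto simp: S single r Yinc_def\<close>)
    qed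
  qed
qed

text \<open>Added up along a path upstairs, the steps give an integer combination of the columns in
  \<open>T\<close> whose boundary is the difference of the ends. Preimages of vectors under the
  minor and vectors in its kernel are all obtained from such paths.\<close>

lemma top_adj_path_sig:
  assumes "(w, w') \<in> top_adj\<^sup>*"
  shows "\<exists>a. (\<forall>x. x \<notin> T \<longrightarrow> a x = (0::int)) \<and>
    (\<forall>v\<in>Vu. (\<Sum>x\<in>U. Binc v x * a x) = sig v w' - sig v w) \<and>
    (\<forall>u. even ((\<Sum>x\<in>U. Yinc u x * a x) -
      ((if q (vmap p w') = u then 1 else 0) - (if q (vmap p w) = u then 1 else 0))))"
  using assms
proof (induction rule: rtrancl_induct)
  case base
  show ?case by (rule exI[of _ "\<lambda>x. 0"]) simp
next
  case (step y z)
  from step(3) obtain a where a: "\<forall>x. x \<notin> T \<longrightarrow> a x = 0"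
    "\<forall>v\<in>Vu. (\<Sum>x\<in>U. Binc v x * a x) = sig v y - sig v w"
    "\<forall>u. even ((\<Sum>x\<in>U. Yinc u x * a x) -
      ((if q (vmap p y) = u then 1 else 0) - (if q (vmap p w) = u then 1 else 0)))" by blast
  from step(2) obtain k where k: "k \<in> halfedges Gt" "hmap p k \<in> H" "y = rootv Gt k" "z = rootv Gt (flip Gt k)"
    by (rule top_adjE)
  obtain b where b: "\<And>x. x \<notin> T \<Longrightarrow> b x = 0"
    "\<And>v. v \<in> Vu \<Longrightarrow> (\<Sum>x\<in>U. Binc v x * b x) = sig v z - sig v y"
    "\<And>u. even ((\<Sum>x\<in>U. Yinc u x * b x) -
      ((if q (vmap p z) = u then 1 else 0) - (if q (vmap p y) = u then 1 else 0)))"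
    using top_adj_step_sig[OF k(1,2)] unfolding k(3,4) by blast
  have e: "even ((s + t) - (z' - w'))" if "even (s - (y' - w'))" "even (t - (z' - y'))" for s t w' y' z' :: int
    using that by presburger
  show ?case
    by (rule exI[of _ "\<lambda>x. a x + b x"])
      (use a(1,2) b(1,2) e[OF spec[OF a(3)] b(3)] in \<open>auto simp: distrib_left sum.distrib\<close>)
qed

text \<open>The connectedness condition of an ogod, in the form in which it acts on the minor: the
  two points of every fibre are joined in the remaining graph upstairs.\<close>

definition inv_connected :: bool where
  "inv_connected \<longleftrightarrow> (\<forall>w\<in>vertices Gt. (w, conjv w) \<in> top_adj\<^sup>*)"

lemma sum_sig:
  assumes "w \<in> vertices Gt"
  shows "(\<Sum>v\<in>Vu. f v * sig v w) = f (vmap p w) * sg w"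
proof (cases "vmap p w \<in> Vu")
  case True
  then show ?thesis using finite_Vu by (simp add: sig_def if_distrib[of "\<lambda>t. _ * t"] cong: if_cong)
next
  case False
  then have "sg w = 0" using vmap_closed[OF assms] dilated_vertex_iff[OF assms] by (auto simp: Vu_def sg_def)
  then show ?thesis by (auto intro!: sum.neutral simp: sig_def)
qed

text \<open>If the preimage of a component is disconnected, choosing a sheet gives a vector in the left
  kernel.\<close>

lemma det_zero_if_not_connected:
  assumes nc: "\<not> inv_connected" and vs: "distinct vs" "set vs = Vu"
    and ts: "set ts = T" "length ts = length vs"
  shows "det (list_mat vs ts Binc) = 0"
proof -
  obtain w1 where w1: "w1 \<in> vertices Gt" "(w1, conjv w1) \<notin> top_adj\<^sup>*" using nc by (auto simp: inv_connected_def)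
  \<comment> \<open>1 on the component of \<open>w1\<close>, -1 on the conjugate component and 0
    elsewhere. The two components are distinct because \<open>w1\<close> and its conjugate are not
    joined.\<close>
  define \<eta> where "\<eta> w = (if (w1, w) \<in> top_adj\<^sup>* then 1 else 0 :: int) - (if (w1, conjv w) \<in> top_adj\<^sup>* then 1 else 0)" for w
  have \<eta>_sg: "\<eta> (liftv (vmap p w)) * sg w = \<eta> w" if w: "w \<in> vertices Gt" for w
  proof (cases "conjv w = w")
    case False
    have l: "liftv (vmap p w) \<in> vertices Gt" "vmap p (liftv (vmap p w)) = vmap p w"
      using liftv vmap_closed[OF w] by auto
    consider "liftv (vmap p w) = w" | "liftv (vmap p w) = conjv w" "w \<noteq> liftv (vmap p w)"
      using over_same_vertex[OF w l] False by metis
    then show ?thesis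
    proof cases
      case 2
      then show ?thesis using vfib_props(4)[OF w] False by (simp add: sg_def \<eta>_def)
    qed (use False in \<open>simp add: sg_def\<close>)
  qed (simp add: sg_def \<eta>_def)
  have \<eta>_ct: "\<eta> w' = \<eta> w" if "(w, w') \<in> top_adj" for w w'
  proof -
    have "(w1, w) \<in> top_adj\<^sup>* \<longleftrightarrow> (w1, w') \<in> top_adj\<^sup>*"
      using that symD[OF sym_top_adj that] by (meson rtrancl_into_rtrancl)
    moreover have "(w1, conjv w) \<in> top_adj\<^sup>* \<longleftrightarrow> (w1, conjv w') \<in> top_adj\<^sup>*"
      using top_adj_conjv[OF that] symD[OF sym_top_adj top_adj_conjv[OF that]] by (meson rtrancl_into_rtrancl)
    ultimately show ?thesis by (simp add: \<eta>_def)
  qed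
  show ?thesis
  proof (rule det_list_mat_left_kernel[OF vs(1) ts(2), where c = "\<lambda>v. \<eta> (liftv v)" and x = "vmap p w1"])
    fix x assume "x \<in> set ts"
    then have x: "x \<in> T" and xH: "x \<in> H" and h: "x \<in> halfedges G" using ts T_H H_halfedges by auto
    have "(rootv Gt (lifth x), rootv Gt (flip Gt (lifth x))) \<in> top_adj"
      using top_adjI[OF lifth(1)[OF h]] lifth(2)[OF h] xH by simp
    then show "(\<Sum>v\<in>set vs. \<eta> (liftv v) * Binc v x) = 0"
      using sum_sig[OF lifth_root(1)[OF h], of "\<lambda>v. \<eta> (liftv v)"] sum_sig[OF lifth_root(2)[OF h], of "\<lambda>v. \<eta> (liftv v)"]
        \<eta>_sg[OF lifth_root(1)[OF h]] \<eta>_sg[OF lifth_root(2)[OF h]] \<eta>_ct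
      by (simp add: vs(2) Binc_sig[OF h] right_diff_distrib sum_subtractf)
  next
    have ne: "conjv w1 \<noteq> w1" using w1(2) by auto
    then show "vmap p w1 \<in> set vs"
      using dilated_vertex_iff[OF w1(1)] vmap_closed[OF w1(1)] by (simp add: vs(2) Vu_def)
    have "\<eta> w1 = 1" using w1(2) by (simp add: \<eta>_def)
    then show "\<eta> (liftv (vmap p w1)) \<noteq> 0" using \<eta>_sg[OF w1(1)] by auto
  qed
qed

section \<open>Components of the remaining graph and the value of the minor\<close>

definition rho :: "'v \<Rightarrow> 'v" where
  "rho v = (SOME u. (v, u) \<in> base_adj\<^sup>*)"

lemma rho_star: "(v, rho v) \<in> base_adj\<^sup>*"
  unfolding rho_def by (rule someI[of _ v]) simp

lemma rho_eq: "(u, v) \<in> base_adj\<^sup>* \<Longrightarrow> rho u = rho v"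
  unfolding rho_def
  by (rule arg_cong[of _ _ Eps], rule ext) (blast dest: base_adj_sym intro: rtrancl_trans)

lemma rho_eq_iff: "rho u = rho v \<longleftrightarrow> (u, v) \<in> base_adj\<^sup>*"
  using rho_eq rho_star base_adj_sym by (metis rtrancl_trans)

lemma rho_idem: "rho (rho v) = rho v"
  using rho_eq[OF rho_star[of v]] by simp

text \<open>The vertices whose component in the remaining graph contains no dilated vertex. These
  components are the source of the factors 2 in the minor.\<close>

definition Vn :: "'v set" where
  "Vn = {v \<in> Vu. \<forall>u\<in>Vd. (v, u) \<notin> base_adj\<^sup>*}"

lemma Vn_star: "v \<in> Vn \<Longrightarrow> (v, u) \<in> base_adj\<^sup>* \<Longrightarrow> u \<in> Vn"
proof -
  assume v: "v \<in> Vn" and vu: "(v, u) \<in> base_adj\<^sup>*"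
  have "u \<in> vertices G" using base_adj_star_vertices[OF vu] v by (simp add: Vn_def Vu_def)
  moreover have "u \<notin> Vd" using v vu by (auto simp: Vn_def)
  moreover have "(u, u') \<notin> base_adj\<^sup>*" if "u' \<in> Vd" for u'
    using v vu that by (auto simp: Vn_def dest: rtrancl_trans)
  ultimately show "u \<in> Vn" using vertices_split by (auto simp: Vn_def)
qed

lemma rho_Vn: "v \<in> Vn \<Longrightarrow> rho v \<in> Vn"
  using Vn_star rho_star by blast

lemma Vn_Vu: "Vn \<subseteq> Vu"
  by (auto simp: Vn_def)

lemma sig_liftv: "v \<in> Vu \<Longrightarrow> sig z (liftv v) = (if z = v then 1 else 0)"
  using liftv[of v] sg_liftv[of v] by (auto simp: sig_def Vu_def)

text \<open>Writing \<open>B\<close> for the minor, there are integer matrices with \<open>B X = N D\<close> and \<open>Q B = D Y\<close>, where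
  \<open>N\<close> and \<open>Q\<close> are unimodular and \<open>D\<close> is diagonal with an entry \<open>2\<close> for every component without dilated
  vertex and \<open>1\<close> otherwise; hence \<open>det B\<close> and \<open>det D\<close> divide each other.\<close>

lemma abs_det_if_connected:
  assumes conn: inv_connected and vs: "distinct vs" "set vs = Vu"
    and ts: "distinct ts" "set ts = T" "length ts = length vs"
  shows "\<bar>det (list_mat vs ts Binc)\<bar> = 2 ^ card (rho ` Vn)"
proof -
  \<comment> \<open>\<open>E\<close> sends a vertex of \<open>Vn\<close> that is not a
    representative to the representative of its component. Representatives are sent to 0, so
    \<open>E\<close> squares to 0 and \<open>N\<close> and \<open>Q\<close> are inverse to each
    other.\<close>
  define E where "E u v = (if v \<in> Vn \<and> rho v \<noteq> v \<and> u = rho v then 1 else 0 :: int)" for u v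
  define N where "N u v = (if u = v then 1 else 0) - E u v" for u v
  define Q where "Q u v = (if u = v then 1 else 0) + E u v" for u v
  define dt where "dt v = (if v \<in> Vn \<and> rho v = v then 2 else 1 :: int)" for v
  define detB where "detB = det (list_mat vs ts Binc)"
  have fV: "finite Vu" by (rule finite_Vu)
  have E2: "E u z * E z v = 0" for u z v using rho_idem by (auto simp: E_def)
  have EE: "(\<Sum>z\<in>Vu. E u z * E z v) = 0" for u v by (rule sum.neutral) (use E2 in blast)
  have NQ: "(\<Sum>z\<in>Vu. N u z * Q z v) = (if u = v then 1 else 0)" if "u \<in> Vu" "v \<in> Vu" for u v
  proof -
    have "(\<Sum>z\<in>Vu. N u z * Q z v) = (\<Sum>z\<in>Vu. (if u = z then Q z v else 0) - ((if z = v then E u z else 0) + E u z * E z v))"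
      by (rule sum.cong) (auto simp: N_def Q_def algebra_simps)
    also have "\<dots> = Q u v - (E u v + (\<Sum>z\<in>Vu. E u z * E z v))"
      using that fV by (simp add: sum_subtractf sum.distrib)
    finally show ?thesis by (simp add: EE Q_def)
  qed
  have "det (list_mat vs vs N) * det (list_mat vs vs Q) = det (list_mat vs vs (\<lambda>x z. \<Sum>y\<in>set vs. N x y * Q y z))"
    by (rule det_list_mat_mult[symmetric]) (use vs in auto)
  also have "list_mat vs vs (\<lambda>x z. \<Sum>y\<in>set vs. N x y * Q y z) = list_mat vs vs (\<lambda>x z. if x = z then 1 else 0)"
    by (rule list_mat_cong) (simp add: vs NQ)
  finally have "det (list_mat vs vs N) * det (list_mat vs vs Q) = 1" by (simp add: det_list_mat_one vs)
  then have absNQ: "\<bar>det (list_mat vs vs N)\<bar> = 1" "\<bar>det (list_mat vs vs Q)\<bar> = 1"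
    by (auto simp: zmult_eq_1_iff)
  have prod_dt: "(\<Prod>v\<in>set vs. dt v) = 2 ^ card (rho ` Vn)"
  proof -
    have "{v \<in> Vu. v \<in> Vn \<and> rho v = v} = rho ` Vn"
      using rho_Vn rho_idem Vn_Vu by (auto simp: image_iff) (metis)
    moreover have "(\<Prod>v\<in>Vu. dt v) = 2 ^ card {v \<in> Vu. v \<in> Vn \<and> rho v = v}"
      unfolding dt_def using fV by (simp add: prod.If_cases Int_def)
    ultimately show ?thesis by (simp add: vs)
  qed
  have "\<exists>a. (\<forall>x. x \<notin> T \<longrightarrow> a x = 0) \<and> (\<forall>u\<in>Vu. (\<Sum>x\<in>U. Binc u x * a x) = N u v * dt v)" if v: "v \<in> Vu" for v
  proof -
    have l: "liftv v \<in> vertices Gt" "vmap p (liftv v) = v" using v liftv by (auto simp: Vu_def)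
    \<comment> \<open>A path to a dilated vertex, where all sheet signs vanish, yields a unit
      vector. A path from the representative to its conjugate yields twice a unit vector. A path to
      another vertex from the representative of its component yields a difference of unit
      vectors.\<close>
    consider (dil) "v \<notin> Vn" | (root) "v \<in> Vn" "rho v = v" | (other) "v \<in> Vn" "rho v \<noteq> v" by blast
    then show ?thesis
    proof cases
      case dil
      then obtain d where d: "d \<in> Vd" "(v, d) \<in> base_adj\<^sup>*" using v by (auto simp: Vn_def)
      then obtain w' where w': "(liftv v, w') \<in> top_adj\<^sup>*" "vmap p w' = d" using base_adj_star_lift l by blast
      obtain a where a: "\<forall>x. x \<notin> T \<longrightarrow> a x = 0"
        "\<forall>u\<in>Vu. (\<Sum>x\<in>U. Binc u x * a x) = sig u w' - sig u (liftv v)" using top_adj_path_sig[OF w'(1)] by blast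
      have "sig u w' = 0" if "u \<in> Vu" for u using that w' d vertices_split by (auto simp: sig_def)
      then show ?thesis using dil a sig_liftv[OF v]
        by (intro exI[of _ "\<lambda>x. - a x"]) (auto simp: N_def E_def dt_def sum_negf)
    next
      case root
      obtain a where a: "\<forall>x. x \<notin> T \<longrightarrow> a x = 0"
        "\<forall>u\<in>Vu. (\<Sum>x\<in>U. Binc u x * a x) = sig u (conjv (liftv v)) - sig u (liftv v)"
        using top_adj_path_sig[of "liftv v" "conjv (liftv v)"] conn l unfolding inv_connected_def by blast
      then show ?thesis using root sig_liftv[OF v]
        by (intro exI[of _ "\<lambda>x. - a x"]) (auto simp: N_def E_def dt_def sum_negf sig_conjv l)
    next
      case other
      have u: "rho v \<in> Vu" using rho_Vn[OF other(1)] Vn_Vu by blast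
      then have lu: "liftv (rho v) \<in> vertices Gt" "vmap p (liftv (rho v)) = rho v" using liftv by (auto simp: Vu_def)
      obtain w' where w': "(liftv (rho v), w') \<in> top_adj\<^sup>*" "vmap p w' = v"
        using base_adj_star_lift[OF base_adj_sym[OF rho_star] lu] by blast
      have "w' = liftv v \<or> w' = conjv (liftv v)"
        using over_same_vertex[OF l(1) top_adj_star_vertices[OF w'(1) lu(1)]] w'(2) l(2) by simp
      moreover have "(conjv (liftv v), liftv v) \<in> top_adj\<^sup>*"
        using conn l(1) top_adj_sym by (auto simp: inv_connected_def)
      ultimately have path: "(liftv (rho v), liftv v) \<in> top_adj\<^sup>*" using w'(1) by (auto intro: rtrancl_trans)
      obtain a where a: "\<forall>x. x \<notin> T \<longrightarrow> a x = 0"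
        "\<forall>u\<in>Vu. (\<Sum>x\<in>U. Binc u x * a x) = sig u (liftv v) - sig u (liftv (rho v))"
        using top_adj_path_sig[OF path] by blast
      then show ?thesis using other sig_liftv[OF v] sig_liftv[OF u]
        by (intro exI[of _ a]) (auto simp: N_def E_def dt_def)
    qed
  qed
  then obtain X where X: "\<And>v x. v \<in> Vu \<Longrightarrow> x \<notin> T \<Longrightarrow> X v x = 0"
    "\<And>u v. v \<in> Vu \<Longrightarrow> u \<in> Vu \<Longrightarrow> (\<Sum>x\<in>U. Binc u x * X v x) = N u v * dt v" by metis
  have XT: "(\<Sum>x\<in>T. Binc u x * X v x) = N u v * dt v" if "u \<in> Vu" "v \<in> Vu" for u v
  proof -
    have "(\<Sum>x\<in>U. Binc u x * X v x) = (\<Sum>x\<in>T. Binc u x * X v x)"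
      by (rule sum.mono_neutral_right[OF finite_U T_U]) (use X(1) that in auto)
    then show ?thesis using X(2) that by simp
  qed
  have 1: "detB * det (list_mat ts vs (\<lambda>x v. X v x)) = det (list_mat vs vs N) * 2 ^ card (rho ` Vn)"
  proof -
    have "detB * det (list_mat ts vs (\<lambda>x v. X v x)) = det (list_mat vs vs (\<lambda>u v. \<Sum>x\<in>set ts. Binc u x * X v x))"
      unfolding detB_def by (rule det_list_mat_mult[symmetric]) (use ts in auto)
    also have "list_mat vs vs (\<lambda>u v. \<Sum>x\<in>set ts. Binc u x * X v x)
        = list_mat vs vs (\<lambda>u v. \<Sum>z\<in>set vs. N u z * (if z = v then dt z else 0))"
      by (rule list_mat_cong) (simp add: XT ts vs fV if_distrib[of "\<lambda>t. _ * t"] cong: if_cong)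
    also have "det \<dots> = det (list_mat vs vs N) * det (list_mat vs vs (\<lambda>z v. if z = v then dt z else 0))"
      by (rule det_list_mat_mult) (use vs in auto)
    finally show ?thesis by (simp add: det_list_mat_diag vs(1) prod_dt)
  qed
  \<comment> \<open>For a representative \<open>u\<close>, multiplying by \<open>Q\<close> adds up
    the rows of its whole component. Both ends of an edge of \<open>T\<close> lie in the same
    component, so a column of the sum is either 0 or made of two signs, hence even.\<close>
  have dvd: "dt u dvd (\<Sum>z\<in>Vu. Q u z * Binc z x)" if u: "u \<in> Vu" and x: "x \<in> T" for u x
  proof (cases "u \<in> Vn \<and> rho u = u")
    case True
    have h: "x \<in> halfedges G" using x T_H H_halfedges by blast
    define f where "f z = (if z \<in> Vn \<and> rho z = u then 1 else 0 :: int)" for z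
    have "(\<Sum>z\<in>Vu. Q u z * Binc z x) = (\<Sum>z\<in>Vu. f z * Binc z x)"
      by (rule sum.cong) (use True in \<open>auto simp: Q_def E_def f_def\<close>)
    also have "\<dots> = f (rootv G (flip G x)) * sg (rootv Gt (flip Gt (lifth x))) - f (rootv G x) * sg (rootv Gt (lifth x))"
      using sum_sig[OF lifth_root(1)[OF h], of f] sum_sig[OF lifth_root(2)[OF h], of f]
      by (simp add: Binc_sig[OF h] right_diff_distrib sum_subtractf lifth_root[OF h])
    also have "even \<dots>"
    proof -
      have base_adj: "(rootv G x, rootv G (flip G x)) \<in> base_adj\<^sup>*" using base_adjI[OF T_H[OF x]] by blast
      have f: "f (rootv G (flip G x)) = f (rootv G x)"
        using rho_eq[OF base_adj] Vn_star[OF _ base_adj] Vn_star[OF _ base_adj_sym[OF base_adj]] by (auto simp: f_def)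
      have "odd (sg w)" if "w \<in> vertices Gt" "vmap p w \<in> Vn" for w
        using that Vn_Vu dilated_vertex_iff[of w] by (auto simp: sg_def Vu_def)
      moreover have "rootv G (flip G x) \<in> Vn" if "rootv G x \<in> Vn" using Vn_star[OF that base_adj] .
      ultimately have "even (sg (rootv Gt (flip Gt (lifth x))) - sg (rootv Gt (lifth x)))" if "rootv G x \<in> Vn"
        using that lifth_root[OF h] by simp
      then show ?thesis unfolding f by (simp add: f_def)
    qed
    finally show ?thesis using True by (simp add: dt_def)
  qed (auto simp: dt_def)
  define Y where "Y u x = (\<Sum>z\<in>Vu. Q u z * Binc z x) div dt u" for u x
  have 2: "det (list_mat vs vs Q) * detB = 2 ^ card (rho ` Vn) * det (list_mat vs ts Y)"
  proof -
    have "det (list_mat vs vs Q) * detB = det (list_mat vs ts (\<lambda>u x. \<Sum>z\<in>set vs. Q u z * Binc z x))"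
      unfolding detB_def by (rule det_list_mat_mult[symmetric]) (use vs ts in auto)
    also have "list_mat vs ts (\<lambda>u x. \<Sum>z\<in>set vs. Q u z * Binc z x) = list_mat vs ts (\<lambda>u x. dt u * Y u x)"
      by (rule list_mat_cong) (use dvd in \<open>auto simp: vs ts Y_def\<close>)
    finally show ?thesis unfolding det_list_mat_scale_rows[OF vs(1) ts(3)] prod_dt .
  qed
  let ?K = "2 ^ card (rho ` Vn) :: int"
  have a1: "\<bar>detB\<bar> * \<bar>det (list_mat ts vs (\<lambda>x v. X v x))\<bar> = ?K"
    using arg_cong[OF 1, of abs] absNQ by (simp add: abs_mult)
  have a2: "\<bar>detB\<bar> = ?K * \<bar>det (list_mat vs ts Y)\<bar>"
    using arg_cong[OF 2, of abs] absNQ by (simp add: abs_mult)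
  have "?K * (\<bar>det (list_mat vs ts Y)\<bar> * \<bar>det (list_mat ts vs (\<lambda>x v. X v x))\<bar>) = ?K * 1"
    using a1 unfolding a2 by (simp add: mult.assoc)
  then have "\<bar>det (list_mat vs ts Y)\<bar> * \<bar>det (list_mat ts vs (\<lambda>x v. X v x))\<bar> = 1"
    by simp
  then have "\<bar>det (list_mat vs ts Y)\<bar> = 1" by (auto simp: zmult_eq_1_iff)
  then show ?thesis using a2 by (simp add: detB_def)
qed

text \<open>If \<open>B_T\<close> is non-singular, no path outside the removed edges joins two dilation components:
  its lift would give a kernel vector.\<close>

lemma dilation_components_separated:
  assumes nz: "det (list_mat vs ts Binc) \<noteq> 0" and vs: "set vs = Vu"
    and ts: "distinct ts" "set ts = T" "length ts = length vs"
    and u: "u \<in> Vd" and u': "u' \<in> Vd" and uu': "(u, u') \<in> base_adj\<^sup>*"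
  shows "q u = q u'"
proof -
  have l: "liftv u \<in> vertices Gt" "vmap p (liftv u) = u" using u liftv by (auto simp: Vd_def)
  obtain w' where w': "(liftv u, w') \<in> top_adj\<^sup>*" "vmap p w' = u'" using base_adj_star_lift[OF uu' l] by blast
  obtain a where a: "\<forall>x. x \<notin> T \<longrightarrow> a x = 0"
    "\<forall>v\<in>Vu. (\<Sum>x\<in>U. Binc v x * a x) = sig v w' - sig v (liftv u)"
    "\<forall>z. even ((\<Sum>x\<in>U. Yinc z x * a x) -
      ((if q (vmap p w') = z then 1 else 0) - (if q (vmap p (liftv u)) = z then 1 else 0)))"
    using top_adj_path_sig[OF w'(1)] by blast
  have B0: "(\<Sum>x\<in>T. Binc v x * a x) = 0" if v: "v \<in> Vu" for v
  proof -
    have "(\<Sum>x\<in>U. Binc v x * a x) = (\<Sum>x\<in>T. Binc v x * a x)"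
      by (rule sum.mono_neutral_right[OF finite_U T_U]) (use a(1) in auto)
    moreover have "sig v w' = 0" "sig v (liftv u) = 0"
      using v u u' w' l vertices_split(2) by (auto simp: sig_def)
    ultimately show ?thesis using a(2) v by simp
  qed
  have "a x = 0" for x
  proof (rule ccontr)
    assume x: "a x \<noteq> 0"
    then have "x \<in> set ts" using a(1) ts(2) by auto
    then have "det (list_mat vs ts Binc) = 0"
      by (intro det_list_mat_right_kernel[where c = a and y = x]) (use ts B0 vs x in auto)
    then show False using nz by simp
  qed
  \<comment> \<open>With \<open>a = 0\<close> the parity clause at the class of \<open>u\<close>
    says that the path ends in the class in which it starts.\<close>
  then have "even ((if q u' = q u then 1 else 0) - (1::int))" using spec[OF a(3), of "q u"] w'(2) l(2) by simp
  then show ?thesis by (auto split: if_splits)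
qed

section \<open>Ogods and their rank in terms of the remaining graph\<close>

definition removed :: "'h set set" where
  "removed = edge_of G ` (U - T)"

lemma halfedges_delete: "halfedges (delete_edges G removed) = H"
proof -
  have *: "y \<in> A \<longleftrightarrow> flip G y \<notin> A" if "y \<in> halfedges G" for y
    using that orient_base unfolding orientation_def by blast
  have "x \<notin> \<Union>removed \<longleftrightarrow> x \<in> H" if x: "x \<in> halfedges G" for x
  proof -
    have "x \<in> \<Union>removed \<longleftrightarrow> (\<exists>y\<in>U - T. x = y \<or> x = flip G y)"
      by (auto simp: removed_def edge_of_def)
    also have "\<dots> \<longleftrightarrow> x \<in> U - T \<or> flip G x \<in> U - T"
      using base.flip_flip[OF x] base.flip_flip[OF U_halfedges] by (metis DiffD1)
    also have "\<dots> \<longleftrightarrow> x \<notin> H"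
      using *[OF x] x T_U base.edge_of_flip[OF x] by (auto simp: H_def U_def)
    finally show ?thesis by simp
  qed
  then have "halfedges G - \<Union>removed = H" using H_halfedges by blast
  then show ?thesis by (simp add: delete_edges_def)
qed

lemma delete_simps [simp]:
  "vertices (delete_edges G F) = vertices G" "rootv (delete_edges G F) = rootv G"
  "flip (delete_edges G F) = flip G"
  by (simp_all add: delete_edges_def)

lemma adjacency_delete: "adjacency (delete_edges G removed) = base_adj"
  unfolding adjacency_def halfedges_delete base_adj_def by simp

lemma components_delete: "components (delete_edges G removed) = (\<lambda>v. base_adj\<^sup>* `` {v}) ` vertices G"
  by (auto simp: components_def adjacency_delete quotient_def)

lemma ogod_rank_eq: "ogod_rank G removed = card (rho ` vertices G)"
proof -
  have 1: "(\<lambda>v. base_adj\<^sup>* `` {v}) ` vertices G = (\<lambda>v. base_adj\<^sup>* `` {v}) ` rho ` vertices G"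
  proof -
    have "base_adj\<^sup>* `` {rho v} = base_adj\<^sup>* `` {v}" for v
      by (auto simp: rho_eq_iff[symmetric] rho_idem)
    then show ?thesis by (simp add: image_image)
  qed
  have "inj_on (\<lambda>v. base_adj\<^sup>* `` {v}) (rho ` vertices G)"
  proof (rule inj_onI)
    fix u v assume uv: "u \<in> rho ` vertices G" "v \<in> rho ` vertices G" "base_adj\<^sup>* `` {u} = base_adj\<^sup>* `` {v}"
    then have "(u, v) \<in> base_adj\<^sup>*" by blast
    then show "u = v" using uv rho_eq rho_idem by fastforce
  qed
  then show ?thesis unfolding ogod_rank_def components_delete 1 by (rule card_image)
qed

lemma dil_adj_base_adj: "dil_adj \<subseteq> base_adj"
proof
  fix e assume "e \<in> dil_adj"
  then obtain x where x: "x \<in> halfedges G" "dilated_edge Gt p (edge_of G x)"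
    "fst e = rootv G x" "snd e = rootv G (flip G x)" by (metis dil_adjE prod.collapse)
  then have "x \<in> H" by (simp add: H_def)
  from base_adjI[OF this] x(3,4) show "e \<in> base_adj" by (metis prod.collapse)
qed

text \<open>A component of the remaining graph either avoids dilation, and is counted by
  \<open>Vn\<close>, or contains some dilation component, and by \<open>sep\<close> only one. This
  is where the exponent \<open>r(F) - d\<close> comes from.\<close>

lemma card_rho_vertices:
  assumes sep: "\<And>u u'. u \<in> Vd \<Longrightarrow> u' \<in> Vd \<Longrightarrow> (u, u') \<in> base_adj\<^sup>* \<Longrightarrow> q u = q u'"
  shows "card (rho ` vertices G) = card (rho ` Vn) + card R"
proof -
  have fin: "finite (vertices G)" by (rule base.finite_vertices)
  have Vn: "Vn \<subseteq> vertices G" using Vn_Vu by (auto simp: Vu_def)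
  have 1: "rho ` (vertices G - Vn) = rho ` R"
  proof (intro equalityI subsetI)
    fix z assume "z \<in> rho ` (vertices G - Vn)"
    then obtain v where v: "v \<in> vertices G" "v \<notin> Vn" "z = rho v" by auto
    have "\<exists>u\<in>Vd. (v, u) \<in> base_adj\<^sup>*" using v vertices_split by (cases "v \<in> Vd") (auto simp: Vn_def)
    then obtain u where u: "u \<in> Vd" "(v, u) \<in> base_adj\<^sup>*" by blast
    have "(u, q u) \<in> base_adj\<^sup>*" using q_star rtrancl_mono[OF dil_adj_base_adj] by blast
    then have "rho v = rho (q u)" using u rho_eq by (metis rtrancl_trans)
    then show "z \<in> rho ` R" using v u q_in_R by blast
  next
    fix z assume "z \<in> rho ` R"
    then obtain u where "u \<in> Vd" "z = rho u" using R_Vd by auto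
    then show "z \<in> rho ` (vertices G - Vn)" using Vn_Vu vertices_split by auto
  qed
  have "inj_on rho R"
  proof (rule inj_onI)
    fix u v assume uv: "u \<in> R" "v \<in> R" "rho u = rho v"
    then have "q u = q v" using sep R_Vd rho_eq_iff by blast
    then show "u = v" using q_R uv by simp
  qed
  then have 2: "card (rho ` R) = card R" by (rule card_image)
  have "rho ` vertices G = rho ` Vn \<union> rho ` (vertices G - Vn)" using Vn by blast
  moreover have "rho ` Vn \<inter> rho ` (vertices G - Vn) = {}"
    using rho_eq_iff Vn_star by blast
  ultimately show ?thesis
    using finite_subset[OF Vn fin] finite_R unfolding 1 by (simp add: card_Un_disjoint 2)
qed

text \<open>By path lifting every point above a component can be joined to the fibre of any other
  vertex of it; what remains is to join the two points of one fibre.\<close>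

lemma connected_preimage_iff:
  "(\<forall>C\<in>components (delete_edges G removed).
      connected_graph (preimage_graph Gt p (component_graph (delete_edges G removed) C))) \<longleftrightarrow> inv_connected"
proof -
  define P where "P C = preimage_graph Gt p (component_graph (delete_edges G removed) C)" for C
  have hP: "halfedges (component_graph (delete_edges G removed) C) = {x \<in> H. rootv G x \<in> C}" for C
    unfolding component_graph_def by (simp add: halfedges_delete)
  have vP: "vertices (P C) = {w \<in> vertices Gt. vmap p w \<in> C}" for C
    by (simp add: P_def preimage_graph_def component_graph_def)
  have aP: "adjacency (P C) = {(rootv Gt k, rootv Gt (flip Gt k)) | k.
      k \<in> halfedges Gt \<and> hmap p k \<in> H \<and> rootv G (hmap p k) \<in> C}" for C
    unfolding P_def adjacency_def preimage_graph_def hP by auto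
  have sub: "adjacency (P C) \<subseteq> top_adj" for C unfolding aP top_adj_def by blast
  \<comment> \<open>A path upstairs never leaves the preimage of the component in which it starts,
    so it is also a path of the preimage graph.\<close>
  have star: "(w, w') \<in> (adjacency (P (base_adj\<^sup>* `` {v})))\<^sup>*"
    if "(w, w') \<in> top_adj\<^sup>*" "vmap p w \<in> base_adj\<^sup>* `` {v}" for w w' v
    using that(1)
  proof (induction rule: rtrancl_induct)
    case (step y z)
    obtain k where k: "k \<in> halfedges Gt" "hmap p k \<in> H" "y = rootv Gt k" "z = rootv Gt (flip Gt k)"
      using step(2) by (rule top_adjE)
    have "(v, vmap p y) \<in> base_adj\<^sup>*" using that(2) top_adj_base_adj_star[OF step(1)] by (auto intro: rtrancl_trans)
    then have "(y, z) \<in> adjacency (P (base_adj\<^sup>* `` {v}))"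
      unfolding aP using k map_rootv[OF k(1)] by auto
    then show ?case using step(3) by (rule rtrancl_into_rtrancl[rotated])
  qed simp
  show ?thesis
    unfolding P_def[symmetric] components_delete
  proof
    assume *: "\<forall>C\<in>(\<lambda>v. base_adj\<^sup>* `` {v}) ` vertices G. connected_graph (P C)"
    show inv_connected unfolding inv_connected_def
    proof
      fix w assume w: "w \<in> vertices Gt"
      have "connected_graph (P (base_adj\<^sup>* `` {vmap p w}))" using * vmap_closed[OF w] by blast
      then have "(w, conjv w) \<in> (adjacency (P (base_adj\<^sup>* `` {vmap p w})))\<^sup>*"
        using w vfib_props[OF w] by (auto simp: connected_graph_def vP)
      then show "(w, conjv w) \<in> top_adj\<^sup>*" using rtrancl_mono[OF sub] by blast
    qed
  next
    assume *: inv_connected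
    show "\<forall>C\<in>(\<lambda>v. base_adj\<^sup>* `` {v}) ` vertices G. connected_graph (P C)"
    proof clarify
      fix v assume v: "v \<in> vertices G"
      have "liftv v \<in> vertices (P (base_adj\<^sup>* `` {v}))" using liftv[OF v] by (simp add: vP)
      moreover have "(w, w') \<in> (adjacency (P (base_adj\<^sup>* `` {v})))\<^sup>*"
        if w: "w \<in> vertices (P (base_adj\<^sup>* `` {v}))" and w': "w' \<in> vertices (P (base_adj\<^sup>* `` {v}))" for w w'
      proof (rule star)
        have ww: "w \<in> vertices Gt" "w' \<in> vertices Gt" "(v, vmap p w) \<in> base_adj\<^sup>*" "(v, vmap p w') \<in> base_adj\<^sup>*"
          using w w' by (auto simp: vP)
        have "(vmap p w, vmap p w') \<in> base_adj\<^sup>*" using ww(3,4) base_adj_sym by (meson rtrancl_trans)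
        then obtain z where z: "(w, z) \<in> top_adj\<^sup>*" "vmap p z = vmap p w'"
          using base_adj_star_lift[OF _ ww(1) refl] by blast
        have "z = w' \<or> z = conjv w'" using over_same_vertex[OF ww(2) top_adj_star_vertices[OF z(1) ww(1)] z(2)] .
        moreover have "(conjv w', w') \<in> top_adj\<^sup>*" using * ww(2) top_adj_sym by (auto simp: inv_connected_def)
        ultimately show "(w, w') \<in> top_adj\<^sup>*" using z(1) by (auto intro: rtrancl_trans)
        show "vmap p w \<in> base_adj\<^sup>* `` {v}" using ww(3) by simp
      qed
      ultimately show "connected_graph (P (base_adj\<^sup>* `` {v}))" by (auto simp: connected_graph_def)
    qed
  qed
qed

text \<open>A connected preimage makes the minor nonzero, which in turn separates the dilation
  components and allows the count of components. The inequality in the second claim says that the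
  natural subtraction in the exponent is exact.\<close>

lemma det_square:
  assumes vs: "distinct vs" "set vs = Vu" and ts: "distinct ts" "set ts = T" "length ts = length vs"
  shows "(det (list_mat vs ts Binc))\<^sup>2 = (if inv_connected then 4 ^ (ogod_rank G removed - card R) else 0)"
    and "inv_connected \<Longrightarrow> card R \<le> ogod_rank G removed"
proof -
  have *: "ogod_rank G removed = card (rho ` Vn) + card R" if inv_connected
    unfolding ogod_rank_eq
    by (rule card_rho_vertices, rule dilation_components_separated[OF _ vs(2) ts])
      (use abs_det_if_connected[OF that vs ts] in auto)
  show "inv_connected \<Longrightarrow> card R \<le> ogod_rank G removed" using * by simp
  show "(det (list_mat vs ts Binc))\<^sup>2 = (if inv_connected then 4 ^ (ogod_rank G removed - card R) else 0)"
  proof (cases inv_connected)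
    case True
    have "(det (list_mat vs ts Binc))\<^sup>2 = \<bar>det (list_mat vs ts Binc)\<bar>\<^sup>2" by simp
    also have "\<dots> = 4 ^ card (rho ` Vn)"
      unfolding abs_det_if_connected[OF True vs ts] by (simp add: power_even_eq power2_eq_square flip: power_mult_distrib)
    finally show ?thesis using True * by simp
  qed (simp add: det_zero_if_not_connected vs ts)
qed

end

section \<open>The sum over ogods\<close>

context oriented_cover
begin

lemma card_top_base:
  "card (edges G) = card A" "card (edges Gt) = card U + card A"
  "card (vertices G) = card Vu + card Vd" "card (vertices Gt) = 2 * card Vu + card Vd"
proof -
  show "card (edges G) = card A"
    using bij_betw_same_card[OF base.bij_betw_edge_of[OF orient_base]] by simp
  have UA: "U \<subseteq> A" using U_A by auto
  have "card (edges Gt) = card At"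
    using bij_betw_same_card[OF top.bij_betw_edge_of[OF orient_top]] by simp
  also have "\<dots> = 2 * card U + card (A - U)" using sum_At[of "\<lambda>_. 1::nat"] by simp
  also have "\<dots> = card U + card A"
    using UA finite_U card_mono[OF finite_A UA] by (simp add: card_Diff_subset)
  finally show "card (edges Gt) = card U + card A" .
  show "card (vertices G) = card Vu + card Vd"
    unfolding vertices_split(1) using finite_Vu finite_Vd vertices_split(2) by (rule card_Un_disjoint)
  show "card (vertices Gt) = 2 * card Vu + card Vd"
    using sum_Vt[of "\<lambda>_. 1"] by simp
qed

text \<open>Dilated edges and vertices occur equally often in both graphs, undilated ones once more
  upstairs.\<close>

lemma prym_dim_eq: "prym_dim Gt G = card U - card Vu"
  unfolding prym_dim_def genus_def card_top_base by simp

lemma ogod_iff: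
  assumes T: "T \<subseteq> U" "card T = card Vu"
  shows "ogod Gt G p (edge_of G ` (U - T)) \<longleftrightarrow> edge_subset.inv_connected Gt G p T"
proof -
  interpret es: edge_subset Gt G p At A T by unfold_locales (rule T(1))
  have "finite T" using T(1) finite_U finite_subset by blast
  have "inj_on (edge_of G) (U - T)"
    using base.bij_betw_edge_of[OF orient_base] U_A by (auto simp: bij_betw_def intro: inj_on_subset)
  then have "card (edge_of G ` (U - T)) = prym_dim Gt G"
    using T \<open>finite T\<close> by (simp add: card_image card_Diff_subset prym_dim_eq)
  moreover have "edge_of G ` (U - T) \<subseteq> edges G" using U_halfedges by (auto simp: edges_def)
  ultimately show ?thesis
    unfolding ogod_def es.connected_preimage_iff[symmetric] es.removed_def by (auto simp: U_def)
qed

lemma bij_betw_ogods: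
  "bij_betw (\<lambda>T. edge_of G ` (U - T))
     {T. (T \<subseteq> U \<and> card T = card Vu) \<and> ogod Gt G p (edge_of G ` (U - T))}
     {F. F \<subseteq> edges G \<and> ogod Gt G p F}"
proof (rule bij_betw_byWitness[where f' = "\<lambda>F. {x \<in> U. edge_of G x \<notin> F}"], goal_cases)
  have inj: "x = y" if "x \<in> U" "y \<in> U" "edge_of G x = edge_of G y" for x y
    using base.bij_betw_edge_of[OF orient_base] U_A that by (auto simp: bij_betw_def inj_on_def)
  {
    case 1
    show ?case using inj by (auto dest: subsetD)
  next
    have img: "edge_of G ` (U - {x \<in> U. edge_of G x \<notin> F}) = F" if F: "F \<subseteq> edges G" "ogod Gt G p F" for F
    proof -
      have "e \<in> edge_of G ` {x \<in> U. edge_of G x \<in> F}" if e: "e \<in> F" for e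
      proof -
        have "e \<in> edges G" "\<not> dilated_edge Gt p e" using F e by (auto simp: ogod_def)
        moreover obtain x where "x \<in> A" "e = edge_of G x"
          using base.bij_betw_edge_of[OF orient_base] \<open>e \<in> edges G\<close> by (auto simp: bij_betw_def)
        ultimately show ?thesis using e by (auto simp: U_def)
      qed
      moreover have "U - {x \<in> U. edge_of G x \<notin> F} = {x \<in> U. edge_of G x \<in> F}" by auto
      ultimately show ?thesis by auto
    qed
    {
      case 2
      show ?case using img by auto
    next
      case 3
      show ?case using U_halfedges by (auto simp: edges_def)
    next
      case 4
      show ?case
      proof (rule image_subsetI)
        fix F assume "F \<in> {F. F \<subseteq> edges G \<and> ogod Gt G p F}"
        then have F: "F \<subseteq> edges G" "ogod Gt G p F" by auto
        let ?T = "{x \<in> U. edge_of G x \<notin> F}"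
        have "card F = card (U - ?T)"
          using inj by (subst img[OF F, symmetric], intro card_image) (auto simp: inj_on_def)
        also have "\<dots> = card U - card ?T" using finite_U by (intro card_Diff_subset) auto
        finally have "card U - card ?T = card U - card Vu"
          using F(2) by (simp add: ogod_def prym_dim_eq)
        moreover have "card ?T \<le> card U" using finite_U by (intro card_mono) auto
        \<comment> \<open>The inequality \<open>card Vu \<le> card U\<close>, a consequence of the
          spanning tree, is needed to cancel in the truncated subtraction.\<close>
        moreover obtain bM bL :: "nat \<Rightarrow> 'h \<Rightarrow> int" where "card Vu \<le> card U"
          using lattice_bases_gram by metis
        ultimately have "card ?T = card Vu" by linarith
        then show "?T \<in> {T. (T \<subseteq> U \<and> card T = card Vu) \<and> ogod Gt G p (edge_of G ` (U - T))}"
          using F(2) img[OF F] by auto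
      qed
    }
  }
qed

text \<open>In exponents of 2 this is \<open>(c - 1) + 2 * (r - c) = (1 - c) + 2 * (r - 1)\<close>,
  with natural subtraction on the left and integers on the right.\<close>

lemma power_two_four:
  assumes "1 \<le> c" "c \<le> (r::nat)"
  shows "(2::real) ^ (c - 1) * 4 ^ (r - c) = 2 powi (1 - int c) * 4 powi (int r - 1)"
proof -
  obtain c' where c: "c = Suc c'" using assms(1) by (cases c) auto
  obtain s where r: "r = c + s" using assms(2) le_Suc_ex by blast
  have "2 powi (1 - int c) = (1 / 2 ^ c' :: real)"
    by (simp add: c power_int_minus divide_inverse)
  moreover have "4 powi (int r - 1) = (4 ^ (c' + s) :: real)"
    by (simp add: c r flip: power_int_of_nat)
  moreover have "(4::real) ^ c' = 2 ^ c' * 2 ^ c'" by (simp flip: power_mult_distrib)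
  ultimately show ?thesis by (simp add: c r power_add)
qed

text \<open>Cauchy-Binet supplies the inverse lengths of the edges in \<open>T\<close>; against the
  product over \<open>U\<close> they leave the lengths of the removed edges. The minors for which
  \<open>U - T\<close> is not an ogod vanish, and the remaining sets \<open>T\<close> correspond to
  the ogods by taking complements.\<close>

lemma ogod_sum:
  assumes vs: "distinct vs" "set vs = Vu"
  shows "2 ^ (card R - 1) * (\<Prod>x\<in>U. lenU x) * det (list_mat vs vs
      (\<lambda>v w. \<Sum>x\<in>U. of_int (Binc v x) * (1 / lenU x) * of_int (Binc w x)))
    = 2 powi (1 - int (card R)) * (\<Sum>F | F \<subseteq> edges G \<and> ogod Gt G p F.
       4 powi (int (ogod_rank G F) - 1) * (\<Prod>e\<in>F. len G e))"
proof -
  have "\<exists>xs. set xs = T \<and> distinct xs" if "T \<subseteq> U" for T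
    using finite_distinct_list[OF finite_subset[OF that finite_U]] by blast
  then obtain es where es: "\<And>T. T \<subseteq> U \<Longrightarrow> set (es T) = T \<and> distinct (es T)" by metis
  have lvs: "length vs = card Vu" using vs distinct_card by metis
  have c1: "1 \<le> card R" using x0 finite_R by (metis One_nat_def Suc_leI card_gt_0_iff empty_iff)
  let ?Ts = "{T. T \<subseteq> U \<and> card T = card Vu}"
  let ?F = "\<lambda>T. edge_of G ` (U - T)"
  let ?g = "\<lambda>F. 4 powi (int (ogod_rank G F) - 1) * (\<Prod>e\<in>F. len G e)"
  have finTs: "finite ?Ts" using finite_U by simp
  have base_adj: "det (list_mat vs vs (\<lambda>v w. \<Sum>x\<in>U. of_int (Binc v x) * (1 / lenU x) * of_int (Binc w x)))
    = (\<Sum>T\<in>?Ts. (\<Prod>x\<in>T. 1 / lenU x) * of_int (det (list_mat vs (es T) Binc)) *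
        (of_int (det (list_mat vs (es T) Binc)) :: real))"
    unfolding det_list_mat_of_int[symmetric] lvs[symmetric]
    by (rule cauchy_binet) (use finite_U es in auto)
  have "2 ^ (card R - 1) * (\<Prod>x\<in>U. lenU x) * det (list_mat vs vs
      (\<lambda>v w. \<Sum>x\<in>U. of_int (Binc v x) * (1 / lenU x) * of_int (Binc w x)))
    = (\<Sum>T\<in>?Ts. 2 ^ (card R - 1) * ((\<Prod>x\<in>U. lenU x) * (\<Prod>x\<in>T. 1 / lenU x)) *
        (of_int (det (list_mat vs (es T) Binc)))\<^sup>2)"
    unfolding base_adj sum_distrib_left
    by (simp add: power2_eq_square mult.assoc)
  also have "\<dots> = (\<Sum>T\<in>?Ts. if ogod Gt G p (?F T) then 2 powi (1 - int (card R)) * ?g (?F T) else 0)"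
  proof (rule sum.cong[OF refl])
    fix T assume "T \<in> ?Ts"
    then have T: "T \<subseteq> U" "card T = card Vu" by auto
    interpret es: edge_subset Gt G p At A T by unfold_locales (rule T(1))
    have ts: "distinct (es T)" "set (es T) = T" "length (es T) = length vs"
      using es[OF T(1)] T(2) lvs distinct_card[of "es T"] by auto
    have "(\<Prod>x\<in>U. lenU x) = (\<Prod>x\<in>U - T. lenU x) * (\<Prod>x\<in>T. lenU x)"
      by (rule prod.subset_diff[OF T(1) finite_U])
    moreover have "(\<Prod>x\<in>T. lenU x) * (\<Prod>x\<in>T. 1 / lenU x) = 1"
      unfolding prod.distrib[symmetric] using lenU_pos T(1) by (intro prod.neutral) force
    ultimately have 1: "(\<Prod>x\<in>U. lenU x) * (\<Prod>x\<in>T. 1 / lenU x) = (\<Prod>x\<in>U - T. lenU x)"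
      by (simp add: mult.assoc)
    have "inj_on (edge_of G) (U - T)"
      using base.bij_betw_edge_of[OF orient_base] U_A by (auto simp: bij_betw_def intro: inj_on_subset)
    then have 2: "(\<Prod>x\<in>U - T. lenU x) = (\<Prod>e\<in>?F T. len G e)"
      by (simp add: prod.reindex lenU_def)
    have 3: "ogod Gt G p (?F T) \<longleftrightarrow> es.inv_connected" by (rule ogod_iff[OF T])
    show "2 ^ (card R - 1) * ((\<Prod>x\<in>U. lenU x) * (\<Prod>x\<in>T. 1 / lenU x)) *
        (of_int (det (list_mat vs (es T) Binc)))\<^sup>2
      = (if ogod Gt G p (?F T) then 2 powi (1 - int (card R)) * ?g (?F T) else 0)"
    proof (cases es.inv_connected)
      case True
      have "(of_int (det (list_mat vs (es T) Binc)))\<^sup>2 = (4 ^ (ogod_rank G (?F T) - card R) :: real)"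
        using es.det_square(1)[OF vs ts] True
        by (metis es.removed_def of_int_numeral of_int_power)
      then show ?thesis
        using power_two_four[OF c1 es.det_square(2)[OF vs ts True]] True
        unfolding 1 2 3 es.removed_def by (simp add: mult_ac)
    next
      case False
      then have "det (list_mat vs (es T) Binc) = 0" using es.det_square(1)[OF vs ts] by simp
      then show ?thesis using False by (simp add: 3)
    qed
  qed
  also have "\<dots> = (\<Sum>T | (T \<subseteq> U \<and> card T = card Vu) \<and> ogod Gt G p (?F T). 2 powi (1 - int (card R)) * ?g (?F T))"
    by (rule sum.mono_neutral_cong_right) (use finTs in auto)
  also have "\<dots> = (\<Sum>F | F \<subseteq> edges G \<and> ogod Gt G p F. 2 powi (1 - int (card R)) * ?g F)"
    by (rule sum.reindex_bij_betw[OF bij_betw_ogods])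
  finally show ?thesis by (simp add: sum_distrib_left)
qed

end

section \<open>The Prym lattices\<close>

context metric_graph
begin

lemma lookup_frag_extend:
  assumes "finite S" "Poly_Mapping.keys f \<subseteq> S"
  shows "Poly_Mapping.lookup (frag_extend b f) v
    = (\<Sum>e\<in>S. Poly_Mapping.lookup f e * Poly_Mapping.lookup (b e) v)"
  unfolding frag_extend_def lookup_sum lookup_frag_cmul
  by (rule sum.mono_neutral_left) (use assms in \<open>auto simp: in_keys_iff\<close>)

lemma sum_edges:
  assumes "orientation G A"
  shows "(\<Sum>e\<in>edges G. g e) = (\<Sum>x\<in>A. g (edge_of G x))"
  using sum.reindex_bij_betw[OF bij_betw_edge_of[OF assms], of g] by simp

lemma lookup_boundary:
  assumes A: "orientation G A" and f: "Poly_Mapping.keys f \<subseteq> edges G"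
  shows "Poly_Mapping.lookup (boundary G A f) v = (\<Sum>x\<in>A. Poly_Mapping.lookup f (edge_of G x) *
      ((if rootv G (flip G x) = v then 1 else 0) - (if rootv G x = v then 1 else 0)))"
proof -
  have "the_elem (edge_of G x \<inter> A) = x" if "x \<in> A" for x
  proof -
    have "x \<in> halfedges G" "flip G x \<notin> A" using A that unfolding orientation_def by blast+
    then have "edge_of G x \<inter> A = {x}" using that by (auto simp: edge_of_def)
    then show ?thesis by simp
  qed
  then show ?thesis
    unfolding boundary_def lookup_frag_extend[OF finite_edges f] sum_edges[OF A]
    by (intro sum.cong) (auto simp: Let_def lookup_minus)
qed

lemma carrier_H1:
  "f \<in> carrier (H1 G A) \<longleftrightarrow> Poly_Mapping.keys f \<subseteq> edges G \<and> boundary G A f = 0"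
  by (simp add: H1_def kernel_def)

lemma H1_simps [simp]: "monoid.mult (H1 G A) = (+)" "\<one>\<^bsub>H1 G A\<^esub> = 0"
  by (simp_all add: H1_def free_Abelian_group_def)

lemma boundary_linear:
  "boundary G A (f + g) = boundary G A f + boundary G A g" "boundary G A (- f) = - boundary G A f"
  "boundary G A (frag_cmul n f) = frag_cmul n (boundary G A f)"
  by (simp_all only: boundary_def frag_extend_add frag_extend_minus frag_extend_cmul)

lemma H1_closed:
  "0 \<in> carrier (H1 G A)"
  "f \<in> carrier (H1 G A) \<Longrightarrow> g \<in> carrier (H1 G A) \<Longrightarrow> f + g \<in> carrier (H1 G A)"
  "f \<in> carrier (H1 G A) \<Longrightarrow> - f \<in> carrier (H1 G A)"
  "f \<in> carrier (H1 G A) \<Longrightarrow> frag_cmul n f \<in> carrier (H1 G A)"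
  unfolding carrier_H1 boundary_linear
  using keys_add[of f g] keys_cmul[of n f] by (auto simp: boundary_def)

lemma comm_group_H1: "comm_group (H1 G A)"
  by (rule comm_group_additive) (simp_all add: H1_closed)

end

context oriented_cover
begin

section \<open>Chains, pullback and pushforward in coordinates\<close>

abbreviation "Z1 \<equiv> carrier (H1 Gt At)"

text \<open>Coefficients are read on half-edges to match the functions used so far. Both halves of
  an edge give the same value; the orientation enters only through sums over
  \<open>At\<close>.\<close>

definition coeff_of :: "('k set \<Rightarrow>\<^sub>0 int) \<Rightarrow> 'k \<Rightarrow> int" where
  "coeff_of f k = Poly_Mapping.lookup f (edge_of Gt k)"

lemma coeff_of_linear:
  "coeff_of (f + g) k = coeff_of f k + coeff_of g k" "coeff_of (- f) k = - coeff_of f k" "coeff_of (frag_cmul n f) k = n * coeff_of f k" "coeff_of 0 k = 0"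
  by (simp_all add: coeff_of_def lookup_add)

lemma phi_coeff_of_linear:
  "phi (coeff_of (f + g)) x = phi (coeff_of f) x + phi (coeff_of g) x" "phi (coeff_of (- f)) x = - phi (coeff_of f) x"
  "phi (coeff_of (frag_cmul n f)) x = n * phi (coeff_of f) x"
  by (simp_all add: phi_def coeff_of_linear algebra_simps)

lemma bd_cong: "(\<And>k. k \<in> At \<Longrightarrow> c k = d k) \<Longrightarrow> bd c w = bd d w"
  by (simp add: bd_def)

lemma boundary_eq_0_iff:
  assumes "Poly_Mapping.keys f \<subseteq> edges Gt"
  shows "boundary Gt At f = 0 \<longleftrightarrow> (\<forall>w\<in>vertices Gt. bd (coeff_of f) w = 0)"
proof -
  have *: "Poly_Mapping.lookup (boundary Gt At f) w = bd (coeff_of f) w" for w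
    unfolding top.lookup_boundary[OF orient_top assms] bd_def inc_def coeff_of_def ..
  have "bd (coeff_of f) w = 0" if "w \<notin> vertices Gt" for w
    unfolding bd_def inc_def using that top.rootv_closed top.flip_closed At_iff
    by (intro sum.neutral) auto
  then show ?thesis
    using * by (metis lookup_zero poly_mapping_eqI)
qed

lemma Z1_iff: "f \<in> Z1 \<longleftrightarrow> Poly_Mapping.keys f \<subseteq> edges Gt \<and> (\<forall>w\<in>vertices Gt. bd (coeff_of f) w = 0)"
  using boundary_eq_0_iff by (auto simp: top.carrier_H1)

lemma frag_exists: "\<exists>f. Poly_Mapping.keys f \<subseteq> edges Gt \<and> (\<forall>k\<in>At. coeff_of f k = c k)"
proof -
  define f where "f = (\<Sum>k\<in>At. frag_cmul (c k) (frag_of (edge_of Gt k)))"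
  have inj: "inj_on (edge_of Gt) At" using top.bij_betw_edge_of[OF orient_top] by (simp add: bij_betw_def)
  have "coeff_of f k = c k" if "k \<in> At" for k
  proof -
    have "coeff_of f k = (\<Sum>l\<in>At. if l = k then c l else 0)"
      unfolding coeff_of_def f_def lookup_sum
      by (rule sum.cong) (use that inj in \<open>auto simp: inj_on_eq_iff\<close>)
    then show ?thesis using that finite_At by simp
  qed
  moreover have "Poly_Mapping.keys f \<subseteq> edges Gt"
    unfolding f_def using keys_sum[of "\<lambda>k. frag_cmul (c k) (frag_of (edge_of Gt k))" At]
    by (auto simp: keys_frag_of At_iff edges_def dest!: subsetD)
  ultimately show ?thesis by blast
qed

lemma frag_eqI:
  assumes "Poly_Mapping.keys f \<subseteq> edges Gt" "Poly_Mapping.keys g \<subseteq> edges Gt" "\<And>k. k \<in> At \<Longrightarrow> coeff_of f k = coeff_of g k"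
  shows "f = g"
proof (rule poly_mapping_eqI)
  fix e
  show "Poly_Mapping.lookup f e = Poly_Mapping.lookup g e"
  proof (cases "e \<in> edges Gt")
    case True
    then obtain k where "k \<in> At" "e = edge_of Gt k"
      using top.bij_betw_edge_of[OF orient_top] by (auto simp: bij_betw_def)
    then show ?thesis using assms(3) by (simp add: coeff_of_def)
  next
    case False
    then show ?thesis using assms(1,2) by (metis in_keys_iff subsetD)
  qed
qed

lemma emap_edge_of: "k \<in> halfedges Gt \<Longrightarrow> emap p (edge_of Gt k) = edge_of G (hmap p k)"
  by (simp add: emap_def edge_of_def map_flip)

lemma inj_edge_of: "inj_on (edge_of G) A"
  using base.bij_betw_edge_of[OF orient_base] by (simp add: bij_betw_def)

lemma keys_pushforward:
  assumes "Poly_Mapping.keys f \<subseteq> edges Gt"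
  shows "Poly_Mapping.keys (pushforward p f) \<subseteq> edges G"
proof -
  have "emap p e \<in> edges G" if "e \<in> edges Gt" for e
    using that emap_edge_of hmap_closed by (auto simp: edges_def)
  then show ?thesis
    using keys_frag_extend[of "\<lambda>et. frag_of (emap p et)" f] assms
    by (auto simp: pushforward_def keys_frag_of dest!: subsetD)
qed

lemma lookup_pushforward:
  assumes f: "Poly_Mapping.keys f \<subseteq> edges Gt" and x: "x \<in> A"
  shows "Poly_Mapping.lookup (pushforward p f) (edge_of G x) = (\<Sum>k\<in>hfib x. coeff_of f k)"
proof -
  have "Poly_Mapping.lookup (pushforward p f) (edge_of G x)
      = (\<Sum>k\<in>At. coeff_of f k * Poly_Mapping.lookup (frag_of (emap p (edge_of Gt k))) (edge_of G x))"
    unfolding pushforward_def top.lookup_frag_extend[OF top.finite_edges f] top.sum_edges[OF orient_top] coeff_of_def ..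
  also have "\<dots> = (\<Sum>k\<in>hfib x. coeff_of f k)"
    by (rule sum.mono_neutral_cong_right)
      (use x inj_edge_of in \<open>auto simp: finite_At At_iff emap_edge_of inj_on_eq_iff\<close>)
  finally show ?thesis .
qed

lemma keys_pullback: "Poly_Mapping.keys (pullback Gt p g) \<subseteq> edges Gt"
proof -
  have "Poly_Mapping.keys (\<Sum>et\<in>edge_fibre Gt p e. frag_of et) \<subseteq> edges Gt" for e
    using keys_sum[of frag_of "edge_fibre Gt p e"]
    by (auto simp: keys_frag_of edge_fibre_def dest!: subsetD)
  then have "Poly_Mapping.keys (let s = \<Sum>et\<in>edge_fibre Gt p e. frag_of et
      in if dilated_edge Gt p e then frag_cmul 2 s else s) \<subseteq> edges Gt" for e
    by (auto simp: Let_def dest!: subsetD)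
  then show ?thesis
    unfolding pullback_def by (intro subset_trans[OF keys_frag_extend] UN_least)
qed

text \<open>The two cases in the definition of the pullback are one formula, since the factor 2 at a
  dilated edge is the degree of its lift.\<close>

lemma coeff_of_pullback:
  assumes g: "Poly_Mapping.keys g \<subseteq> edges G" and k: "k \<in> At"
  shows "coeff_of (pullback Gt p g) k = int (edeg p (edge_of Gt k)) * Poly_Mapping.lookup g (edge_of G (hmap p k))"
proof -
  have h: "k \<in> halfedges Gt" "hmap p k \<in> A" using k by (auto simp: At_iff)
  have fin: "finite (edge_fibre Gt p e)" for e by (simp add: edge_fibre_def top.finite_edges)
  have "coeff_of (pullback Gt p g) k = (\<Sum>x\<in>A. Poly_Mapping.lookup g (edge_of G x) *
      Poly_Mapping.lookup (let s = \<Sum>et\<in>edge_fibre Gt p (edge_of G x). frag_of et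
      in if dilated_edge Gt p (edge_of G x) then frag_cmul 2 s else s) (edge_of Gt k))"
    unfolding coeff_of_def pullback_def base.lookup_frag_extend[OF base.finite_edges g] base.sum_edges[OF orient_base] ..
  also have "\<dots> = (\<Sum>x\<in>A. if x = hmap p k
      then Poly_Mapping.lookup g (edge_of G x) * (if dilated_edge Gt p (edge_of G x) then 2 else 1) else 0)"
  proof (rule sum.cong[OF refl])
    fix x assume x: "x \<in> A"
    have "edge_of Gt k \<in> edge_fibre Gt p (edge_of G x) \<longleftrightarrow> x = hmap p k"
      using x h inj_edge_of edge_of_top[OF h(1)] by (auto simp: edge_fibre_def emap_edge_of inj_on_eq_iff)
    then have *: "Poly_Mapping.lookup (\<Sum>et\<in>edge_fibre Gt p (edge_of G x). frag_of et) (edge_of Gt k)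
        = (if x = hmap p k then 1 else 0)"
      using fin[of "edge_of G x"] by (simp add: lookup_sum)
    show "Poly_Mapping.lookup g (edge_of G x) *
      Poly_Mapping.lookup (let s = \<Sum>et\<in>edge_fibre Gt p (edge_of G x). frag_of et
      in if dilated_edge Gt p (edge_of G x) then frag_cmul 2 s else s) (edge_of Gt k)
      = (if x = hmap p k
      then Poly_Mapping.lookup g (edge_of G x) * (if dilated_edge Gt p (edge_of G x) then 2 else 1) else 0)"
      using * by (cases "x = hmap p k"; cases "dilated_edge Gt p (edge_of G x)") (simp_all add: Let_def)
  qed
  also have "\<dots> = int (edeg p (edge_of Gt k)) * Poly_Mapping.lookup g (edge_of G (hmap p k))"
    using h finite_A dilated_edge_iff[OF h(1)] hfib_props(5)[OF h(1)] by simp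
  finally show ?thesis .
qed

definition pbZ :: "('k set \<Rightarrow>\<^sub>0 int) set" where
  "pbZ = pullback Gt p ` carrier (H1 G A)"

lemma pullback_linear:
  "pullback Gt p (f + g) = pullback Gt p f + pullback Gt p g" "pullback Gt p (- f) = - pullback Gt p f"
  by (simp_all only: pullback_def frag_extend_add frag_extend_minus)

lemma pullback_cycle:
  assumes "g \<in> carrier (H1 G A)"
  shows "pullback Gt p g \<in> Z1"
proof -
  have g: "Poly_Mapping.keys g \<subseteq> edges G" "boundary G A g = 0" using assms by (simp_all add: base.carrier_H1)
  let ?l = "\<lambda>x. Poly_Mapping.lookup g (edge_of G x)"
  have "bd (coeff_of (pullback Gt p g)) w = 0" if w: "w \<in> vertices Gt" for w
  proof -
    have "bd (coeff_of (pullback Gt p g)) w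
        = bd (\<lambda>k. \<Sum>x\<in>A. ?l x * (if hmap p k = x then int (edeg p (edge_of Gt k)) else 0)) w"
      by (rule bd_cong) (use finite_A in \<open>simp add: coeff_of_pullback[OF g(1)] At_iff
        if_distrib[of "\<lambda>t. _ * t"] cong: if_cong\<close>)
    also have "\<dots> = (\<Sum>x\<in>A. ?l x * bd (\<lambda>k. if hmap p k = x then int (edeg p (edge_of Gt k)) else 0) w)"
      unfolding bd_def sum_distrib_left sum_distrib_right by (subst sum.swap) (simp only: mult.assoc)
    also have "\<dots> = (\<Sum>x\<in>A. ?l x * (tau (rootv G (flip G x)) w - tau (rootv G x) w))"
      by (rule sum.cong) (simp_all add: bd_fibre w)
    also have "\<dots> = int (vdeg p w) * Poly_Mapping.lookup (boundary G A g) (vmap p w)"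
      unfolding base.lookup_boundary[OF orient_base g(1)] sum_distrib_left
      by (rule sum.cong) (auto simp: tau_def)
    finally show ?thesis using g(2) by simp
  qed
  then show ?thesis using keys_pullback by (simp add: Z1_iff)
qed

lemma pushforward_cycle:
  assumes "f \<in> Z1"
  shows "pushforward p f \<in> carrier (H1 G A)"
proof -
  have f: "Poly_Mapping.keys f \<subseteq> edges Gt" "\<And>w. w \<in> vertices Gt \<Longrightarrow> bd (coeff_of f) w = 0"
    using assms by (auto simp: Z1_iff)
  have "Poly_Mapping.lookup (boundary G A (pushforward p f)) v = 0" for v
  proof -
    let ?i = "\<lambda>x. (if rootv G (flip G x) = v then 1 else 0) - (if rootv G x = v then 1 else 0 :: int)"
    have "Poly_Mapping.lookup (boundary G A (pushforward p f)) v = (\<Sum>x\<in>A. (\<Sum>k\<in>hfib x. coeff_of f k) * ?i x)"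
      unfolding base.lookup_boundary[OF orient_base keys_pushforward[OF f(1)]]
      by (rule sum.cong) (simp_all add: lookup_pushforward[OF f(1)])
    also have "\<dots> = (\<Sum>x\<in>A. \<Sum>k\<in>{k \<in> At. hmap p k = x}. coeff_of f k * ?i (hmap p k))"
      by (intro sum.cong refl) (auto simp: sum_distrib_right At_iff intro!: sum.cong)
    also have "\<dots> = (\<Sum>k\<in>At. coeff_of f k * ?i (hmap p k))"
      by (rule sum.group) (auto simp: finite_At finite_A At_iff)
    also have "\<dots> = (\<Sum>k\<in>At. \<Sum>w\<in>vfib v. coeff_of f k * inc w k)"
    proof (rule sum.cong[OF refl])
      fix k assume "k \<in> At"
      then have k: "k \<in> halfedges Gt" by (simp add: At_iff)
      have "(\<Sum>w\<in>vfib v. inc w k) = ?i (hmap p k)"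
        using k top.finite_vertices top.rootv_closed top.flip_closed
        by (simp add: inc_def sum_subtractf map_rootv map_flip)
      then show "coeff_of f k * ?i (hmap p k) = (\<Sum>w\<in>vfib v. coeff_of f k * inc w k)"
        by (simp only: sum_distrib_left[symmetric])
    qed
    also have "\<dots> = (\<Sum>w\<in>vfib v. bd (coeff_of f) w)" unfolding bd_def by (rule sum.swap)
    also have "\<dots> = 0" using f(2) by simp
    finally show ?thesis .
  qed
  then show ?thesis using keys_pushforward[OF f(1)] by (simp add: base.carrier_H1 poly_mapping_eqI)
qed

lemma phi_pullback:
  assumes "g \<in> carrier (H1 G A)"
  shows "phi (coeff_of (pullback Gt p g)) x = 0"
proof (cases "x \<in> U")
  case True
  have g: "Poly_Mapping.keys g \<subseteq> edges G" using assms by (simp add: base.carrier_H1)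
  note l = lifth(1)[OF U_halfedges[OF True]]
  show ?thesis
    using coeff_of_pullback[OF g] U_lift[OF True] edeg_conjh[OF l] hfib_props(3)[OF l] by (simp add: phi_def)
qed (simp add: phi_def)

text \<open>An invariant cycle \<open>f\<close> satisfies \<open>2 f = pullback (pushforward f)\<close>, so the kernel of \<open>phi\<close> is the
  saturation of the image of the pullback.\<close>

lemma phi_eq_0_iff:
  assumes f: "f \<in> Z1"
  shows "(\<forall>x. phi (coeff_of f) x = 0) \<longleftrightarrow> (\<exists>n::nat. n > 0 \<and> frag_cmul (int n) f \<in> pbZ)"
proof
  assume phi0: "\<forall>x. phi (coeff_of f) x = 0"
  have keys: "Poly_Mapping.keys f \<subseteq> edges Gt" using f by (simp add: Z1_iff)
  have "frag_cmul 2 f = pullback Gt p (pushforward p f)"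
  proof (rule frag_eqI)
    show "Poly_Mapping.keys (frag_cmul 2 f) \<subseteq> edges Gt" using keys keys_cmul[of 2 f] by blast
    show "Poly_Mapping.keys (pullback Gt p (pushforward p f)) \<subseteq> edges Gt" by (rule keys_pullback)
    fix k assume k: "k \<in> At"
    then have h: "k \<in> halfedges Gt" "hmap p k \<in> A" by (auto simp: At_iff)
    have 1: "coeff_of (pullback Gt p (pushforward p f)) k = int (edeg p (edge_of Gt k)) * (\<Sum>l\<in>hfib (hmap p k). coeff_of f l)"
      using coeff_of_pullback[OF keys_pushforward[OF keys] k] lookup_pushforward[OF keys h(2)] by simp
    show "coeff_of (frag_cmul 2 f) k = coeff_of (pullback Gt p (pushforward p f)) k"
    proof (cases "conjh k = k")
      case True
      then show ?thesis unfolding 1 hfib_props(1)[OF h(1)] using hfib_props(5)[OF h(1)] by (simp add: coeff_of_linear)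
    next
      case False
      then have U: "hmap p k \<in> U" using dilated_edge_iff[OF h(1)] h(2) by (simp add: U_def)
      note l = lifth[OF A_halfedges[OF h(2)]]
      have "coeff_of f (lifth (hmap p k)) = coeff_of f (conjh (lifth (hmap p k)))"
        using spec[OF phi0, of "hmap p k"] U by (simp add: phi_def)
      then have "coeff_of f (conjh k) = coeff_of f k"
        using over_same_halfedge[OF l(1) h(1)] l(2) hfib_props(4)[OF l(1)] by auto
      then show ?thesis unfolding 1 hfib_props(1)[OF h(1)] using False hfib_props(5)[OF h(1)] by (simp add: coeff_of_linear)
    qed
  qed
  then show "\<exists>n::nat. n > 0 \<and> frag_cmul (int n) f \<in> pbZ"
    using pushforward_cycle[OF f] unfolding pbZ_def by (intro exI[of _ 2]) auto
next
  assume "\<exists>n::nat. n > 0 \<and> frag_cmul (int n) f \<in> pbZ"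
  then obtain n :: nat and g where n: "n > 0" "frag_cmul (int n) f = pullback Gt p g" "g \<in> carrier (H1 G A)"
    by (auto simp: pbZ_def)
  have "int n * phi (coeff_of f) x = 0" for x
    using phi_pullback[OF n(3), of x] phi_coeff_of_linear(3)[of "int n" f x] by (simp add: n(2))
  then show "\<forall>x. phi (coeff_of f) x = 0" using n(1) by simp
qed

lemma comm_group_Z1: "comm_group (H1 Gt At)"
  by (rule top.comm_group_H1)

lemma inv_Z1: "f \<in> Z1 \<Longrightarrow> inv\<^bsub>H1 Gt At\<^esub> f = - f"
  by (rule inv_additive) (simp_all add: comm_group.axioms(2)[OF comm_group_Z1] top.H1_closed)

lemma subgroup_pbZ: "subgroup pbZ (H1 Gt At)"
proof (rule group.subgroupI)
  show "group (H1 Gt At)" using comm_group_Z1 by (rule comm_group.axioms(2))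
  show "pbZ \<subseteq> Z1" using pullback_cycle by (auto simp: pbZ_def)
  show "pbZ \<noteq> {}" using base.H1_closed(1) by (auto simp: pbZ_def)
  show "inv\<^bsub>H1 Gt At\<^esub> a \<in> pbZ" if "a \<in> pbZ" for a
    using that pullback_cycle base.H1_closed(3)
    by (auto simp: pbZ_def inv_Z1 pullback_linear[symmetric])
  show "a \<otimes>\<^bsub>H1 Gt At\<^esub> b \<in> pbZ" if "a \<in> pbZ" "b \<in> pbZ" for a b
    using that base.H1_closed(2) by (auto simp: pbZ_def pullback_linear(1)[symmetric])
qed

section \<open>The lattice \<open>K\<close>\<close>

abbreviation "cokerK \<equiv> coker_pullback Gt G p At A"
abbreviation "prymK \<equiv> prym_K Gt G p At A"

lemma Ck_eq: "cokerK = H1 Gt At Mod pbZ"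
  by (simp add: coker_pullback_def pbZ_def)

lemma comm_group_cokerK: "comm_group cokerK"
  unfolding Ck_eq by (rule comm_group.abelian_FactGroup[OF comm_group_Z1 subgroup_pbZ])

lemma comm_group_prymK: "comm_group prymK"
  unfolding prym_K_def
  by (rule comm_group.abelian_FactGroup[OF comm_group_cokerK subgroup_torsion[OF comm_group_cokerK]])

definition q1 :: "('k set \<Rightarrow>\<^sub>0 int) \<Rightarrow> ('k set \<Rightarrow>\<^sub>0 int) set" where
  "q1 f = pbZ #>\<^bsub>H1 Gt At\<^esub> f"

definition q2 :: "('k set \<Rightarrow>\<^sub>0 int) \<Rightarrow> ('k set \<Rightarrow>\<^sub>0 int) set set" where
  "q2 f = torsion cokerK #>\<^bsub>cokerK\<^esub> q1 f"

lemma carrier_cokerK: "carrier cokerK = q1 ` Z1"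
  by (auto simp: Ck_eq FactGroup_def RCOSETS_def q1_def)

lemma carrier_prymK: "carrier prymK = q2 ` Z1"
proof -
  have "carrier prymK = (\<lambda>X. torsion cokerK #>\<^bsub>cokerK\<^esub> X) ` carrier cokerK"
    by (auto simp: prym_K_def FactGroup_def RCOSETS_def)
  then show ?thesis by (simp add: carrier_cokerK image_image q2_def)
qed

lemma q1_hom: "f \<in> Z1 \<Longrightarrow> g \<in> Z1 \<Longrightarrow> q1 (f + g) = q1 f \<otimes>\<^bsub>cokerK\<^esub> q1 g"
proof -
  assume "f \<in> Z1" "g \<in> Z1"
  moreover have "pbZ \<lhd> H1 Gt At"
    using comm_group.normal_iff_subgroup[OF comm_group_Z1] subgroup_pbZ by simp
  ultimately show ?thesis
    using hom_mult[OF normal.r_coset_hom_Mod, of pbZ "H1 Gt At" f g] by (simp add: q1_def Ck_eq)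
qed

lemma q2_hom: "f \<in> Z1 \<Longrightarrow> g \<in> Z1 \<Longrightarrow> q2 (f + g) = q2 f \<otimes>\<^bsub>prymK\<^esub> q2 g"
proof -
  assume fg: "f \<in> Z1" "g \<in> Z1"
  moreover have "torsion cokerK \<lhd> cokerK"
    using comm_group.normal_iff_subgroup[OF comm_group_cokerK] subgroup_torsion[OF comm_group_cokerK] by simp
  ultimately show ?thesis
    using hom_mult[OF normal.r_coset_hom_Mod, of "torsion cokerK" cokerK "q1 f" "q1 g"]
    by (simp add: q2_def prym_K_def q1_hom carrier_cokerK)
qed

lemma q1_pow: "f \<in> Z1 \<Longrightarrow> q1 f [^]\<^bsub>cokerK\<^esub> (n::nat) = q1 (frag_cmul (int n) f)"
proof (induction n)
  case 0
  have "q1 0 = \<one>\<^bsub>cokerK\<^esub>"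
    using subgroup.rcos_const[OF subgroup_pbZ comm_group.axioms(2)[OF comm_group_Z1] subgroup.one_closed[OF subgroup_pbZ]]
    by (simp add: q1_def Ck_eq)
  then show ?case by simp
next
  case (Suc n)
  have "q1 f [^]\<^bsub>cokerK\<^esub> Suc n = q1 (frag_cmul (int n) f + f)"
    using Suc by (simp add: q1_hom top.H1_closed)
  also have "frag_cmul (int n) f + f = frag_cmul (int (Suc n)) f"
    using frag_cmul_distrib[of "int n" 1 f] by (simp add: add.commute)
  finally show ?case .
qed

lemma q1_eq_iff: "f \<in> Z1 \<Longrightarrow> g \<in> Z1 \<Longrightarrow> q1 f = q1 g \<longleftrightarrow> f - g \<in> pbZ"
  unfolding q1_def
  using group.r_coset_eq_iff[OF comm_group.axioms(2)[OF comm_group_Z1] subgroup_pbZ, of f g]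
  by (simp add: inv_Z1)

lemma q1_torsion: "f \<in> Z1 \<Longrightarrow> q1 f \<in> torsion cokerK \<longleftrightarrow> (\<forall>x. phi (coeff_of f) x = 0)"
proof -
  assume f: "f \<in> Z1"
  have one: "\<one>\<^bsub>cokerK\<^esub> = q1 0" using q1_pow[OF f, of 0] by simp
  have "q1 f [^]\<^bsub>cokerK\<^esub> n = \<one>\<^bsub>cokerK\<^esub> \<longleftrightarrow> frag_cmul (int n) f \<in> pbZ" for n :: nat
    unfolding one q1_pow[OF f] using q1_eq_iff[of "frag_cmul (int n) f" 0] f top.H1_closed by simp
  then show ?thesis using f by (auto simp: torsion_def carrier_cokerK phi_eq_0_iff[OF f])
qed

lemma q1_minus: "f \<in> Z1 \<Longrightarrow> g \<in> Z1 \<Longrightarrow> q1 f \<otimes>\<^bsub>cokerK\<^esub> inv\<^bsub>cokerK\<^esub> q1 g = q1 (f - g)"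
proof -
  assume fg: "f \<in> Z1" "g \<in> Z1"
  have m: "- g \<in> Z1" using fg top.H1_closed by blast
  have "q1 (- g) \<otimes>\<^bsub>cokerK\<^esub> q1 g = q1 0" using q1_hom[OF m fg(2)] by simp
  also have "q1 0 = \<one>\<^bsub>cokerK\<^esub>" using q1_pow[OF fg(1), of 0] by simp
  finally have "inv\<^bsub>cokerK\<^esub> q1 g = q1 (- g)"
    using fg m by (intro group.inv_equality comm_group.axioms(2)[OF comm_group_cokerK]) (auto simp: carrier_cokerK)
  then show ?thesis using q1_hom[OF fg(1) m] by simp
qed

text \<open>Torsion of the cokernel consists of the classes with \<open>phi = 0\<close>, so dividing
  it out leaves the cycles modulo the kernel of \<open>phi\<close>, and \<open>phi\<close> descends
  to an injective map on \<open>K\<close>.\<close>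

lemma q2_eq_iff:
  assumes "f \<in> Z1" "g \<in> Z1"
  shows "q2 f = q2 g \<longleftrightarrow> phi (coeff_of f) = phi (coeff_of g)"
proof -
  have d: "f - g \<in> Z1" using top.H1_closed(2)[OF assms(1) top.H1_closed(3)[OF assms(2)]] by simp
  have "q2 f = q2 g \<longleftrightarrow> q1 f \<otimes>\<^bsub>cokerK\<^esub> inv\<^bsub>cokerK\<^esub> q1 g \<in> torsion cokerK"
    unfolding q2_def
    by (rule group.r_coset_eq_iff[OF comm_group.axioms(2)[OF comm_group_cokerK] subgroup_torsion[OF comm_group_cokerK]])
      (use assms in \<open>auto simp: carrier_cokerK\<close>)
  also have "\<dots> \<longleftrightarrow> (\<forall>x. phi (coeff_of (f - g)) x = 0)"
    unfolding q1_minus[OF assms] by (rule q1_torsion[OF d])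
  also have "\<dots> \<longleftrightarrow> phi (coeff_of f) = phi (coeff_of g)"
    using phi_coeff_of_linear(1)[where f = f and g = "- g"] by (auto simp: phi_coeff_of_linear(2) fun_eq_iff)
  finally show ?thesis .
qed

text \<open>The pairing on \<open>K\<close> quantifies over all representatives of a coset of
  cosets. They are precisely the cycles with the given differences, so a pairing that depends only
  on \<open>phi\<close> is well defined.\<close>

lemma Union_q2:
  assumes f: "f \<in> Z1"
  shows "\<Union> (q2 f) = {g \<in> Z1. phi (coeff_of g) = phi (coeff_of f)}"
proof -
  have "q2 f = {X \<in> carrier cokerK. torsion cokerK #>\<^bsub>cokerK\<^esub> X = q2 f}"
    unfolding q2_def
    by (rule group.r_coset_members[OF comm_group.axioms(2)[OF comm_group_cokerK] subgroup_torsion[OF comm_group_cokerK]])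
      (use f in \<open>auto simp: carrier_cokerK\<close>)
  also have "\<dots> = q1 ` {g \<in> Z1. phi (coeff_of g) = phi (coeff_of f)}"
    using q2_eq_iff[OF _ f] unfolding carrier_cokerK q2_def by auto
  finally have 1: "q2 f = q1 ` {g \<in> Z1. phi (coeff_of g) = phi (coeff_of f)}" .
  have q1: "q1 g = {h \<in> Z1. h - g \<in> pbZ}" if "g \<in> Z1" for g
  proof -
    have "q1 g = {h \<in> Z1. q1 h = q1 g}"
      unfolding q1_def by (rule group.r_coset_members[OF comm_group.axioms(2)[OF comm_group_Z1] subgroup_pbZ that])
    then show ?thesis using q1_eq_iff[OF _ that] by blast
  qed
  have 2: "phi (coeff_of h) = phi (coeff_of g)" if "g \<in> Z1" "h \<in> Z1" "h - g \<in> pbZ" for g h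
    using q1_eq_iff[OF that(2,1)] that q2_eq_iff[OF that(2,1)] by (simp add: q2_def)
  have 3: "g \<in> q1 g" if "g \<in> Z1" for g
    using group.rcos_self[OF comm_group.axioms(2)[OF comm_group_Z1] that subgroup_pbZ] by (simp add: q1_def)
  show ?thesis
    unfolding 1
  proof (intro equalityI subsetI)
    fix h assume "h \<in> \<Union> (q1 ` {g \<in> Z1. phi (coeff_of g) = phi (coeff_of f)})"
    then obtain g where g: "g \<in> Z1" "phi (coeff_of g) = phi (coeff_of f)" "h \<in> q1 g" by blast
    then have "h \<in> Z1" "h - g \<in> pbZ" using q1 by blast+
    then show "h \<in> {g \<in> Z1. phi (coeff_of g) = phi (coeff_of f)}" using 2[OF g(1)] g(2) by simp
  qed (use 3 in blast)
qed

definition PhiK :: "('k set \<Rightarrow>\<^sub>0 int) set set \<Rightarrow> 'h \<Rightarrow> int" where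
  "PhiK \<kappa> = phi (coeff_of (SOME c. c \<in> \<Union>\<kappa>))"

lemma PhiK_q2: "f \<in> Z1 \<Longrightarrow> PhiK (q2 f) = phi (coeff_of f)"
proof -
  assume f: "f \<in> Z1"
  then have "f \<in> \<Union> (q2 f)" by (simp add: Union_q2)
  then have "(SOME c. c \<in> \<Union> (q2 f)) \<in> \<Union> (q2 f)" by (rule someI)
  then show ?thesis using Union_q2[OF f] by (simp add: PhiK_def)
qed

lemma PhiK_image: "PhiK ` carrier prymK = latL"
proof -
  have "PhiK ` carrier prymK = (\<lambda>f. phi (coeff_of f)) ` Z1"
    unfolding carrier_prymK image_image by (rule image_cong) (simp_all add: PhiK_q2)
  also have "\<dots> = latL"
  proof (intro equalityI subsetI)
    fix a assume "a \<in> (\<lambda>f. phi (coeff_of f)) ` Z1"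
    then show "a \<in> latL" using phi_cycle_in_latL by (auto simp: Z1_iff)
  next
    fix a assume "a \<in> latL"
    then obtain c where c: "\<And>w. w \<in> vertices Gt \<Longrightarrow> bd c w = 0" "phi c = a" using latL_lift by blast
    obtain f where f: "Poly_Mapping.keys f \<subseteq> edges Gt" "\<forall>k\<in>At. coeff_of f k = c k" using frag_exists by blast
    have "bd (coeff_of f) w = bd c w" for w by (rule bd_cong) (use f in auto)
    then have "f \<in> Z1" using c(1) f(1) by (simp add: Z1_iff)
    moreover have "phi (coeff_of f) = a" unfolding c(2)[symmetric]
      by (rule ext) (use f(2) U_lift in \<open>auto simp: phi_def\<close>)
    ultimately show "a \<in> (\<lambda>f. phi (coeff_of f)) ` Z1" by blast
  qed
  finally show ?thesis .
qed

lemma Z_basis_prymK: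
  "Z_basis prymK n b \<longleftrightarrow> (\<forall>i<n. b i \<in> carrier prymK) \<and> lattice_basis latL n (\<lambda>i. PhiK (b i))"
proof (rule Z_basis_transport[OF comm_group_prymK _ _ PhiK_image])
  show "PhiK (x \<otimes>\<^bsub>prymK\<^esub> y) = (\<lambda>u. PhiK x u + PhiK y u)" if xy: "x \<in> carrier prymK" "y \<in> carrier prymK" for x y
  proof -
    obtain f g where fg: "f \<in> Z1" "x = q2 f" "g \<in> Z1" "y = q2 g" using xy by (auto simp: carrier_prymK)
    then show ?thesis
      using q2_hom[OF fg(1,3)] top.H1_closed(2)[OF fg(1,3)]
      by (auto simp: PhiK_q2 phi_coeff_of_linear simp flip: q2_hom)
  qed
  show "inj_on PhiK (carrier prymK)"
  proof (rule inj_onI)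
    fix x y assume "x \<in> carrier prymK" "y \<in> carrier prymK" "PhiK x = PhiK y"
    then obtain f g where "f \<in> Z1" "x = q2 f" "g \<in> Z1" "y = q2 g" "PhiK (q2 f) = PhiK (q2 g)"
      by (auto simp: carrier_prymK)
    then show "x = y" using q2_eq_iff[of f g] by (simp add: PhiK_q2)
  qed
qed

section \<open>The lattice \<open>K'\<close> and the pairing\<close>

abbreviation "prymK' \<equiv> prym_K' Gt G p At A"

text \<open>One coefficient and not the difference \<open>phi\<close>, which is twice as large on
  anti-invariant chains and would miss part of \<open>latM\<close>.\<close>

definition PsiK :: "('k set \<Rightarrow>\<^sub>0 int) \<Rightarrow> 'h \<Rightarrow> int" where
  "PsiK f x = (if x \<in> U then coeff_of f (lifth x) else 0)"

lemma carrier_prymK':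
  "f \<in> carrier prymK' \<longleftrightarrow> f \<in> Z1 \<and> (\<forall>x\<in>U. coeff_of f (conjh (lifth x)) = - coeff_of f (lifth x)) \<and> (\<forall>x\<in>A - U. coeff_of f (lifth x) = 0)"
proof -
  have "f \<in> carrier prymK' \<longleftrightarrow> f \<in> Z1 \<and> pushforward p f = 0"
    by (simp add: prym_K'_def kernel_def)
  also have "\<dots> \<longleftrightarrow> f \<in> Z1 \<and> (\<forall>x\<in>A. (\<Sum>k\<in>hfib x. coeff_of f k) = 0)"
  proof (rule conj_cong[OF refl])
    assume "f \<in> Z1"
    then have keys: "Poly_Mapping.keys f \<subseteq> edges Gt" by (simp add: Z1_iff)
    show "pushforward p f = 0 \<longleftrightarrow> (\<forall>x\<in>A. (\<Sum>k\<in>hfib x. coeff_of f k) = 0)"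
    proof
      assume 0: "\<forall>x\<in>A. (\<Sum>k\<in>hfib x. coeff_of f k) = 0"
      show "pushforward p f = 0"
      proof (rule poly_mapping_eqI)
        fix e
        show "Poly_Mapping.lookup (pushforward p f) e = Poly_Mapping.lookup 0 e"
        proof (cases "e \<in> edges G")
          case True
          then obtain x where "x \<in> A" "e = edge_of G x"
            using base.bij_betw_edge_of[OF orient_base] by (auto simp: bij_betw_def)
          then show ?thesis using 0 lookup_pushforward[OF keys] by simp
        next
          case False
          then show ?thesis using keys_pushforward[OF keys] by (metis in_keys_iff lookup_zero subsetD)
        qed
      qed
    qed (use lookup_pushforward[OF keys] in force)
  qed
  also have "\<dots> \<longleftrightarrow> f \<in> Z1 \<and> (\<forall>x\<in>U. coeff_of f (conjh (lifth x)) = - coeff_of f (lifth x)) \<and> (\<forall>x\<in>A - U. coeff_of f (lifth x) = 0)"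
  proof (rule conj_cong[OF refl])
    have 1: "(\<Sum>k\<in>hfib x. coeff_of f k) = coeff_of f (lifth x) + coeff_of f (conjh (lifth x))" if "x \<in> U" for x
      unfolding hfib_eq[OF U_halfedges[OF that]] using U_lift(3)[OF that] by (simp add: eq_commute)
    have 2: "(\<Sum>k\<in>hfib x. coeff_of f k) = coeff_of f (lifth x)" if "x \<in> A - U" for x
      using that dil_lift(2)[OF that] hfib_eq[OF A_halfedges, of x] by simp
    show "(\<forall>x\<in>A. (\<Sum>k\<in>hfib x. coeff_of f k) = 0) \<longleftrightarrow>
      (\<forall>x\<in>U. coeff_of f (conjh (lifth x)) = - coeff_of f (lifth x)) \<and> (\<forall>x\<in>A - U. coeff_of f (lifth x) = 0)" (is "?L \<longleftrightarrow> ?R")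
    proof
      assume ?L
      then have "(\<Sum>k\<in>hfib x. coeff_of f k) = 0" if "x \<in> A" for x using that by blast
      then show ?R using 1 2 U_A by (auto simp: eq_neg_iff_add_eq_0 add.commute)
    next
      assume R: ?R
      show ?L
      proof
        fix x assume "x \<in> A"
        then show "(\<Sum>k\<in>hfib x. coeff_of f k) = 0" using R 1[of x] 2[of x] by (cases "x \<in> U") auto
      qed
    qed
  qed
  finally show ?thesis .
qed

lemma prymK'_simps: "monoid.mult prymK' = (+)" "\<one>\<^bsub>prymK'\<^esub> = 0"
  by (simp_all add: prym_K'_def)

lemma comm_group_prymK': "comm_group prymK'"
  by (rule comm_group_additive)
    (auto simp: prymK'_simps carrier_prymK' top.H1_closed coeff_of_linear)

lemma PsiK_image: "PsiK ` carrier prymK' = latM"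
proof (intro equalityI subsetI)
  fix a assume "a \<in> PsiK ` carrier prymK'"
  then obtain f where f: "f \<in> carrier prymK'" "a = PsiK f" by blast
  have "(\<lambda>x. if x \<in> U then coeff_of f (lifth x) else 0) \<in> latM"
    by (rule anti_cycle_in_latM) (use f(1) in \<open>auto simp: carrier_prymK' Z1_iff\<close>)
  then show "a \<in> latM" unfolding f(2) PsiK_def .
next
  fix a assume a: "a \<in> latM"
  define c where "c k = (if hmap p k \<in> U then if k = lifth (hmap p k) then a (hmap p k) else - a (hmap p k) else 0)" for k
  have c: "c (lifth x) = a x" "c (conjh (lifth x)) = - a x" if "x \<in> U" for x
    using that lifth[OF U_halfedges[OF that]] hfib_props(3)[of "lifth x"] U_lift(3)[OF that]
    by (auto simp: c_def)
  have c0: "c (lifth x) = 0" if "x \<in> A - U" for x using that lifth(2)[OF A_halfedges, of x] by (simp add: c_def)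
  obtain f where f: "Poly_Mapping.keys f \<subseteq> edges Gt" "\<forall>k\<in>At. coeff_of f k = c k" using frag_exists by blast
  have "bd (coeff_of f) w = 0" if w: "w \<in> vertices Gt" for w
  proof -
    have "bd (coeff_of f) w = bd c w" by (rule bd_cong) (use f in auto)
    also have "\<dots> = 0" by (rule latM_lift[OF a _ _ w]) (use c c0 in auto)
    finally show ?thesis .
  qed
  then have "f \<in> carrier prymK'" using f c c0 U_lift dil_lift by (auto simp: carrier_prymK' Z1_iff)
  moreover have "PsiK f = a"
    by (rule ext) (use f(2) U_lift c a in \<open>auto simp: PsiK_def latM_def\<close>)
  ultimately show "a \<in> PsiK ` carrier prymK'" by blast
qed

lemma Z_basis_prymK':
  "Z_basis prymK' n b \<longleftrightarrow> (\<forall>i<n. b i \<in> carrier prymK') \<and> lattice_basis latM n (\<lambda>i. PsiK (b i))"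
proof (rule Z_basis_transport[OF comm_group_prymK' _ _ PsiK_image])
  show "PsiK (x \<otimes>\<^bsub>prymK'\<^esub> y) = (\<lambda>u. PsiK x u + PsiK y u)" for x y
    by (rule ext) (simp add: prymK'_simps PsiK_def coeff_of_linear)
  show "inj_on PsiK (carrier prymK')"
  proof (rule inj_onI)
    fix f g assume fg: "f \<in> carrier prymK'" "g \<in> carrier prymK'" "PsiK f = PsiK g"
    have lift: "coeff_of f (lifth x) = coeff_of g (lifth x)" if "x \<in> U" for x
      using fun_cong[OF fg(3), of x] that by (simp add: PsiK_def)
    show "f = g"
    proof (rule frag_eqI)
      fix k assume k: "k \<in> At"
      then have h: "k \<in> halfedges Gt" "hmap p k \<in> A" by (auto simp: At_iff)
      note l = lifth[OF A_halfedges[OF h(2)]]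
      have "k = lifth (hmap p k) \<or> k = conjh (lifth (hmap p k))"
        using over_same_halfedge[OF l(1) h(1)] l(2) by simp
      then show "coeff_of f k = coeff_of g k"
        using fg(1,2) lift h(2) dil_lift(2)[of "hmap p k"]
        unfolding carrier_prymK' by (cases "hmap p k \<in> U") (metis, metis DiffI)
    qed (use fg in \<open>auto simp: carrier_prymK' Z1_iff\<close>)
  qed
qed

text \<open>As \<open>g\<close> is anti-invariant, the terms of the two lifts combine into the
  difference of the coefficients of \<open>f\<close>. Both lifts have degree 1 and thus the length
  of the edge below, and \<open>g\<close> vanishes over dilated edges.\<close>

lemma edge_pairing_eq:
  assumes "g \<in> carrier prymK'"
  shows "edge_pairing Gt f g = (\<Sum>x\<in>U. of_int (phi (coeff_of f) x) * of_int (PsiK g x) * lenU x)"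
proof -
  have len: "len Gt (edge_of Gt k) = lenU (hmap p k)"
    if "k \<in> At" "conjh k \<noteq> k" for k
    using that map_len[OF edge_of_top, of k] hfib_props(5)[of k] by (simp add: At_iff emap_edge_of lenU_def)
  have "edge_pairing Gt f g = (\<Sum>k\<in>At. of_int (coeff_of f k) * of_int (coeff_of g k) * len Gt (edge_of Gt k))"
    unfolding edge_pairing_def top.sum_edges[OF orient_top] coeff_of_def ..
  also have "\<dots> = (\<Sum>x\<in>U. of_int (phi (coeff_of f) x) * of_int (PsiK g x) * lenU x) + (\<Sum>x\<in>A - U. 0)"
    unfolding sum_At
  proof (intro arg_cong2[of _ _ _ _ "(+)"] sum.cong refl)
    fix x assume x: "x \<in> U"
    note l = lifth[OF U_halfedges[OF x]] and c = hfib_props[OF lifth(1)[OF U_halfedges[OF x]]]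
    have "len Gt (edge_of Gt (lifth x)) = lenU x" "len Gt (edge_of Gt (conjh (lifth x))) = lenU x"
      using len[of "lifth x"] len[of "conjh (lifth x)"] U_lift[OF x] l c by auto
    then show "of_int (coeff_of f (lifth x)) * of_int (coeff_of g (lifth x)) * len Gt (edge_of Gt (lifth x)) +
      of_int (coeff_of f (conjh (lifth x))) * of_int (coeff_of g (conjh (lifth x))) * len Gt (edge_of Gt (conjh (lifth x)))
      = of_int (phi (coeff_of f) x) * of_int (PsiK g x) * lenU x"
      using assms x by (simp add: carrier_prymK' phi_def PsiK_def algebra_simps)
  next
    fix x assume "x \<in> A - U"
    then show "of_int (coeff_of f (lifth x)) * of_int (coeff_of g (lifth x)) * len Gt (edge_of Gt (lifth x)) = 0"
      using assms by (simp add: carrier_prymK')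
  qed
  finally show ?thesis by simp
qed

lemma prym_pairing_eq:
  assumes "\<kappa> \<in> carrier prymK" "g \<in> carrier prymK'"
  shows "prym_pairing Gt \<kappa> g = (\<Sum>x\<in>U. of_int (PhiK \<kappa> x) * of_int (PsiK g x) * lenU x)"
proof -
  obtain f where f: "f \<in> Z1" "\<kappa> = q2 f" using assms(1) by (auto simp: carrier_prymK)
  then have "f \<in> \<Union> \<kappa>" by (simp add: Union_q2)
  then show ?thesis
    unfolding prym_pairing_def f(2) PhiK_q2[OF f(1)]
    by (intro the_equality) (auto simp: Union_q2[OF f(1)] edge_pairing_eq[OF assms(2)])
qed

lemma pairing_matrix:
  assumes "\<And>i. i < n \<Longrightarrow> b i \<in> carrier prymK" "\<And>i. i < n \<Longrightarrow> d i \<in> carrier prymK'"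
  shows "mat n n (\<lambda>(i, j). prym_pairing Gt (b i) (d j)) = gram U lenU n (\<lambda>i. PhiK (b i)) (\<lambda>i. PsiK (d i))"
  unfolding gram_def by (rule eq_matI) (auto simp: prym_pairing_eq assms)

text \<open>Disposes of the absolute value in the definition of the volume.\<close>

lemma ogod_sum_nonneg:
  "0 \<le> 2 powi (1 - int (card R)) * (\<Sum>F | F \<subseteq> edges G \<and> ogod Gt G p F.
     4 powi (int (ogod_rank G F) - 1) * (\<Prod>e\<in>F. len G e))"
  by (intro mult_nonneg_nonneg sum_nonneg prod_nonneg)
    (auto intro: less_imp_le base.len_pos)

text \<open>The description needs both a witness and uniqueness. Pulling the bases of
  \<open>latL\<close> and \<open>latM\<close> back to \<open>K\<close> and \<open>K'\<close>
  provides the witness; any other pair of bases changes the determinant only by a sign.\<close>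

theorem prym_vol2_eq:
  "prym_vol2 Gt G p At A = 2 powi (1 - int (card R)) * (\<Sum>F | F \<subseteq> edges G \<and> ogod Gt G p F.
     4 powi (int (ogod_rank G F) - 1) * (\<Prod>e\<in>F. len G e))" (is "_ = ?V")
proof -
  let ?h = "card U - card Vu"
  obtain bM bL where b: "lattice_basis latM ?h bM" "lattice_basis latL ?h bL"
    and det: "\<And>vs. distinct vs \<Longrightarrow> set vs = Vu \<Longrightarrow> det (gram U lenU ?h bL bM)
      = 2 ^ (card R - 1) * (\<Prod>x\<in>U. lenU x) * det (list_mat vs vs
          (\<lambda>v w. \<Sum>x\<in>U. of_int (Binc v x) * (1 / lenU x) * of_int (Binc w x)))"
    by (rule lattice_bases_gram) (rule that)
  obtain vs where vs: "set vs = Vu" "distinct vs" using finite_distinct_list[OF finite_Vu] by blast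
  have "det (gram U lenU ?h bL bM) = ?V" unfolding det[OF vs(2,1)] by (rule ogod_sum[OF vs(2,1)])
  then have V: "\<bar>det (gram U lenU ?h bL bM)\<bar> = ?V" using ogod_sum_nonneg by simp
  have val: "\<bar>det (mat ?h ?h (\<lambda>(i, j). prym_pairing Gt (\<kappa> i) (\<mu> j)))\<bar> = ?V"
    if "Z_basis prymK ?h \<kappa>" "Z_basis prymK' ?h \<mu>" for \<kappa> \<mu>
  proof -
    have k: "\<And>i. i < ?h \<Longrightarrow> \<kappa> i \<in> carrier prymK" "lattice_basis latL ?h (\<lambda>i. PhiK (\<kappa> i))"
      and m: "\<And>i. i < ?h \<Longrightarrow> \<mu> i \<in> carrier prymK'" "lattice_basis latM ?h (\<lambda>i. PsiK (\<mu> i))"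
      using that by (simp_all add: Z_basis_prymK Z_basis_prymK')
    have "mat ?h ?h (\<lambda>(i, j). prym_pairing Gt (\<kappa> i) (\<mu> j))
        = gram U lenU ?h (\<lambda>i. PhiK (\<kappa> i)) (\<lambda>i. PsiK (\<mu> i))"
      by (rule pairing_matrix) (use k(1) m(1) in auto)
    then show ?thesis
      unfolding V[symmetric] using abs_det_gram_change[OF k(2) b(2) m(2) b(1)] by simp
  qed
  have "\<exists>x. x \<in> carrier prymK \<and> PhiK x = bL i" if "i < ?h" for i
    using lattice_basis_mem[OF b(2) that] unfolding PhiK_image[symmetric] by auto
  then obtain \<kappa> where \<kappa>: "\<And>i. i < ?h \<Longrightarrow> \<kappa> i \<in> carrier prymK \<and> PhiK (\<kappa> i) = bL i" by metis
  have "\<exists>x. x \<in> carrier prymK' \<and> PsiK x = bM i" if "i < ?h" for i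
    using lattice_basis_mem[OF b(1) that] unfolding PsiK_image[symmetric] by auto
  then obtain \<mu> where \<mu>: "\<And>i. i < ?h \<Longrightarrow> \<mu> i \<in> carrier prymK' \<and> PsiK (\<mu> i) = bM i" by metis
  have cong: "lattice_basis L ?h c \<longleftrightarrow> lattice_basis L ?h d" if "\<And>i. i < ?h \<Longrightarrow> c i = d i" for L c d
    unfolding lattice_basis_def using that by simp
  have ex: "Z_basis prymK ?h \<kappa>" "Z_basis prymK' ?h \<mu>"
    unfolding Z_basis_prymK Z_basis_prymK'
    using \<kappa> \<mu> b cong[of "\<lambda>i. PhiK (\<kappa> i)" bL latL] cong[of "\<lambda>i. PsiK (\<mu> i)" bM latM] by auto
  show ?thesis
    unfolding prym_vol2_def prym_dim_eq
    by (rule the_equality) (use ex val in \<open>auto intro!: exI[of _ \<kappa>] exI[of _ \<mu>]\<close>)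
qed

end

theorem theorem1p1:
  fixes Gt :: "('w, 'k) mgraph" and G :: "('v, 'h) mgraph"
    and p :: "('w, 'k, 'v, 'h) cover"
    and At :: "'k set" and A :: "'h set"
  assumes cover: "double_cover Gt G p"
    and connected: "connected_graph G"
    and dilated: "dilated_cover Gt G p"
    and orient_top: "orientation Gt At"
    and orient_base: "orientation G A"
    and orient_compatible: "compatible_orientation Gt p At A"
  shows "prym_vol2 Gt G p At A =
    2 powi (1 - int (card (components (dilation_subgraph Gt G p)))) *
    (\<Sum>F | F \<subseteq> edges G \<and> ogod Gt G p F.
       4 powi (int (ogod_rank G F) - 1) * (\<Prod>e\<in>F. len G e))"
proof -
  interpret oriented_cover Gt G p At A
    by (intro oriented_cover.intro oriented_cover_axioms.intro assms)
  show ?thesis unfolding card_R[symmetric] by (rule prym_vol2_eq)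
qed

end
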